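(* Let $r>6$ be an integer, let $M$ be a mesh of degree $r$, let $G_0 \subset M$ be a convex combinatorial disk, and let $G_{n+1} = T(G_n)$ for all $n\ge 0$. Let $v_0,e_0,f_0$ be the numbers of vertices, edges and interior faces of $G_0$, and for $n\ge1$ let $v_n,e_n,f_n$ be the numbers of vertices, edges and faces belonging to $G_n$ but not to $G_{n-1}$. Define $v_M = v_0 + \sum_{n=1}^{\infty} v_n$, $e_M = e_0 + \sum_{n=1}^{\infty} e_n$, $f_M = f_0 + \sum_{n=1}^{\infty} f_n$, where the infinite sums are Euler sums. Then these quantities do not depend on the choice of $G_0$; more precisely, $$v_M = \frac{-6}{r-6},\qquad e_M = \frac{-3r}{r-6},\qquad f_M = \frac{-2r}{r-6}.$$
   Context: All graphs are simple and undirected, considered with a fixed embedding in the plane. A mesh of degree $r$ is a connected infinite simple graph embedded in the Euclidean plane without edge crossings such that: every vertex has degree $r$; every face is a triangle, i.e. a region bounded by three distinct edges; and every bounded region of the plane contains only finitely many vertices and edges. For a simple cycle $C$ in $M$, the combinatorial disk with boundary $C$ is the subgraph $G$ of $M$ consisting of $C$ together with all vertices and edges of $M$ lying inside the region bounded by $C$. A combinatorial disk $G$ with boundary $C$ is convex if every vertex $w$ of $C$ satisfies $\deg_G(w) \leq 1 + \frac{r}{2}$. For a nonempty subgraph $G \subset M$, its expansion $T(G) = H$ is the subgraph of $M$ with vertex set $V_H = V_G \cup \{ w \in V_M \setminus V_G : w \text{ is adjacent in } M \text{ to some } u \in V_G\}$ and edge set consisting of all edges of $M$ with both endpoints in $V_H$.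 Euler sum: if $(x_n)_{n=1}^{\infty}$ satisfies $x_{n+2} = \gamma x_{n+1} - x_n$ for all $n\ge1$ with $\gamma\ne 2$, its Euler sum is $\sum_{n=1}^{\infty} x_n := \frac{(1-\gamma)x_1 + x_2}{2-\gamma}$ (the value at $t=1$ of the rational function equal to its generating function $\sum_{n\ge1}x_nt^n$). The sequences $(v_n)_{n\ge1},(e_n)_{n\ge1},(f_n)_{n\ge1}$ satisfy such a recurrence with $\gamma = r-4$, so their Euler sums are defined. *)

theory Defs
  imports "HOL-Analysis.Analysis"
begin

text \<open>The plane is modelled by the type complex. An embedded graph is given by a set V of
points (the vertices) and a set E of subsets of the plane (the edges); each edge is the image
of an arc joining two distinct vertices and meeting V only in its two endpoints.\<close>

definition is_edge :: "complex set \<Rightarrow> complex set \<Rightarrow> bool" where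
  "is_edge V e \<longleftrightarrow> (\<exists>g. arc g \<and> path_image g = e \<and>
      e \<inter> V = {pathstart g, pathfinish g})"

definition plane_graph :: "complex set \<Rightarrow> complex set set \<Rightarrow> bool" where
  "plane_graph V E \<longleftrightarrow> (\<forall>e\<in>E. is_edge V e) \<and>
     (\<forall>e1\<in>E. \<forall>e2\<in>E. e1 \<noteq> e2 \<longrightarrow> e1 \<inter> e2 \<subseteq> V \<and> e1 \<inter> V \<noteq> e2 \<inter> V)"

definition adj :: "complex set \<Rightarrow> complex set set \<Rightarrow> complex \<Rightarrow> complex \<Rightarrow> bool" where
  "adj V E u w \<longleftrightarrow> (\<exists>e\<in>E. e \<inter> V = {u, w})"

definition deg :: "complex set set \<Rightarrow> complex \<Rightarrow> nat" where
  "deg EG w = card {e\<in>EG. w \<in> e}"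

definition graph_connected :: "complex set \<Rightarrow> complex set set \<Rightarrow> bool" where
  "graph_connected V E \<longleftrightarrow> (\<forall>u\<in>V. \<forall>w\<in>V. (adj V E)\<^sup>*\<^sup>* u w)"

definition faces :: "complex set \<Rightarrow> complex set set \<Rightarrow> complex set set" where
  "faces V E = components (- (V \<union> \<Union>E))"

definition is_triangle_face :: "complex set set \<Rightarrow> complex set \<Rightarrow> bool" where
  "is_triangle_face E F \<longleftrightarrow> (\<exists>e1\<in>E. \<exists>e2\<in>E. \<exists>e3\<in>E.
      e1 \<noteq> e2 \<and> e1 \<noteq> e3 \<and> e2 \<noteq> e3 \<and> frontier F = e1 \<union> e2 \<union> e3)"

definition locally_finite :: "complex set \<Rightarrow> complex set set \<Rightarrow> bool" where
  "locally_finite V E \<longleftrightarrow> (\<forall>S. bounded S \<longrightarrow>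
      finite (V \<inter> S) \<and> finite {e\<in>E. e \<inter> S \<noteq> {}})"

definition mesh :: "nat \<Rightarrow> complex set \<Rightarrow> complex set set \<Rightarrow> bool" where
  "mesh r V E \<longleftrightarrow> plane_graph V E \<and> infinite V \<and> graph_connected V E \<and>
     (\<forall>w\<in>V. deg E w = r) \<and> (\<forall>F\<in>faces V E. is_triangle_face E F) \<and>
     locally_finite V E"

definition simple_cycle :: "complex set \<Rightarrow> complex set set \<Rightarrow> complex list \<Rightarrow> bool" where
  "simple_cycle V E cs \<longleftrightarrow> length cs \<ge> 3 \<and> distinct cs \<and> set cs \<subseteq> V \<and>
     (\<forall>i<length cs. adj V E (cs ! i) (cs ! ((i + 1) mod length cs)))"

definition cycle_edges :: "complex set \<Rightarrow> complex set set \<Rightarrow> complex list \<Rightarrow> complex set set" where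
  "cycle_edges V E cs = {e\<in>E. \<exists>i<length cs. e \<inter> V = {cs ! i, cs ! ((i + 1) mod length cs)}}"

definition cycle_image :: "complex set \<Rightarrow> complex set set \<Rightarrow> complex list \<Rightarrow> complex set" where
  "cycle_image V E cs = \<Union>(cycle_edges V E cs)"

definition comb_disk :: "complex set \<Rightarrow> complex set set \<Rightarrow> complex list \<Rightarrow> complex set \<times> complex set set" where
  "comb_disk V E cs =
     (let D = cycle_image V E cs \<union> inside (cycle_image V E cs)
      in (V \<inter> D, {e\<in>E. e \<subseteq> D}))"

definition convex_disk :: "nat \<Rightarrow> complex set \<Rightarrow> complex set set \<Rightarrow> complex list \<Rightarrow> bool" where
  "convex_disk r V E cs \<longleftrightarrow>
     (\<forall>w\<in>set cs. real (deg (snd (comb_disk V E cs)) w) \<le> 1 + real r / 2)"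

definition expansion :: "complex set \<Rightarrow> complex set set \<Rightarrow> complex set \<times> complex set set \<Rightarrow> complex set \<times> complex set set" where
  "expansion V E G =
     (let VH = fst G \<union> {w\<in>V. \<exists>u\<in>fst G. adj V E u w}
      in (VH, {e\<in>E. e \<inter> V \<subseteq> VH}))"

definition faces_of :: "complex set \<Rightarrow> complex set set \<Rightarrow> complex set \<times> complex set set \<Rightarrow> complex set set" where
  "faces_of V E G = {F\<in>faces V E. {e\<in>E. e \<subseteq> frontier F} \<subseteq> snd G}"

text \<open>Euler sum of a sequence (x_n)_{n>=1} satisfying x_{n+2} = g x_{n+1} - x_n.\<close>
definition lin_rec :: "real \<Rightarrow> (nat \<Rightarrow> real) \<Rightarrow> bool" where
  "lin_rec g x \<longleftrightarrow> (\<forall>n\<ge>1. x (n + 2) = g * x (n + 1) - x n)"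

definition euler_sum :: "real \<Rightarrow> (nat \<Rightarrow> real) \<Rightarrow> real" where
  "euler_sum g x = ((1 - g) * x 1 + x 2) / (2 - g)"

definition layer_count :: "('a \<Rightarrow> 'b set) \<Rightarrow> (nat \<Rightarrow> 'a) \<Rightarrow> nat \<Rightarrow> real" where
  "layer_count sel Gs n =
     (if n = 0 then real (card (sel (Gs 0))) else real (card (sel (Gs n) - sel (Gs (n - 1)))))"

end

theory Submission
  imports Defs
begin

text \<open>
  The vertices, edges and triangular faces of a mesh form a combinatorial surface in which every edge lies
  on two triangles and the link of every vertex is an \<open>r\<close>-cycle. By the Jordan curve theorem every simple
  cycle bounds a disk that can be cut along edges into smaller disks until only triangles remain. This yields
  Euler's formula for combinatorial disks, and it shows that closed walks lift to closed walks in every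
  combinatorial covering of the mesh, so that connected coverings are injective.

  Starting from the boundary walk of \<open>G\<^sub>0\<close>, attach abstractly one cyclic layer of triangles after the other,
  as if consecutive outer neighbours were all distinct. Convexity leaves every boundary vertex at least two
  outer neighbours, which is what makes the next layer well defined, and each new boundary vertex has
  one or two neighbours below it. The resulting complex covers the mesh, hence embeds into it, and so the
  layers really are the boundaries of the \<open>G\<^sub>n\<close>. If \<open>b n\<close> is the length of the \<open>n\<close>-th one, then counting
  edges and triangles around the vertices of \<open>G\<^sub>n\<close> gives \<open>b (n + 1) = (r - 4) b n - b (n - 1)\<close> and \<open>b n\<close>,
  \<open>2 b n + b (n - 1)\<close> and \<open>b n + b (n - 1)\<close> new vertices, edges and faces. Euler's formula for \<open>G\<^sub>0\<close>
  evaluates the sums.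
\<close>

section \<open>Arcs, Jordan curves and theta curves\<close>

definition arc_between :: "'a::topological_space set \<Rightarrow> 'a \<Rightarrow> 'a \<Rightarrow> bool" where
  "arc_between S a b \<longleftrightarrow> (\<exists>g. arc g \<and> path_image g = S \<and> pathstart g = a \<and> pathfinish g = b)"

lemma arc_betweenE:
  assumes "arc_between S a b"
  obtains g where "arc g" "path_image g = S" "pathstart g = a" "pathfinish g = b"
  using assms unfolding arc_between_def by blast

lemma arc_between_sym:
  assumes "arc_between S a b"
  shows "arc_between S b a"
  using assms unfolding arc_between_def
  by (metis arc_reversepath path_image_reversepath pathfinish_reversepath pathstart_reversepath)

lemma arc_between_join:
  assumes "arc_between S a b" "arc_between T b c" "S \<inter> T \<subseteq> {b}"
  shows "arc_between (S \<union> T) a c"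
proof -
  obtain g h where "arc g" "path_image g = S" "pathstart g = a" "pathfinish g = b"
    and "arc h" "path_image h = T" "pathstart h = b" "pathfinish h = c"
    using assms(1,2) by (elim arc_betweenE) blast
  then show ?thesis
    unfolding arc_between_def using assms(3)
    by (intro exI[of _ "g +++ h"]) (simp add: arc_join path_image_join)
qed

lemma arc_between_ends:
  assumes "arc_between S a b"
  shows "a \<in> S" "b \<in> S" "a \<noteq> b"
  using assms by (auto elim!: arc_betweenE dest: arc_distinct_ends)

lemma arc_between_imp_compact: "arc_between S a b \<Longrightarrow> compact S"
  using compact_arc_image by (auto elim: arc_betweenE)

lemma arc_between_imp_connected: "arc_between S a b \<Longrightarrow> connected S"
  using connected_arc_image by (auto elim: arc_betweenE)

lemma arc_between_imp_connected_Compl: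
  fixes S :: "'a::euclidean_space set"
  assumes "arc_between S a b" "2 \<le> DIM('a)"
  shows "connected (- S)"
  using assms connected_arc_complement by (auto elim!: arc_betweenE)

lemma
  fixes S :: "'a::real_normed_vector set"
  assumes "arc_between S a b"
  shows connected_arc_between_endless: "connected (S - {a, b})"
    and arc_between_endless_nonempty: "S - {a, b} \<noteq> {}"
    and arc_between_subset_closure_endless: "S \<subseteq> closure (S - {a, b})"
proof -
  obtain g where g: "arc g" "path_image g = S" "pathstart g = a" "pathfinish g = b"
    using assms by (rule arc_betweenE)
  have endless: "S - {a, b} = g ` {0<..<1}"
    using simple_path_endless[OF arc_imp_simple_path[OF g(1)]] g by simp
  show "connected (S - {a, b})"
    using connected_simple_path_endless[OF arc_imp_simple_path[OF g(1)]] g by simp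
  show "S - {a, b} \<noteq> {}"
    unfolding endless by auto
  have "continuous_on {0..1} g"
    using g(1) by (simp add: arc_def path_def)
  then have "g ` closure {0<..<1} \<subseteq> closure (g ` {0<..<1})"
    by (intro image_closure_subset) (use closure_subset[of "g ` {0<..<1}"] in auto)
  then show "S \<subseteq> closure (S - {a, b})"
    using g(2) by (simp add: endless path_image_def)
qed

lemma interior_arc_between:
  fixes S :: "'a::euclidean_space set"
  assumes "arc_between S a b" "2 \<le> DIM('a)"
  shows "interior S = {}"
proof (rule ccontr)
  assume nonempty: "interior S \<noteq> {}"
  obtain g where "arc g" "path_image g = S"
    using assms(1) by (rule arc_betweenE)
  then obtain h where "homeomorphism {0..1} S g h"
    by (metis homeomorphism_arc)
  then have "continuous_on S h" "inj_on h S"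
    by (auto simp: homeomorphism_def intro: inj_on_inverseI)
  then have "DIM('a) \<le> DIM(real)"
    using nonempty interior_subset[of S]
    by (intro invariance_of_dimension[of "interior S" h]) (auto intro: continuous_on_subset inj_on_subset)
  then show False
    using assms(2) by simp
qed

definition jordan_curve :: "complex set \<Rightarrow> bool" where
  "jordan_curve C \<longleftrightarrow> (\<exists>g. simple_path g \<and> pathfinish g = pathstart g \<and> path_image g = C)"

lemma
  assumes "jordan_curve C"
  shows inside_jordan_curve_nonempty: "inside C \<noteq> {}"
    and open_inside_jordan_curve: "open (inside C)"
    and connected_inside_jordan_curve: "connected (inside C)"
    and bounded_inside_jordan_curve: "bounded (inside C)"
    and frontier_inside_jordan_curve: "frontier (inside C) = C"
    and open_outside_jordan_curve: "open (outside C)"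
    and connected_outside_jordan_curve: "connected (outside C)"
    and unbounded_outside_jordan_curve: "\<not> bounded (outside C)"
    and frontier_outside_jordan_curve: "frontier (outside C) = C"
  using assms Jordan_inside_outside by (auto simp: jordan_curve_def)

lemma bounded_jordan_curve: "jordan_curve C \<Longrightarrow> bounded C"
  using bounded_simple_path_image by (auto simp: jordan_curve_def)

lemma closure_inside_jordan_curve: "jordan_curve C \<Longrightarrow> closure (inside C) = C \<union> inside C"
  using closure_Un_frontier[of "inside C"] by (simp add: frontier_inside_jordan_curve Un_commute)

lemma closure_outside_jordan_curve: "jordan_curve C \<Longrightarrow> closure (outside C) = C \<union> outside C"
  using closure_Un_frontier[of "outside C"] by (simp add: frontier_outside_jordan_curve Un_commute)

lemma jordan_curve_two_arcs:
  assumes "arc_between S a b" "arc_between T a b" "S \<inter> T \<subseteq> {a, b}"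
  shows "jordan_curve (S \<union> T)"
proof -
  obtain g where g: "arc g" "path_image g = S" "pathstart g = a" "pathfinish g = b"
    using assms(1) by (rule arc_betweenE)
  obtain h where h: "arc h" "path_image h = T" "pathstart h = b" "pathfinish h = a"
    using arc_between_sym[OF assms(2)] by (rule arc_betweenE)
  have "simple_path (g +++ h)"
    using g h assms(3) by (intro simple_path_join_loop) auto
  then show ?thesis
    unfolding jordan_curve_def using g h by (intro exI[of _ "g +++ h"]) (simp add: path_image_join)
qed

lemma connected_inside_or_outside:
  assumes "jordan_curve C" "connected X" "X \<inter> C = {}"
  shows "X \<subseteq> inside C \<or> X \<subseteq> outside C"
proof -
  have "X \<subseteq> inside C \<union> outside C"
    using assms(3) by auto
  then show ?thesis
    using connectedD[OF assms(2) open_inside_jordan_curve[OF assms(1)] open_outside_jordan_curve[OF assms(1)]]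
      inside_Int_outside by blast
qed

lemma same_side_of_jordan_curve:
  assumes C: "jordan_curve C" and A: "connected A" "A \<inter> C = {}" and B: "connected B" "B \<inter> C = {}"
    and touch: "A \<inter> closure B \<noteq> {}"
  shows "A \<subseteq> inside C \<longleftrightarrow> B \<subseteq> inside C"
proof -
  have meets: "S \<inter> B \<noteq> {}" if "open S" "A \<subseteq> S" for S
    using that touch open_Int_closure_eq_empty[OF that(1), of B] by blast
  show ?thesis
    using meets[OF open_inside_jordan_curve[OF C]] meets[OF open_outside_jordan_curve[OF C]]
      connected_inside_or_outside[OF C A] connected_inside_or_outside[OF C B]
      inside_Int_outside[of C] by blast
qed

lemma bounded_connected_eq_inside:
  assumes "jordan_curve C" "connected F" "F \<noteq> {}" "bounded F" "frontier F = C" "F \<inter> C = {}"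
  shows "F = inside C"
proof -
  have "\<not> F \<subseteq> outside C"
  proof
    assume "F \<subseteq> outside C"
    then have "outside C \<subseteq> F"
      using connected_Int_frontier[OF connected_outside_jordan_curve[OF assms(1)], of F] assms(3,5)
        outside_no_overlap[of C] by blast
    then show False
      using unbounded_outside_jordan_curve[OF assms(1)] assms(4) bounded_subset by blast
  qed
  then have "F \<subseteq> inside C"
    using connected_inside_or_outside[OF assms(1,2,6)] by blast
  moreover from this have "inside C \<subseteq> F"
    using connected_Int_frontier[OF connected_inside_jordan_curve[OF assms(1)], of F] assms(3,5)
      inside_no_overlap[of C] by blast
  ultimately show ?thesis
    by (rule subset_antisym)
qed

definition theta_curve :: "complex set \<Rightarrow> complex set \<Rightarrow> complex set \<Rightarrow> complex \<Rightarrow> complex \<Rightarrow> bool" where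
  "theta_curve S\<^sub>1 S\<^sub>2 S a b \<longleftrightarrow> arc_between S\<^sub>1 a b \<and> arc_between S\<^sub>2 a b \<and> arc_between S a b \<and>
     S\<^sub>1 \<inter> S\<^sub>2 \<subseteq> {a, b} \<and> S\<^sub>1 \<inter> S \<subseteq> {a, b} \<and> S\<^sub>2 \<inter> S \<subseteq> {a, b}"

lemma theta_curve_jordan_curves:
  assumes "theta_curve S\<^sub>1 S\<^sub>2 S a b"
  shows "jordan_curve (S\<^sub>1 \<union> S\<^sub>2)" "jordan_curve (S\<^sub>1 \<union> S)" "jordan_curve (S\<^sub>2 \<union> S)"
  using assms unfolding theta_curve_def by (blast intro: jordan_curve_two_arcs)+

lemma theta_curve_split_inside:
  assumes theta: "theta_curve S\<^sub>1 S\<^sub>2 S a b" and "S \<inter> inside (S\<^sub>1 \<union> S\<^sub>2) \<noteq> {}"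
  shows "inside (S\<^sub>1 \<union> S) \<inter> inside (S\<^sub>2 \<union> S) = {}"
    and "inside (S\<^sub>1 \<union> S) \<union> inside (S\<^sub>2 \<union> S) \<union> (S - {a, b}) = inside (S\<^sub>1 \<union> S\<^sub>2)"
proof -
  have arcs: "arc_between S\<^sub>1 a b" "arc_between S\<^sub>2 a b" "arc_between S a b"
    and Int: "S\<^sub>1 \<inter> S\<^sub>2 \<subseteq> {a, b}" "S\<^sub>1 \<inter> S \<subseteq> {a, b}" "S\<^sub>2 \<inter> S \<subseteq> {a, b}"
    using theta unfolding theta_curve_def by auto
  obtain g\<^sub>1 g\<^sub>2 g where paths:
    "simple_path g\<^sub>1" "path_image g\<^sub>1 = S\<^sub>1" "pathstart g\<^sub>1 = a" "pathfinish g\<^sub>1 = b"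
    "simple_path g\<^sub>2" "path_image g\<^sub>2 = S\<^sub>2" "pathstart g\<^sub>2 = a" "pathfinish g\<^sub>2 = b"
    "simple_path g" "path_image g = S" "pathstart g = a" "pathfinish g = b"
    using arcs arc_imp_simple_path unfolding arc_between_def by metis
  have "a \<noteq> b" "S\<^sub>1 \<inter> S\<^sub>2 = {a, b}" "S\<^sub>1 \<inter> S = {a, b}" "S\<^sub>2 \<inter> S = {a, b}"
    using Int arcs[THEN arc_between_ends(1)] arcs[THEN arc_between_ends(2)]
      arc_between_ends(3)[OF arcs(1)] by auto
  note split = split_inside_simple_closed_curve[of g\<^sub>1 a b g\<^sub>2 g, unfolded paths, OF paths(1) refl refl
      paths(5) refl refl paths(9) refl refl this assms(2)]
  show "inside (S\<^sub>1 \<union> S) \<inter> inside (S\<^sub>2 \<union> S) = {}"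
    using split by blast
  show "inside (S\<^sub>1 \<union> S) \<union> inside (S\<^sub>2 \<union> S) \<union> (S - {a, b}) = inside (S\<^sub>1 \<union> S\<^sub>2)"
    using split by blast
qed

lemma theta_curve_connected_split:
  assumes theta: "theta_curve S\<^sub>1 S\<^sub>2 S a b" "S \<inter> inside (S\<^sub>1 \<union> S\<^sub>2) \<noteq> {}"
    and T: "connected T" "T \<subseteq> inside (S\<^sub>1 \<union> S\<^sub>2)" "T \<inter> S = {}"
  shows "T \<subseteq> inside (S\<^sub>1 \<union> S) \<or> T \<subseteq> inside (S\<^sub>2 \<union> S)"
proof -
  have "open (inside (S\<^sub>1 \<union> S))" "open (inside (S\<^sub>2 \<union> S))"
    using theta_curve_jordan_curves[OF theta(1)] open_inside_jordan_curve by blast+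
  moreover have "T \<subseteq> inside (S\<^sub>1 \<union> S) \<union> inside (S\<^sub>2 \<union> S)"
    using T(2,3) theta_curve_split_inside(2)[OF theta] by blast
  ultimately show ?thesis
    using connectedD[OF T(1)] theta_curve_split_inside(1)[OF theta] by blast
qed

lemma theta_curve_inside_subset_outside:
  assumes theta: "theta_curve S\<^sub>1 S\<^sub>2 S a b"
    and outer: "S - {a, b} \<subseteq> outside (S\<^sub>1 \<union> S\<^sub>2)" and disjoint: "inside (S\<^sub>1 \<union> S) \<inter> S\<^sub>2 = {}"
  shows "inside (S\<^sub>1 \<union> S) \<subseteq> outside (S\<^sub>1 \<union> S\<^sub>2)"
proof -
  note curves = theta_curve_jordan_curves[OF theta]
  have "S - {a, b} \<noteq> {}"
    using theta arc_between_endless_nonempty unfolding theta_curve_def by blast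
  then obtain q where "q \<in> S" "q \<in> outside (S\<^sub>1 \<union> S\<^sub>2)"
    using outer by blast
  then have "outside (S\<^sub>1 \<union> S\<^sub>2) \<inter> closure (inside (S\<^sub>1 \<union> S)) \<noteq> {}"
    using closure_inside_jordan_curve[OF curves(2)] by blast
  then have "outside (S\<^sub>1 \<union> S\<^sub>2) \<inter> inside (S\<^sub>1 \<union> S) \<noteq> {}"
    using open_Int_closure_eq_empty[OF open_outside_jordan_curve[OF curves(1)]] by blast
  moreover have "inside (S\<^sub>1 \<union> S) \<subseteq> inside (S\<^sub>1 \<union> S\<^sub>2) \<or> inside (S\<^sub>1 \<union> S) \<subseteq> outside (S\<^sub>1 \<union> S\<^sub>2)"
  proof (rule connected_inside_or_outside[OF curves(1)])
    show "connected (inside (S\<^sub>1 \<union> S))"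
      using connected_inside_jordan_curve[OF curves(2)] .
    show "inside (S\<^sub>1 \<union> S) \<inter> (S\<^sub>1 \<union> S\<^sub>2) = {}"
      using disjoint inside_no_overlap[of "S\<^sub>1 \<union> S"] by blast
  qed
  ultimately show ?thesis
    using inside_Int_outside[of "S\<^sub>1 \<union> S\<^sub>2"] by blast
qed

lemma theta_curve_commute: "theta_curve S\<^sub>1 S\<^sub>2 S a b \<longleftrightarrow> theta_curve S\<^sub>2 S\<^sub>1 S a b"
  unfolding theta_curve_def by blast

lemma theta_curve_connected_Compl_disks:
  assumes theta: "theta_curve S\<^sub>1 S\<^sub>2 S a b"
    and disjoint: "inside (S\<^sub>1 \<union> S) \<inter> S\<^sub>2 = {}" "inside (S\<^sub>2 \<union> S) \<inter> S\<^sub>1 = {}"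
      "inside (S\<^sub>1 \<union> S) \<inter> inside (S\<^sub>2 \<union> S) = {}"
  shows "connected (- (closure (inside (S\<^sub>1 \<union> S)) \<union> closure (inside (S\<^sub>2 \<union> S))))"
proof (rule Janiszewski_connected)
  note curves = theta_curve_jordan_curves[OF theta]
  have arc: "arc_between S a b" and Int: "S\<^sub>1 \<inter> S\<^sub>2 \<subseteq> {a, b}"
    using theta unfolding theta_curve_def by auto
  have "closure (inside (S\<^sub>1 \<union> S)) \<inter> closure (inside (S\<^sub>2 \<union> S)) = S"
    unfolding closure_inside_jordan_curve[OF curves(2)] closure_inside_jordan_curve[OF curves(3)]
    using disjoint Int arc_between_ends(1,2)[OF arc] inside_no_overlap[of "S\<^sub>1 \<union> S"]
      inside_no_overlap[of "S\<^sub>2 \<union> S"] by blast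
  then show "connected (closure (inside (S\<^sub>1 \<union> S)) \<inter> closure (inside (S\<^sub>2 \<union> S)))"
    using arc_between_imp_connected[OF arc] by simp
  show "connected (- closure (inside (S\<^sub>1 \<union> S)))" "connected (- closure (inside (S\<^sub>2 \<union> S)))"
    using connected_outside_jordan_curve[OF curves(2)] connected_outside_jordan_curve[OF curves(3)]
    unfolding closure_inside_jordan_curve[OF curves(2)] closure_inside_jordan_curve[OF curves(3)]
      outside_inside .
qed (use theta_curve_jordan_curves[OF theta] in \<open>simp_all add: bounded_inside_jordan_curve\<close>)

text \<open>If the middle arc were outside, the two disks it borders would meet in an arc and, by Janiszewski's
  theorem, not separate the plane, although their union contains the Jordan curve of the other two arcs.\<close>
lemma theta_curve_middle_inside:
  assumes theta: "theta_curve S\<^sub>1 S\<^sub>2 S a b"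
    and disjoint: "inside (S\<^sub>1 \<union> S) \<inter> S\<^sub>2 = {}" "inside (S\<^sub>2 \<union> S) \<inter> S\<^sub>1 = {}"
      "inside (S\<^sub>1 \<union> S) \<inter> inside (S\<^sub>2 \<union> S) = {}"
  shows "S - {a, b} \<subseteq> inside (S\<^sub>1 \<union> S\<^sub>2)"
proof (rule ccontr)
  assume not_inside: "\<not> ?thesis"
  note curves = theta_curve_jordan_curves[OF theta]
  have arcs: "arc_between S\<^sub>1 a b" "arc_between S a b" and Int: "S\<^sub>1 \<inter> S \<subseteq> {a, b}" "S\<^sub>2 \<inter> S \<subseteq> {a, b}"
    using theta unfolding theta_curve_def by auto
  have "S - {a, b} \<subseteq> inside (S\<^sub>1 \<union> S\<^sub>2) \<or> S - {a, b} \<subseteq> outside (S\<^sub>1 \<union> S\<^sub>2)"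
    by (rule connected_inside_or_outside[OF curves(1) connected_arc_between_endless[OF arcs(2)]])
      (use Int in blast)
  with not_inside have outer: "S - {a, b} \<subseteq> outside (S\<^sub>1 \<union> S\<^sub>2)"
    by blast
  have disk_outside: "inside (S\<^sub>1 \<union> S) \<subseteq> outside (S\<^sub>1 \<union> S\<^sub>2)" "inside (S\<^sub>2 \<union> S) \<subseteq> outside (S\<^sub>1 \<union> S\<^sub>2)"
    using theta_curve_inside_subset_outside[OF theta outer disjoint(1)]
      theta_curve_inside_subset_outside[of S\<^sub>2 S\<^sub>1 S a b] theta outer disjoint(2)
    by (simp_all add: theta_curve_commute Un_commute)
  define D where "D = closure (inside (S\<^sub>1 \<union> S)) \<union> closure (inside (S\<^sub>2 \<union> S))"
  have D: "D = S\<^sub>1 \<union> S\<^sub>2 \<union> S \<union> inside (S\<^sub>1 \<union> S) \<union> inside (S\<^sub>2 \<union> S)"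
    unfolding D_def using curves by (auto simp: closure_inside_jordan_curve)
  have "inside (S\<^sub>1 \<union> S\<^sub>2) \<subseteq> - D"
    unfolding D using outer disk_outside arc_between_ends(1,2)[OF arcs(1)]
      inside_no_overlap[of "S\<^sub>1 \<union> S\<^sub>2"] inside_Int_outside[of "S\<^sub>1 \<union> S\<^sub>2"] by blast
  moreover have "- D \<subseteq> inside (S\<^sub>1 \<union> S\<^sub>2) \<or> - D \<subseteq> outside (S\<^sub>1 \<union> S\<^sub>2)"
    using theta_curve_connected_Compl_disks[OF theta disjoint]
    by (intro connected_inside_or_outside[OF curves(1)]) (auto simp: D D_def[symmetric])
  ultimately have "- D \<subseteq> inside (S\<^sub>1 \<union> S\<^sub>2)"
    using inside_jordan_curve_nonempty[OF curves(1)] inside_Int_outside[of "S\<^sub>1 \<union> S\<^sub>2"] by blast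
  then have "bounded (- D)"
    using bounded_inside_jordan_curve[OF curves(1)] bounded_subset by blast
  moreover have "bounded D"
    unfolding D_def using curves by (simp add: bounded_inside_jordan_curve bounded_closure)
  ultimately show False
    using cobounded_imp_unbounded by blast
qed

section \<open>Closed walks and periodic sequences\<close>

lemma successively_append_Cons_iff:
  "successively R (xs @ y # ys) \<longleftrightarrow> successively R (xs @ [y]) \<and> successively R (y # ys)"
  by (auto simp: successively_append_iff)

lemma successively_rev_symp:
  assumes "symp R"
  shows "successively R (rev xs) \<longleftrightarrow> successively R xs"
proof -
  have "(\<lambda>x y. R y x) = R"
    using assms by (auto simp: fun_eq_iff dest: sympD)
  then show ?thesis
    by (simp only: successively_rev)
qed

lemma nth_append_hd:
  assumes "i < length cs"
  shows "(cs @ [hd cs]) ! i = cs ! i" "(cs @ [hd cs]) ! Suc i = cs ! ((i + 1) mod length cs)"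
proof -
  have "cs \<noteq> []"
    using assms by auto
  then show "(cs @ [hd cs]) ! Suc i = cs ! ((i + 1) mod length cs)"
    using assms by (cases "Suc i = length cs") (auto simp: nth_append hd_conv_nth)
qed (use assms in \<open>simp add: nth_append\<close>)

definition graph_cycle :: "('a \<Rightarrow> 'a \<Rightarrow> bool) \<Rightarrow> 'a list \<Rightarrow> bool" where
  "graph_cycle R cs \<longleftrightarrow> length cs \<ge> 3 \<and> distinct cs \<and> successively R (cs @ [hd cs])"

lemma graph_cycle_iff_nth:
  "graph_cycle R cs \<longleftrightarrow>
     length cs \<ge> 3 \<and> distinct cs \<and> (\<forall>i<length cs. R (cs ! i) (cs ! ((i + 1) mod length cs)))"
  by (auto simp: graph_cycle_def successively_conv_nth nth_append_hd)

lemma graph_cycle_split: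
  assumes "graph_cycle R (x # p @ y # q)"
  shows "successively R (x # p @ [y])" "successively R (y # q @ [x])"
  using assms successively_append_Cons_iff[of R "x # p" y "q @ [x]"] by (simp_all add: graph_cycle_def)

lemma graph_cycle_split_iff:
  assumes "symp R"
  shows "graph_cycle R (x # p @ y # q) \<longleftrightarrow>
    successively R (x # p @ [y]) \<and> successively R (x # rev q @ [y]) \<and>
    distinct (x # p @ y # q) \<and> (p \<noteq> [] \<or> q \<noteq> [])"
proof -
  have "successively R ((x # p) @ y # (q @ [x])) \<longleftrightarrow>
      successively R ((x # p) @ [y]) \<and> successively R (y # q @ [x])"
    by (rule successively_append_Cons_iff)
  moreover have "successively R (y # q @ [x]) \<longleftrightarrow> successively R (x # rev q @ [y])"
    using successively_rev_symp[OF assms, of "y # q @ [x]"] by simp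
  moreover have "length (x # p @ y # q) \<ge> 3 \<longleftrightarrow> p \<noteq> [] \<or> q \<noteq> []"
    by (cases p; cases q) auto
  ultimately show ?thesis
    unfolding graph_cycle_def by auto
qed

lemma graph_cycle_rotate_iff: "graph_cycle R (xs @ [x]) \<longleftrightarrow> graph_cycle R (x # xs)"
proof (cases xs)
  case (Cons y ys)
  then show ?thesis
    using successively_append_Cons_iff[of R "y # ys" x "[y]"] by (auto simp: graph_cycle_def)
qed (simp add: graph_cycle_def)

lemma graph_cycleE:
  assumes "graph_cycle R cs"
  obtains x y zs where "cs = x # y # zs" "zs \<noteq> []" "R x y"
proof -
  obtain x y zs where "cs = x # y # zs"
    using assms unfolding graph_cycle_def by (cases cs; cases "tl cs") auto
  moreover have "zs \<noteq> []"
    using assms calculation by (auto simp: graph_cycle_def)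
  ultimately show ?thesis
    using that assms by (simp add: graph_cycle_def)
qed

lemma closed_path_cases:
  assumes "successively R (cs @ [hd cs])" "cs \<noteq> []" "distinct cs" and irrefl: "\<And>a. \<not> R a a"
  obtains (edge) a b where "cs = [a, b]" "R a b" | (cycle) "graph_cycle R cs"
proof -
  consider (long) "length cs \<ge> 3" | (singleton) a where "cs = [a]" | (pair) a b where "cs = [a, b]"
    using assms(2) by (cases cs; cases "tl cs"; cases "tl (tl cs)") auto
  then show ?thesis
  proof cases
    case long
    then show ?thesis
      using assms(1,3) cycle unfolding graph_cycle_def by blast
  qed (use assms(1) irrefl edge in auto)
qed

lemma successively_cut_loop:
  assumes "successively R (xs @ y # ys @ y # zs)"
  shows "successively R (y # ys @ [y])" "successively R (xs @ y # zs)"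
  using assms successively_append_Cons_iff[of R xs y "ys @ y # zs"]
    successively_append_Cons_iff[of R "y # ys" y zs] successively_append_Cons_iff[of R xs y zs] by simp_all

lemma closed_walk_induct [consumes 4, case_names trivial backtrack cycle splice]:
  assumes "successively R ws" "ws \<noteq> []" "last ws = hd ws"
    and irrefl: "\<And>a. \<not> R a a"
    and trivial: "\<And>a. P [a]"
    and backtrack: "\<And>a b. R a b \<Longrightarrow> P [a, b, a]"
    and cycle: "\<And>cs. graph_cycle R cs \<Longrightarrow> P (cs @ [hd cs])"
    and splice: "\<And>xs y ys zs. successively R (xs @ y # ys @ y # zs) \<Longrightarrow> P (y # ys @ [y]) \<Longrightarrow>
      P (xs @ y # zs) \<Longrightarrow> P (xs @ y # ys @ y # zs)"
  shows "P ws"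
  using assms(1-3)
proof (induction "length ws" arbitrary: ws rule: less_induct)
  case less
  obtain vs a where ws: "ws = vs @ [a]"
    using less.prems(2) by (metis append_butlast_last_id)
  consider (point) "vs = []" | (path) "vs \<noteq> []" "distinct vs"
    | (loop) xs y ys zs where "vs = xs @ y # ys @ y # zs"
    using not_distinct_decomp[of vs] by auto
  then show ?case
  proof cases
    case point
    then show ?thesis
      using ws trivial by simp
  next
    case path
    then have closed: "ws = vs @ [hd vs]"
      using less.prems(3) ws by simp
    then have "successively R (vs @ [hd vs])"
      using less.prems(1) by simp
    then show ?thesis
      using path irrefl unfolding closed by (cases rule: closed_path_cases) (auto intro: backtrack cycle)
  next
    case loop
    then have split: "ws = xs @ y # ys @ y # zs @ [a]"
      using ws by simp
    note walks = successively_cut_loop[OF less.prems(1)[unfolded split]]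
    have "P (y # ys @ [y])"
      using walks(1) by (intro less.hyps) (auto simp: split)
    moreover have "P (xs @ y # zs @ [a])"
      using walks(2) less.prems(3) by (intro less.hyps) (auto simp: split hd_append)
    ultimately show ?thesis
      using splice[of xs y ys "zs @ [a]"] less.prems(1) split by blast
  qed
qed

lemma int_step_induct:
  fixes P :: "int \<Rightarrow> bool"
  assumes "P 0" "\<And>i. P i \<longleftrightarrow> P (i + 1)"
  shows "P i"
proof (induction i rule: int_induct[of _ 0])
  case (step2 i)
  then show ?case
    using assms(2)[of "i - 1"] by simp
qed (use assms in auto)

lemma dvd_diff_small_imp_eq:
  fixes i j m :: int
  assumes "m dvd i - j" "\<bar>i - j\<bar> < m"
  shows "i = j"
  using assms dvd_imp_le_int[of "i - j" m] by auto

lemma dvd_diffE: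
  fixes i j m :: int
  assumes "m dvd i - j"
  obtains s where "i = j + m * s"
  using assms by (metis dvd_def add.commute diff_add_cancel)

lemma bij_betw_period:
  fixes f :: "int \<Rightarrow> 'a"
  assumes period: "\<And>i j. f i = f j \<longleftrightarrow> m dvd i - j" and "m > 0"
  shows "bij_betw f {k..<k + m} (range f)"
  unfolding bij_betw_def
proof
  show "inj_on f {k..<k + m}"
  proof
    fix i j assume "i \<in> {k..<k + m}" "j \<in> {k..<k + m}" "f i = f j"
    then show "i = j"
      using period by (intro dvd_diff_small_imp_eq[of m]) auto
  qed
  have "f i \<in> f ` {k..<k + m}" for i
  proof -
    have "f i = f (k + (i - k) mod m)"
      unfolding period by (metis diff_diff_eq minus_mod_eq_mult_div dvd_triv_left)
    then show ?thesis
      using \<open>m > 0\<close> by auto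
  qed
  then show "f ` {k..<k + m} = range f"
    by auto
qed

lemma card_range_period:
  fixes f :: "int \<Rightarrow> 'a"
  assumes "\<And>i j. f i = f j \<longleftrightarrow> m dvd i - j" "m > 0"
  shows "card (range f) = nat m"
  using bij_betw_same_card[OF bij_betw_period[OF assms, of 0]] by simp

lemma eq_iff_least_period_dvd:
  fixes f :: "int \<Rightarrow> 'a"
  assumes shift: "\<And>i j k. f i = f j \<Longrightarrow> f (i + k) = f (j + k)" and d: "d > 0" "f (int d) = f 0"
    and least: "\<And>e. 0 < e \<Longrightarrow> f (int e) = f 0 \<Longrightarrow> d \<le> e"
  shows "f i = f j \<longleftrightarrow> int d dvd i - j"
proof -
  have multiple: "f (k + int d * q) = f k" for k q
  proof (rule int_step_induct[where P = "\<lambda>q. f (k + int d * q) = f k"])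
    fix q
    have "f (int d + (k + int d * q)) = f (0 + (k + int d * q))"
      by (rule shift[OF d(2)])
    then show "f (k + int d * q) = f k \<longleftrightarrow> f (k + int d * (q + 1)) = f k"
      by (simp add: algebra_simps)
  qed simp
  show ?thesis
  proof
    assume "int d dvd i - j"
    then show "f i = f j"
      using multiple by (metis dvd_diffE)
  next
    assume "f i = f j"
    then have "f (i - j) = f 0"
      using shift[of i j "- j"] by simp
    then have "f ((i - j) mod int d) = f 0"
      using multiple[of "(i - j) mod int d" "(i - j) div int d"] by (simp add: mult.commute)
    moreover have "0 \<le> (i - j) mod int d" "(i - j) mod int d < int d"
      using d(1) by simp_all
    ultimately have "(i - j) mod int d = 0"
      using least[of "nat ((i - j) mod int d)"] by (cases "(i - j) mod int d = 0") auto
    then show "int d dvd i - j"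
      by (rule dvd_eq_mod_eq_0[THEN iffD2])
  qed
qed

lemma eq_iff_card_range_dvd:
  fixes f :: "int \<Rightarrow> 'a"
  assumes shift: "\<And>i j k. f i = f j \<Longrightarrow> f (i + k) = f (j + k)" and finite: "finite (range f)"
  shows "f i = f j \<longleftrightarrow> int (card (range f)) dvd i - j"
proof -
  have "\<not> inj f"
    using finite finite_imageD infinite_UNIV_int by blast
  then obtain i j where "i < j" "f i = f j"
    unfolding inj_def by (metis linorder_neqE)
  then have "0 < nat (j - i) \<and> f (int (nat (j - i))) = f 0"
    using shift[of j i "- i"] by simp
  then obtain d :: nat where d: "0 < d" "f (int d) = f 0"
    and least: "\<And>e. 0 < e \<Longrightarrow> f (int e) = f 0 \<Longrightarrow> d \<le> e"
    using LeastI_ex[of "\<lambda>d. 0 < d \<and> f (int d) = f 0"] Least_le[of "\<lambda>d. 0 < d \<and> f (int d) = f 0"] by blast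
  have period: "f i = f j \<longleftrightarrow> int d dvd i - j" for i j
    using shift d least by (rule eq_iff_least_period_dvd[where f = f])
  then have "card (range f) = d"
    using card_range_period[of f "int d"] d(1) by simp
  then show ?thesis
    using period by simp
qed

lemma bij_betw_int_orbit:
  assumes f: "bij_betw f S S" and "s \<in> S"
  obtains x :: "int \<Rightarrow> 'a" where "x 0 = s" "\<And>i. x i \<in> S" "\<And>i. x (i + 1) = f (x i)"
proof -
  define g where "g = inv_into S f"
  define x where "x i = (if i \<ge> 0 then (f ^^ nat i) s else (g ^^ nat (- i)) s)" for i
  have f_S: "(f ^^ n) s \<in> S" for n
    using f \<open>s \<in> S\<close> by (induction n) (auto simp: bij_betwE)
  have g_S: "(g ^^ n) s \<in> S" for n
    using bij_betw_inv_into[OF f] \<open>s \<in> S\<close> by (induction n) (auto simp: bij_betwE g_def)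
  have "x (i + 1) = f (x i)" for i
  proof (cases "i \<ge> 0")
    case True
    then show ?thesis
      by (simp add: x_def nat_add_distrib)
  next
    case False
    define n where "n = nat (- (i + 1))"
    have "f (g ((g ^^ n) s)) = (g ^^ n) s"
      using bij_betw_inv_into_right[OF f g_S] unfolding g_def .
    moreover have "nat (- i) = Suc n"
      using False by (simp add: n_def)
    then have "x i = g ((g ^^ n) s)"
      using False by (simp add: x_def)
    moreover have "x (i + 1) = (g ^^ n) s"
      using False by (cases "i = -1") (auto simp: x_def n_def)
    ultimately show ?thesis
      by simp
  qed
  then show ?thesis
    using f_S g_S by (intro that[of x]) (auto simp: x_def)
qed

definition cyclic_nth :: "'a list \<Rightarrow> int \<Rightarrow> 'a" where
  "cyclic_nth cs i = cs ! nat (i mod int (length cs))"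

lemma cyclic_nth_of_nat: "i < length cs \<Longrightarrow> cyclic_nth cs (int i) = cs ! i"
  by (simp add: cyclic_nth_def)

lemma cyclic_nth_succ_of_nat: "cyclic_nth cs (int i + 1) = cs ! ((i + 1) mod length cs)"
proof -
  have "(int i + 1) mod int (length cs) = int ((i + 1) mod length cs)"
    by (simp add: zmod_int add.commute)
  then show ?thesis
    by (simp add: cyclic_nth_def)
qed

lemma cyclic_nth_mod: "cyclic_nth cs (i mod int (length cs) + k) = cyclic_nth cs (i + k)"
  by (simp add: cyclic_nth_def mod_simps)

lemma cyclic_nthE:
  assumes "cs \<noteq> []"
  obtains j where "j < length cs" "cyclic_nth cs i = cs ! j"
    "cyclic_nth cs (i + 1) = cs ! ((j + 1) mod length cs)"
proof
  define j where "j = nat (i mod int (length cs))"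
  show "j < length cs" "cyclic_nth cs i = cs ! j"
    using assms unfolding j_def cyclic_nth_def by (simp_all add: nat_less_iff)
  have "int j = i mod int (length cs)"
    using assms unfolding j_def by simp
  then show "cyclic_nth cs (i + 1) = cs ! ((j + 1) mod length cs)"
    using cyclic_nth_succ_of_nat[of cs j] cyclic_nth_mod[of cs i 1] by simp
qed

lemma range_cyclic_nth:
  assumes "cs \<noteq> []"
  shows "range (cyclic_nth cs) = set cs"
proof
  show "range (cyclic_nth cs) \<subseteq> set cs"
    using assms by (metis cyclic_nthE image_subsetI nth_mem)
  show "set cs \<subseteq> range (cyclic_nth cs)"
    by (metis cyclic_nth_of_nat in_set_conv_nth rangeI subsetI)
qed

lemma cyclic_nth_eq_iff:
  assumes "distinct cs" "cs \<noteq> []"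
  shows "cyclic_nth cs i = cyclic_nth cs j \<longleftrightarrow> int (length cs) dvd i - j"
proof -
  have bounds: "0 \<le> k mod int (length cs)" "k mod int (length cs) < int (length cs)" for k
    using assms(2) by simp_all
  then have "nat (i mod int (length cs)) < length cs" "nat (j mod int (length cs)) < length cs"
    by (simp_all add: nat_less_iff)
  then have "cyclic_nth cs i = cyclic_nth cs j \<longleftrightarrow> i mod int (length cs) = j mod int (length cs)"
    unfolding cyclic_nth_def using nth_eq_iff_index_eq[OF assms(1)] bounds by (simp add: eq_nat_nat_iff)
  then show ?thesis
    by (simp add: mod_eq_dvd_iff)
qed

lemma graph_cycle_cyclic_nth: "graph_cycle R cs \<Longrightarrow> R (cyclic_nth cs i) (cyclic_nth cs (i + 1))"
  unfolding graph_cycle_iff_nth by (metis cyclic_nthE list.size(3) not_numeral_le_zero)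

section \<open>Edges and paths of a plane graph\<close>

locale embedded_graph =
  fixes V :: "complex set" and E :: "complex set set"
  assumes plane_graph: "plane_graph V E"
begin

abbreviation adjacent :: "complex \<Rightarrow> complex \<Rightarrow> bool" where
  "adjacent \<equiv> adj V E"

definition edge :: "complex \<Rightarrow> complex \<Rightarrow> complex set" where
  "edge u w = (THE e. e \<in> E \<and> e \<inter> V = {u, w})"

lemma edge_eqI: "e \<in> E \<Longrightarrow> e' \<in> E \<Longrightarrow> e \<inter> V = e' \<inter> V \<Longrightarrow> e = e'"
  using plane_graph unfolding plane_graph_def by metis

lemma edge_eqI_inner: "e \<in> E \<Longrightarrow> e' \<in> E \<Longrightarrow> p \<in> e \<Longrightarrow> p \<in> e' \<Longrightarrow> p \<notin> V \<Longrightarrow> e = e'"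
  using plane_graph unfolding plane_graph_def by blast

lemma edge_eq:
  assumes "e \<in> E" "e \<inter> V = {u, w}"
  shows "edge u w = e"
  unfolding edge_def using assms edge_eqI by (intro the_equality) metis+

lemma symp_adjacent: "symp adjacent"
  unfolding symp_def adj_def by (metis insert_commute)

lemmas adjacent_sym = sympD[OF symp_adjacent]

lemma edge_commute: "edge u w = edge w u"
  unfolding edge_def by (metis insert_commute)

lemma edgeE:
  assumes "e \<in> E"
  obtains u w where "adjacent u w" "e = edge u w"
proof -
  have "is_edge V e"
    using assms plane_graph unfolding plane_graph_def by simp
  then obtain u w where "e \<inter> V = {u, w}"
    unfolding is_edge_def by blast
  then have "adjacent u w" "e = edge u w"
    using assms edge_eq unfolding adj_def by auto
  then show ?thesis
    by (rule that)
qed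

lemma
  assumes "adjacent u w"
  shows edge_in_E: "edge u w \<in> E" and edge_Int_V: "edge u w \<inter> V = {u, w}"
    and arc_between_edge: "arc_between (edge u w) u w"
proof -
  obtain e where e: "e \<in> E" "e \<inter> V = {u, w}"
    using assms adj_def by blast
  then have "edge u w = e"
    by (rule edge_eq)
  with e show "edge u w \<in> E" "edge u w \<inter> V = {u, w}"
    by auto
  then obtain a b where "arc_between (edge u w) a b" "{a, b} = {u, w}"
    using plane_graph unfolding plane_graph_def is_edge_def arc_between_def by metis
  then show "arc_between (edge u w) u w"
    using arc_between_sym by (metis doubleton_eq_iff)
qed

lemma ends_in_edge:
  assumes "adjacent u w"
  shows "u \<in> edge u w" "w \<in> edge u w"
  using arc_between_ends(1,2)[OF arc_between_edge[OF assms]] .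

lemma adjacent_neq: "adjacent u w \<Longrightarrow> u \<noteq> w"
  using arc_between_edge arc_between_ends(3) by blast

lemma adjacent_in_V:
  assumes "adjacent u w"
  shows "u \<in> V" "w \<in> V"
  using edge_Int_V[OF assms] by blast+

lemma edge_eq_iff:
  assumes "adjacent u w" "adjacent u' w'"
  shows "edge u w = edge u' w' \<longleftrightarrow> {u, w} = {u', w'}"
  using assms by (metis edge_in_E edge_Int_V edge_eqI)

lemma edge_Int_Union:
  assumes "X \<subseteq> E" "e \<in> E" "e \<notin> X"
  shows "(e - V) \<inter> \<Union>X = {}"
  using assms edge_eqI_inner by blast

lemma edge_Int_edge:
  assumes "adjacent u w" "adjacent u' w'" "{u, w} \<noteq> {u', w'}"
  shows "edge u w \<inter> edge u' w' \<subseteq> {u, w} \<inter> {u', w'}"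
proof -
  have "edge u w \<noteq> edge u' w'"
    using assms edge_eq_iff by simp
  then have "(edge u w - V) \<inter> edge u' w' = {}"
    using edge_Int_Union[of "{edge u' w'}" "edge u w"] edge_in_E assms(1,2) by simp
  then show ?thesis
    using edge_Int_V[OF assms(1)] edge_Int_V[OF assms(2)] by blast
qed

lemma
  assumes "e \<in> E"
  shows connected_edge_minus_V: "connected (e - V)"
    and edge_minus_V_nonempty: "e - V \<noteq> {}"
    and edge_subset_closure: "e \<subseteq> closure (e - V)"
proof -
  obtain u w where uw: "adjacent u w" "e = edge u w"
    using assms by (rule edgeE)
  then have "e - V = e - {u, w}" "arc_between e u w"
    using edge_Int_V[OF uw(1)] arc_between_edge[OF uw(1)] by blast+
  then show "connected (e - V)" "e - V \<noteq> {}" "e \<subseteq> closure (e - V)"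
    using connected_arc_between_endless arc_between_endless_nonempty
      arc_between_subset_closure_endless by metis+
qed

lemma edge_inner_point:
  assumes "adjacent u w"
  obtains p where "p \<in> edge u w" "p \<notin> V"
  using edge_minus_V_nonempty[OF edge_in_E[OF assms]] that by blast

lemma edge_subset_Union: "X \<subseteq> E \<Longrightarrow> e \<in> E \<Longrightarrow> e \<subseteq> \<Union>X \<Longrightarrow> e \<in> X"
  using edge_Int_Union[of X e] edge_minus_V_nonempty[of e] by blast

lemma
  assumes "e \<in> E"
  shows compact_edge: "compact e" and connected_Compl_edge: "connected (- e)"
proof -
  obtain u w where "adjacent u w" "e = edge u w"
    using assms by (rule edgeE)
  then have "arc_between e u w"
    using arc_between_edge by blast
  then show "compact e" "connected (- e)"
    by (simp_all add: arc_between_imp_compact arc_between_imp_connected_Compl)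
qed

lemma edges_at_vertex:
  assumes "X \<subseteq> E" "w \<in> V"
  shows "{e \<in> X. w \<in> e} = edge w ` {u. adjacent w u \<and> edge w u \<in> X}"
proof
  show "{e \<in> X. w \<in> e} \<subseteq> edge w ` {u. adjacent w u \<and> edge w u \<in> X}"
  proof
    fix e assume e: "e \<in> {e \<in> X. w \<in> e}"
    then obtain u v where uv: "adjacent u v" "e = edge u v"
      using assms(1) by (blast elim: edgeE)
    then have "w = u \<or> w = v"
      using edge_Int_V[OF uv(1)] e assms(2) by blast
    then have "\<exists>x. adjacent w x \<and> e = edge w x"
      using uv adjacent_sym edge_commute by metis
    then show "e \<in> edge w ` {u. adjacent w u \<and> edge w u \<in> X}"
      using e by blast
  qed
  show "edge w ` {u. adjacent w u \<and> edge w u \<in> X} \<subseteq> {e \<in> X. w \<in> e}"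
    using ends_in_edge(1) by auto
qed

lemma card_adjacent_via:
  assumes "X \<subseteq> E" "w \<in> V"
  shows "card {u. adjacent w u \<and> edge w u \<in> X} = deg X w"
proof -
  have "inj_on (edge w) {u. adjacent w u \<and> edge w u \<in> X}"
    by (auto simp: inj_on_def edge_eq_iff doubleton_eq_iff)
  then show ?thesis
    unfolding deg_def edges_at_vertex[OF assms] by (rule card_image[symmetric])
qed

fun path_edges :: "complex list \<Rightarrow> complex set set" where
  "path_edges (x # y # zs) = insert (edge x y) (path_edges (y # zs))"
| "path_edges _ = {}"

definition boundary_edges :: "complex list \<Rightarrow> complex set set" where
  "boundary_edges cs = path_edges (cs @ [hd cs])"

lemma finite_path_edges: "finite (path_edges xs)"
  by (induction xs rule: path_edges.induct) auto

lemma path_edges_append_Cons: "path_edges (xs @ y # ys) = path_edges (xs @ [y]) \<union> path_edges (y # ys)"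
proof (induction xs)
  case (Cons x xs)
  then show ?case
    by (cases xs) auto
qed simp

lemma path_edges_rev: "path_edges (rev xs) = path_edges xs"
proof (induction xs rule: path_edges.induct)
  case (1 x y zs)
  have "path_edges (rev (x # y # zs)) = path_edges (rev zs @ [y]) \<union> path_edges [y, x]"
    using path_edges_append_Cons[of "rev zs" y "[x]"] by simp
  then show ?case
    using 1 edge_commute[of x y] by simp
qed auto

lemma path_edges_conv_nth: "path_edges xs = {edge (xs ! i) (xs ! Suc i) |i. Suc i < length xs}"
proof (induction xs rule: path_edges.induct)
  case (1 x y zs)
  have "{edge ((x # y # zs) ! i) ((x # y # zs) ! Suc i) |i. Suc i < length (x # y # zs)} =
    (\<lambda>i. edge ((x # y # zs) ! i) ((y # zs) ! i)) ` {..<Suc (length zs)}"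
    by auto
  also have "\<dots> = insert (edge x y) ((\<lambda>i. edge ((y # zs) ! i) (zs ! i)) ` {..<length zs})"
    unfolding lessThan_Suc_eq_insert_0 by (simp add: image_image)
  also have "(\<lambda>i. edge ((y # zs) ! i) (zs ! i)) ` {..<length zs} = path_edges (y # zs)"
    unfolding 1 by auto
  finally show ?case
    by simp
qed auto

lemma path_edges_subset_E: "successively adjacent xs \<Longrightarrow> path_edges xs \<subseteq> E"
  by (induction xs rule: path_edges.induct) (auto simp: edge_in_E)

lemma path_edges_Int_V: "successively adjacent xs \<Longrightarrow> e \<in> path_edges xs \<Longrightarrow> e \<inter> V \<subseteq> set xs"
proof (induction xs rule: path_edges.induct)
  case (1 x y zs)
  then show ?case
    using edge_Int_V[of x y] by (cases "e = edge x y") auto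
qed auto

lemma Union_path_edges_Int_V:
  "successively adjacent xs \<Longrightarrow> length xs \<ge> 2 \<Longrightarrow> \<Union>(path_edges xs) \<inter> V = set xs"
proof (induction xs rule: path_edges.induct)
  case (1 x y zs)
  then show ?case
    using edge_Int_V[of x y] by (cases zs) (simp_all add: Int_Un_distrib2 insert_commute)
qed auto

lemma first_edge_notin_path_edges:
  assumes "successively adjacent ys" "adjacent x y" "x \<notin> set ys"
  shows "edge x y \<notin> path_edges ys"
  using path_edges_Int_V[OF assms(1)] edge_Int_V[OF assms(2)] assms(3) by blast

lemma card_path_edges:
  "successively adjacent xs \<Longrightarrow> distinct xs \<Longrightarrow> card (path_edges xs) = length xs - 1"
proof (induction xs rule: path_edges.induct)
  case (1 x y zs)
  then have "edge x y \<notin> path_edges (y # zs)"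
    by (intro first_edge_notin_path_edges) auto
  then show ?case
    using 1 finite_path_edges by simp
qed auto

lemma arc_between_path:
  "successively adjacent xs \<Longrightarrow> distinct xs \<Longrightarrow> length xs \<ge> 2 \<Longrightarrow>
    arc_between (\<Union>(path_edges xs)) (hd xs) (last xs)"
proof (induction xs rule: path_edges.induct)
  case (1 x y zs)
  have xy: "adjacent x y"
    using 1 by auto
  show ?case
  proof (cases zs)
    case Nil
    then show ?thesis
      using arc_between_edge[OF xy] by simp
  next
    case (Cons z zs')
    have path: "successively adjacent (y # zs)"
      using 1 by simp
    have "edge x y \<notin> path_edges (y # zs)"
      using 1(3) by (intro first_edge_notin_path_edges[OF path xy]) auto
    then have "(edge x y - V) \<inter> \<Union>(path_edges (y # zs)) = {}"
      by (rule edge_Int_Union[OF path_edges_subset_E[OF path] edge_in_E[OF xy]])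
    moreover have "\<Union>(path_edges (y # zs)) \<inter> V = set (y # zs)"
      by (rule Union_path_edges_Int_V[OF path]) (simp add: Cons)
    ultimately have "edge x y \<inter> \<Union>(path_edges (y # zs)) \<subseteq> {x, y} \<inter> set (y # zs)"
      using edge_Int_V[OF xy] by blast
    then have "edge x y \<inter> \<Union>(path_edges (y # zs)) \<subseteq> {y}"
      using 1(3) by auto
    moreover have "arc_between (\<Union>(path_edges (y # zs))) y (last (y # zs))"
      using 1 Cons by simp
    ultimately show ?thesis
      using arc_between_join[OF arc_between_edge[OF xy]] by simp
  qed
qed auto

lemma end_edge_in_path_edges:
  assumes "successively adjacent (x # p @ [y])" "distinct (x # p @ [y])" "adjacent x y"
    and "edge x y \<in> path_edges (x # p @ [y])"
  shows "p = []"
proof (cases p)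
  case (Cons z p')
  have "successively adjacent (z # p' @ [y])" "adjacent x z"
    using assms(1) Cons by auto
  moreover from this have "edge x y \<notin> path_edges (z # p' @ [y])"
    using assms(2,3) Cons by (intro first_edge_notin_path_edges) auto
  ultimately have "{x, y} = {x, z}"
    using assms(3,4) Cons edge_eq_iff by simp
  then show ?thesis
    using assms(2) Cons by (auto simp: doubleton_eq_iff)
qed simp

lemma path_edges_Int:
  assumes p: "successively adjacent (x # p @ [y])" "distinct (x # p @ [y])"
    and m: "successively adjacent (x # m @ [y])" "distinct (x # m @ [y])"
    and disjoint: "set p \<inter> set m = {}" "p \<noteq> [] \<or> m \<noteq> []"
  shows "\<Union>(path_edges (x # p @ [y])) \<inter> \<Union>(path_edges (x # m @ [y])) \<subseteq> {x, y}"
proof -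
  have vertices: "set (x # p @ [y]) \<inter> set (x # m @ [y]) = {x, y}"
    using disjoint(1) p(2) m(2) by auto
  have "e \<notin> path_edges (x # m @ [y])" if e: "e \<in> path_edges (x # p @ [y])" for e
  proof
    assume e': "e \<in> path_edges (x # m @ [y])"
    obtain u w where uw: "adjacent u w" "e = edge u w"
      using e path_edges_subset_E[OF p(1)] by (blast elim: edgeE)
    have "{u, w} \<subseteq> {x, y}"
      using path_edges_Int_V[OF p(1) e] path_edges_Int_V[OF m(1) e'] vertices edge_Int_V uw by blast
    then have "{u, w} = {x, y}"
      using adjacent_neq[OF uw(1)] by blast
    then have "adjacent x y" "e = edge x y"
      using uw adjacent_sym edge_commute by (metis doubleton_eq_iff)+
    then show False
      using end_edge_in_path_edges[OF p] end_edge_in_path_edges[OF m] e e' disjoint(2) by blast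
  qed
  then have "\<Union>(path_edges (x # p @ [y])) \<inter> \<Union>(path_edges (x # m @ [y])) \<subseteq> V"
    using edge_eqI_inner path_edges_subset_E[OF p(1)] path_edges_subset_E[OF m(1)] by blast
  then show ?thesis
    using Union_path_edges_Int_V[OF p(1)] Union_path_edges_Int_V[OF m(1)] vertices by auto
qed

lemma boundary_edges_split:
  "boundary_edges (x # p @ y # q) = path_edges (x # p @ [y]) \<union> path_edges (x # rev q @ [y])"
  using path_edges_append_Cons[of "x # p" y "q @ [x]"] path_edges_rev[of "y # q @ [x]"]
  by (simp add: boundary_edges_def)

lemma boundary_edges_rotate:
  assumes "xs \<noteq> []"
  shows "boundary_edges (xs @ [x]) = boundary_edges (x # xs)"
proof -
  obtain y ys where "xs = y # ys"
    using assms by (cases xs) auto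
  then show ?thesis
    unfolding boundary_edges_def using path_edges_append_Cons[of "y # ys" x "[y]"] by auto
qed

lemma boundary_edges_conv_nth:
  "boundary_edges cs = {edge (cs ! i) (cs ! ((i + 1) mod length cs)) |i. i < length cs}"
  unfolding boundary_edges_def path_edges_conv_nth using nth_append_hd[of _ cs] by force

lemma boundary_edges_subset_E: "graph_cycle adjacent cs \<Longrightarrow> boundary_edges cs \<subseteq> E"
  unfolding boundary_edges_def graph_cycle_def using path_edges_subset_E by blast

lemma Union_boundary_edges_Int_V:
  assumes "graph_cycle adjacent cs"
  shows "\<Union>(boundary_edges cs) \<inter> V = set cs"
  using Union_path_edges_Int_V[of "cs @ [hd cs]"] assms
  unfolding graph_cycle_def boundary_edges_def by (cases cs) auto

lemma jordan_curve_boundary: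
  assumes cycle: "graph_cycle adjacent cs"
  shows "jordan_curve (\<Union>(boundary_edges cs))"
proof -
  obtain x y q where cs: "cs = x # [] @ y # q"
    using cycle by (auto elim!: graph_cycleE)
  note paths = cycle[unfolded cs graph_cycle_split_iff[OF symp_adjacent]]
  have "arc_between (\<Union>(path_edges (x # [] @ [y]))) x y"
    "arc_between (\<Union>(path_edges (x # rev q @ [y]))) x y"
    using arc_between_path[of "x # [] @ [y]"] arc_between_path[of "x # rev q @ [y]"] paths by simp_all
  moreover have "\<Union>(path_edges (x # [] @ [y])) \<inter> \<Union>(path_edges (x # rev q @ [y])) \<subseteq> {x, y}"
    using paths by (intro path_edges_Int) auto
  ultimately show ?thesis
    unfolding cs boundary_edges_split Union_Un_distrib by (rule jordan_curve_two_arcs)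
qed

lemma simple_cycle_iff_graph_cycle: "simple_cycle V E cs \<longleftrightarrow> graph_cycle adjacent cs"
  unfolding simple_cycle_def graph_cycle_iff_nth using adjacent_in_V(1) by (metis in_set_conv_nth subsetI)

lemma cycle_edges_eq_boundary_edges:
  assumes "graph_cycle adjacent cs"
  shows "cycle_edges V E cs = boundary_edges cs"
proof
  show "boundary_edges cs \<subseteq> cycle_edges V E cs"
    using assms edge_in_E edge_Int_V
    unfolding boundary_edges_conv_nth cycle_edges_def graph_cycle_iff_nth by blast
  show "cycle_edges V E cs \<subseteq> boundary_edges cs"
    unfolding boundary_edges_conv_nth cycle_edges_def using edge_eq by blast
qed

end

section \<open>Faces and links of a mesh\<close>

locale triangulated_mesh =
  fixes r :: nat and V :: "complex set" and E :: "complex set set"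
  assumes mesh: "mesh r V E" and degree_pos: "r > 0"
begin

sublocale embedded_graph V E
  using mesh by unfold_locales (simp add: mesh_def)

lemma finite_bounded_V: "bounded S \<Longrightarrow> finite (V \<inter> S)"
  and finite_edges_meeting_bounded: "bounded S \<Longrightarrow> finite {e \<in> E. e \<inter> S \<noteq> {}}"
  using mesh unfolding mesh_def locally_finite_def by blast+

lemma card_adjacent:
  assumes "w \<in> V"
  shows "card {u. adjacent w u} = r"
proof -
  have "{u. adjacent w u} = {u. adjacent w u \<and> edge w u \<in> E}"
    using edge_in_E by blast
  then show ?thesis
    using card_adjacent_via[of E w] mesh assms by (simp add: mesh_def)
qed

lemma V_subset_Union_E: "V \<subseteq> \<Union>E"
proof
  fix w assume "w \<in> V"
  then obtain u where "adjacent w u"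
    using card_adjacent degree_pos by (metis card.empty empty_Collect_eq less_not_refl)
  then show "w \<in> \<Union>E"
    using edge_in_E ends_in_edge(1) by blast
qed

lemma isolating_ball:
  obtains \<epsilon> where "\<epsilon> > 0" "\<And>e. e \<in> E \<Longrightarrow> e \<inter> ball p \<epsilon> \<noteq> {} \<Longrightarrow> p \<in> e" "V \<inter> ball p \<epsilon> \<subseteq> {p}"
proof -
  define K where "K = \<Union>{e \<in> E. e \<inter> ball p 1 \<noteq> {} \<and> p \<notin> e} \<union> (V \<inter> ball p 1 - {p})"
  have "finite {e \<in> E. e \<inter> ball p 1 \<noteq> {} \<and> p \<notin> e}"
    by (rule finite_subset[OF _ finite_edges_meeting_bounded[OF bounded_ball[of p 1]]]) auto
  then have "open (- K)"
    unfolding K_def using compact_edge finite_bounded_V[OF bounded_ball[of p 1]]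
    by (intro open_Compl closed_Un closed_Union) (auto simp: compact_imp_closed finite_imp_closed)
  moreover have "p \<in> - K"
    by (auto simp: K_def)
  ultimately obtain \<delta> where "\<delta> > 0" and \<delta>: "ball p \<delta> \<subseteq> - K"
    using open_contains_ball by blast
  have sub: "ball p (min \<delta> 1) \<subseteq> ball p \<delta>" "ball p (min \<delta> 1) \<subseteq> ball p 1"
    by auto
  show thesis
  proof (rule that[of "min \<delta> 1"])
    fix e assume "e \<in> E" "e \<inter> ball p (min \<delta> 1) \<noteq> {}"
    then show "p \<in> e"
      using \<delta> sub unfolding K_def by blast
  next
    show "V \<inter> ball p (min \<delta> 1) \<subseteq> {p}"
      using \<delta> sub unfolding K_def by blast
  qed (use \<open>\<delta> > 0\<close> in simp)
qed

lemma closed_Union_E: "closed (\<Union>E)"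
  unfolding closed_def open_contains_ball
proof
  fix p assume "p \<in> - \<Union>E"
  moreover obtain \<epsilon> where "\<epsilon> > 0" "\<And>e. e \<in> E \<Longrightarrow> e \<inter> ball p \<epsilon> \<noteq> {} \<Longrightarrow> p \<in> e"
    using isolating_ball[of p] by metis
  ultimately have "e \<inter> ball p \<epsilon> = {}" if "e \<in> E" for e
    using that by blast
  then show "\<exists>\<epsilon>>0. ball p \<epsilon> \<subseteq> - \<Union>E"
    using \<open>\<epsilon> > 0\<close> by (intro exI[of _ \<epsilon>]) blast
qed

lemma faces_eq_components: "faces V E = components (- \<Union>E)"
  using V_subset_Union_E by (simp add: faces_def Un_absorb1)

lemma
  assumes "F \<in> faces V E"
  shows open_face: "open F" and connected_face: "connected F" and face_nonempty: "F \<noteq> {}"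
    and face_Int_Union_E: "F \<inter> \<Union>E = {}"
proof -
  have F: "F \<in> components (- \<Union>E)"
    using assms faces_eq_components by simp
  show "open F"
    using F closed_Union_E open_components by blast
  show "connected F" "F \<noteq> {}"
    using F in_components_connected in_components_nonempty by blast+
  show "F \<inter> \<Union>E = {}"
    using in_components_subset[OF F] by blast
qed

lemma face_Int_V: "F \<in> faces V E \<Longrightarrow> F \<inter> V = {}"
  using face_Int_Union_E[of F] V_subset_Union_E by blast

lemma face_Int_edge: "F \<in> faces V E \<Longrightarrow> adjacent u w \<Longrightarrow> F \<inter> edge u w = {}"
  using face_Int_Union_E[of F] edge_in_E[of u w] by blast

lemma faces_eqI: "F \<in> faces V E \<Longrightarrow> F' \<in> faces V E \<Longrightarrow> F \<inter> F' \<noteq> {} \<Longrightarrow> F = F'"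
  unfolding faces_def using components_eq by blast

lemma in_some_face:
  assumes "p \<notin> \<Union>E"
  obtains F where "F \<in> faces V E" "p \<in> F"
  using assms Union_components[of "- \<Union>E"] unfolding faces_eq_components by blast

lemma frontier_face:
  assumes "F \<in> faces V E"
  obtains e\<^sub>1 e\<^sub>2 e\<^sub>3 where "e\<^sub>1 \<in> E" "e\<^sub>2 \<in> E" "e\<^sub>3 \<in> E" "e\<^sub>1 \<noteq> e\<^sub>2" "e\<^sub>1 \<noteq> e\<^sub>3" "e\<^sub>2 \<noteq> e\<^sub>3"
    "frontier F = e\<^sub>1 \<union> e\<^sub>2 \<union> e\<^sub>3"
  using assms mesh unfolding mesh_def is_triangle_face_def by metis

lemma bounded_frontier_face: "F \<in> faces V E \<Longrightarrow> bounded (frontier F)"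
  by (erule frontier_face) (simp add: compact_edge compact_imp_bounded)

lemma bounded_face:
  assumes "F \<in> faces V E"
  shows "bounded F"
proof (rule ccontr)
  assume unbounded: "\<not> bounded F"
  obtain R where R: "R > 0" "frontier F \<subseteq> ball 0 R"
    using bounded_frontier_face[OF assms] bounded_subset_ballD by blast
  have "- ball 0 R \<inter> F \<noteq> {}"
    using unbounded bounded_subset[OF bounded_ball, of F 0 R] by blast
  moreover have "connected (- ball (0::complex) R)"
    by (rule connected_complement_bounded_convex) auto
  ultimately have "- ball 0 R \<subseteq> F"
    using connected_Int_frontier[of "- ball 0 R" F] R(2) by blast
  then have "V = V \<inter> ball 0 R"
    using face_Int_V[OF assms] by blast
  then have "finite V"
    using finite_bounded_V[OF bounded_ball[of "0::complex" R]] by simp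
  then show False
    using mesh unfolding mesh_def by simp
qed

lemma disconnected_Compl_frontier_face:
  assumes "F \<in> faces V E"
  shows "\<not> connected (- frontier F)"
proof
  assume "connected (- frontier F)"
  moreover have "F \<subseteq> - frontier F"
    using open_face[OF assms] frontier_disjoint_eq by blast
  ultimately have "- frontier F \<subseteq> F"
    using connected_Int_frontier[of "- frontier F" F] face_nonempty[OF assms] by blast
  then have "bounded (- frontier F)"
    using bounded_face[OF assms] bounded_subset by blast
  then show False
    using bounded_frontier_face[OF assms] cobounded_imp_unbounded by blast
qed

text \<open>If an endpoint of one of the three edges lay on neither of the other two, the edges could be added one
  at a time, each meeting the previous ones in at most a point, without separating the plane.\<close>
lemma separating_edges_share_ends:
  assumes E: "e\<^sub>1 \<in> E" "e\<^sub>2 \<in> E" "e\<^sub>3 \<in> E" and distinct: "e\<^sub>1 \<noteq> e\<^sub>2" "e\<^sub>1 \<noteq> e\<^sub>3" "e\<^sub>2 \<noteq> e\<^sub>3"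
    and separates: "\<not> connected (- (e\<^sub>1 \<union> e\<^sub>2 \<union> e\<^sub>3))"
  shows "e\<^sub>3 \<inter> V \<subseteq> e\<^sub>1 \<union> e\<^sub>2"
proof (rule ccontr)
  assume "\<not> ?thesis"
  then obtain x where x: "x \<in> e\<^sub>3" "x \<in> V" "x \<notin> e\<^sub>1 \<union> e\<^sub>2"
    by blast
  have connected_if_subset_singleton: "connected S" if "S \<subseteq> {y}" for S and y :: complex
    using that by (metis connected_empty connected_sing subset_singletonD)
  obtain s t where st: "adjacent s t" "e\<^sub>1 = edge s t"
    using E(1) by (rule edgeE)
  obtain s' t' where st': "adjacent s' t'" "e\<^sub>2 = edge s' t'"
    using E(2) by (rule edgeE)
  obtain u w where uw: "adjacent u w" "e\<^sub>3 = edge u w"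
    using E(3) by (rule edgeE)
  have "{s, t} \<noteq> {s', t'}"
    using st st' distinct(1) edge_eq_iff by metis
  then have "\<exists>y. {s, t} \<inter> {s', t'} \<subseteq> {y}"
    by auto
  moreover have "e\<^sub>1 \<inter> e\<^sub>2 \<subseteq> {s, t} \<inter> {s', t'}"
    using edge_Int_edge[OF st(1) st'(1) \<open>{s, t} \<noteq> {s', t'}\<close>] st(2) st'(2) by simp
  ultimately have "connected (e\<^sub>1 \<inter> e\<^sub>2)"
    using connected_if_subset_singleton by (metis subset_trans)
  then have "connected (- (e\<^sub>1 \<union> e\<^sub>2))"
    using E connected_Compl_edge compact_edge compact_imp_closed by (metis Janiszewski_connected)
  moreover have "connected ((e\<^sub>1 \<union> e\<^sub>2) \<inter> e\<^sub>3)"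
  proof -
    have "(e\<^sub>1 \<union> e\<^sub>2) \<inter> e\<^sub>3 \<subseteq> V"
      using edge_eqI_inner E distinct(2,3) by blast
    then have "(e\<^sub>1 \<union> e\<^sub>2) \<inter> e\<^sub>3 \<subseteq> {u, w} - {x}" "x \<in> {u, w}"
      using edge_Int_V[OF uw(1)] uw(2) x by blast+
    then have "\<exists>y. (e\<^sub>1 \<union> e\<^sub>2) \<inter> e\<^sub>3 \<subseteq> {y}"
      by blast
    then show ?thesis
      using connected_if_subset_singleton by blast
  qed
  ultimately have "connected (- (e\<^sub>1 \<union> e\<^sub>2 \<union> e\<^sub>3))"
    using E connected_Compl_edge compact_edge compact_imp_closed compact_Un
    by (metis Janiszewski_connected)
  then show False
    using separates by simp
qed

definition triangle_boundary :: "complex \<Rightarrow> complex \<Rightarrow> complex \<Rightarrow> complex set" where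
  "triangle_boundary a b c = edge a b \<union> edge b c \<union> edge a c"

abbreviation triangle_interior :: "complex \<Rightarrow> complex \<Rightarrow> complex \<Rightarrow> complex set" where
  "triangle_interior a b c \<equiv> inside (triangle_boundary a b c)"

definition triangle :: "complex \<Rightarrow> complex \<Rightarrow> complex \<Rightarrow> bool" where
  "triangle a b c \<longleftrightarrow>
     adjacent a b \<and> adjacent b c \<and> adjacent a c \<and> triangle_interior a b c \<in> faces V E"

lemma triangle_adjacent:
  assumes "triangle a b c"
  shows "adjacent a b" "adjacent b c" "adjacent a c"
  using assms unfolding triangle_def by auto

lemma triangle_neq:
  assumes "triangle a b c"
  shows "a \<noteq> b" "b \<noteq> c" "a \<noteq> c"
  using triangle_adjacent[OF assms] adjacent_neq by blast+

lemma triangle_face: "triangle a b c \<Longrightarrow> triangle_interior a b c \<in> faces V E"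
  unfolding triangle_def by simp

lemma boundary_edges_triangle: "boundary_edges [a, b, c] = {edge a b, edge b c, edge a c}"
  unfolding boundary_edges_def using edge_commute[of a c] by auto

lemma Union_boundary_edges_triangle: "\<Union>(boundary_edges [a, b, c]) = triangle_boundary a b c"
  unfolding boundary_edges_triangle triangle_boundary_def by blast

lemma graph_cycle_three:
  assumes "adjacent a b" "adjacent b c" "adjacent a c"
  shows "graph_cycle adjacent [a, b, c]"
  using assms adjacent_neq adjacent_sym unfolding graph_cycle_def by auto

lemma triangle_graph_cycle: "triangle a b c \<Longrightarrow> graph_cycle adjacent [a, b, c]"
  using graph_cycle_three triangle_adjacent by blast

lemma jordan_curve_triangle: "triangle a b c \<Longrightarrow> jordan_curve (triangle_boundary a b c)"
  using jordan_curve_boundary[OF triangle_graph_cycle] unfolding Union_boundary_edges_triangle .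

lemma triangle_boundary_Int_V: "triangle a b c \<Longrightarrow> triangle_boundary a b c \<inter> V = {a, b, c}"
  using Union_boundary_edges_Int_V[OF triangle_graph_cycle] by (simp add: Union_boundary_edges_triangle)

lemma frontier_triangle: "triangle a b c \<Longrightarrow> frontier (triangle_interior a b c) = triangle_boundary a b c"
  by (rule frontier_inside_jordan_curve[OF jordan_curve_triangle])

lemma triangle_swap:
  assumes "triangle a b c"
  shows "triangle b a c" "triangle a c b"
    "triangle_boundary b a c = triangle_boundary a b c" "triangle_boundary a c b = triangle_boundary a b c"
proof -
  show boundary: "triangle_boundary b a c = triangle_boundary a b c"
    "triangle_boundary a c b = triangle_boundary a b c"
    unfolding triangle_boundary_def using edge_commute by auto
  show "triangle b a c" "triangle a c b"
    using assms adjacent_sym unfolding triangle_def boundary by blast+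
qed

lemma triangle_cong:
  assumes "triangle a b c" "{x, y, z} = {a, b, c}"
  shows "triangle x y z" "triangle_boundary x y z = triangle_boundary a b c"
proof -
  define same where
    "same x y z \<longleftrightarrow> triangle x y z \<and> triangle_boundary x y z = triangle_boundary a b c" for x y z
  have swap: "same x z y" "same y x z" if "same x y z" for x y z
    using that triangle_swap[of x y z] unfolding same_def by simp_all
  have "same a b c"
    using assms(1) unfolding same_def by simp
  then have all: "same a b c" "same a c b" "same b a c" "same b c a" "same c a b" "same c b a"
    using swap by metis+
  have "card {x, y, z} = 3"
    unfolding assms(2) using triangle_neq[OF assms(1)] by simp
  then have "x \<noteq> y" "y \<noteq> z" "x \<noteq> z"
    by (auto simp: card_insert_if split: if_splits)
  moreover have "x \<in> {a, b, c}" "y \<in> {a, b, c}" "z \<in> {a, b, c}"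
    using assms(2) by blast+
  ultimately have "same x y z"
    using all by blast
  then show "triangle x y z" "triangle_boundary x y z = triangle_boundary a b c"
    unfolding same_def by auto
qed

lemma triangle_at_edge:
  assumes "triangle x y z" "{a, b} \<subseteq> {x, y, z}" "a \<noteq> b"
  obtains c where "triangle a b c" "triangle_boundary a b c = triangle_boundary x y z"
proof -
  obtain c where "{a, b, c} = {x, y, z}"
    using assms triangle_neq[OF assms(1)] by auto
  then show ?thesis
    using that[of c] triangle_cong[OF assms(1), of a b c] by simp
qed

lemma triangle_edge_iff:
  assumes "triangle x y z" "adjacent a b"
  shows "edge a b \<subseteq> triangle_boundary x y z \<longleftrightarrow> {a, b} \<subseteq> {x, y, z}"
proof
  assume "edge a b \<subseteq> triangle_boundary x y z"
  then show "{a, b} \<subseteq> {x, y, z}"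
    using edge_Int_V[OF assms(2)] triangle_boundary_Int_V[OF assms(1)] by blast
next
  assume "{a, b} \<subseteq> {x, y, z}"
  then obtain c where "triangle_boundary a b c = triangle_boundary x y z"
    using triangle_at_edge[OF assms(1)] adjacent_neq[OF assms(2)] by metis
  then show "edge a b \<subseteq> triangle_boundary x y z"
    using triangle_boundary_def[of a b c] by auto
qed

lemma edges_form_triangle:
  assumes E: "e\<^sub>1 \<in> E" "e\<^sub>2 \<in> E" "e\<^sub>3 \<in> E" and distinct: "e\<^sub>1 \<noteq> e\<^sub>2" "e\<^sub>1 \<noteq> e\<^sub>3" "e\<^sub>2 \<noteq> e\<^sub>3"
    and ends: "e\<^sub>1 \<inter> V \<subseteq> e\<^sub>2 \<union> e\<^sub>3" "e\<^sub>2 \<inter> V \<subseteq> e\<^sub>1 \<union> e\<^sub>3" "e\<^sub>3 \<inter> V \<subseteq> e\<^sub>1 \<union> e\<^sub>2"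
  obtains a b c where "adjacent a b" "adjacent b c" "adjacent a c" "e\<^sub>1 \<union> e\<^sub>2 \<union> e\<^sub>3 = triangle_boundary a b c"
proof -
  obtain a b where ab: "adjacent a b" "e\<^sub>1 = edge a b"
    using E(1) by (rule edgeE)
  obtain s t where st: "adjacent s t" "e\<^sub>2 = edge s t"
    using E(2) by (rule edgeE)
  obtain u w where uw: "adjacent u w" "e\<^sub>3 = edge u w"
    using E(3) by (rule edgeE)
  have "e\<^sub>1 \<inter> V \<subseteq> e\<^sub>2 \<inter> V \<union> e\<^sub>3 \<inter> V" "e\<^sub>2 \<inter> V \<subseteq> e\<^sub>1 \<inter> V \<union> e\<^sub>3 \<inter> V" "e\<^sub>3 \<inter> V \<subseteq> e\<^sub>1 \<inter> V \<union> e\<^sub>2 \<inter> V"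
    using ends by blast+
  then have "{a, b} \<subseteq> {s, t} \<union> {u, w}" "{s, t} \<subseteq> {a, b} \<union> {u, w}" "{u, w} \<subseteq> {a, b} \<union> {s, t}"
    by (simp_all only: ab(2) st(2) uw(2) edge_Int_V[OF ab(1)] edge_Int_V[OF st(1)] edge_Int_V[OF uw(1)])
  moreover have "{a, b} \<noteq> {s, t}" "{a, b} \<noteq> {u, w}" "{s, t} \<noteq> {u, w}"
    using distinct ab st uw edge_eq_iff by metis+
  moreover have "a \<noteq> b" "s \<noteq> t" "u \<noteq> w"
    using ab(1) st(1) uw(1) adjacent_neq by blast+
  ultimately have "\<exists>c. {{s, t}, {u, w}} = {{b, c}, {a, c}}"
    by (simp add: doubleton_eq_iff) metis
  then obtain c where "{{s, t}, {u, w}} = {{b, c}, {a, c}}" ..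
  then have sides: "{s, t} = {b, c} \<and> {u, w} = {a, c} \<or> {s, t} = {a, c} \<and> {u, w} = {b, c}"
    using doubleton_eq_iff[of "{s, t}" "{u, w}"] by simp
  then have bc: "adjacent b c" "adjacent a c"
    using st(1) uw(1) adjacent_sym by (metis doubleton_eq_iff)+
  have "e\<^sub>2 = edge b c \<and> e\<^sub>3 = edge a c \<or> e\<^sub>2 = edge a c \<and> e\<^sub>3 = edge b c"
    using sides by (simp add: st uw bc edge_eq_iff)
  then have "e\<^sub>1 \<union> e\<^sub>2 \<union> e\<^sub>3 = triangle_boundary a b c"
    using ab(2) unfolding triangle_boundary_def by auto
  then show ?thesis
    using that ab(1) bc by blast
qed

lemma faceE:
  assumes "F \<in> faces V E"
  obtains a b c where "triangle a b c" "F = triangle_interior a b c"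
proof -
  obtain e\<^sub>1 e\<^sub>2 e\<^sub>3 where e: "e\<^sub>1 \<in> E" "e\<^sub>2 \<in> E" "e\<^sub>3 \<in> E" "e\<^sub>1 \<noteq> e\<^sub>2" "e\<^sub>1 \<noteq> e\<^sub>3" "e\<^sub>2 \<noteq> e\<^sub>3"
    and frontier: "frontier F = e\<^sub>1 \<union> e\<^sub>2 \<union> e\<^sub>3"
    using frontier_face[OF assms] .
  have "\<not> connected (- (e\<^sub>1 \<union> e\<^sub>2 \<union> e\<^sub>3))"
    using disconnected_Compl_frontier_face[OF assms] frontier by simp
  then have ends: "e\<^sub>1 \<inter> V \<subseteq> e\<^sub>2 \<union> e\<^sub>3" "e\<^sub>2 \<inter> V \<subseteq> e\<^sub>1 \<union> e\<^sub>3" "e\<^sub>3 \<inter> V \<subseteq> e\<^sub>1 \<union> e\<^sub>2"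
    using separating_edges_share_ends[of e\<^sub>2 e\<^sub>3 e\<^sub>1] separating_edges_share_ends[of e\<^sub>1 e\<^sub>3 e\<^sub>2]
      separating_edges_share_ends[of e\<^sub>1 e\<^sub>2 e\<^sub>3] e by (simp_all add: Un_ac)
  obtain a b c where abc: "adjacent a b" "adjacent b c" "adjacent a c"
    and boundary: "frontier F = triangle_boundary a b c"
    by (rule edges_form_triangle[OF e ends, folded frontier])
  have "jordan_curve (triangle_boundary a b c)"
    using jordan_curve_boundary[OF graph_cycle_three[OF abc]] unfolding Union_boundary_edges_triangle .
  moreover have "F \<inter> triangle_boundary a b c = {}"
    using frontier_disjoint_eq[of F] open_face[OF assms] boundary by (simp add: Int_commute)
  ultimately have "F = triangle_interior a b c"
    using assms boundary by (intro bounded_connected_eq_inside)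
      (simp_all add: connected_face face_nonempty bounded_face)
  then show ?thesis
    using that[of a b c] abc assms unfolding triangle_def by blast
qed

lemma inj_on_frontier_Int_V: "inj_on (\<lambda>F. frontier F \<inter> V) (faces V E)"
proof
  fix F G assume FG: "F \<in> faces V E" "G \<in> faces V E" and eq: "frontier F \<inter> V = frontier G \<inter> V"
  obtain a b c where F: "triangle a b c" "F = triangle_interior a b c"
    using FG(1) by (rule faceE)
  obtain x y z where G: "triangle x y z" "G = triangle_interior x y z"
    using FG(2) by (rule faceE)
  have "{a, b, c} = {x, y, z}"
    using eq F G by (simp add: frontier_triangle triangle_boundary_Int_V)
  from triangle_cong(2)[OF G(1) this] show "F = G"
    using F(2) G(2) by simp
qed

lemma triangle_interior_eqD:
  assumes "triangle a b c" "triangle x y z" "triangle_interior a b c \<inter> triangle_interior x y z \<noteq> {}"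
  shows "{a, b, c} = {x, y, z}"
proof -
  have "triangle_interior a b c = triangle_interior x y z"
    using assms triangle_face faces_eqI by blast
  then show ?thesis
    using assms(1,2) by (metis frontier_triangle triangle_boundary_Int_V)
qed

lemma edge_subset_closure_triangle: "triangle a b c \<Longrightarrow> edge a b \<subseteq> closure (triangle_interior a b c)"
  using closure_inside_jordan_curve[OF jordan_curve_triangle, of a b c] by (auto simp: triangle_boundary_def)

lemma triangles_near_point:
  assumes "p \<in> \<Union>E"
  obtains \<epsilon> where "\<epsilon> > 0" "\<And>e. e \<in> E \<Longrightarrow> e \<inter> ball p \<epsilon> \<noteq> {} \<Longrightarrow> p \<in> e" "V \<inter> ball p \<epsilon> \<subseteq> {p}"
    "\<And>x. x \<in> ball p \<epsilon> \<Longrightarrow> x \<notin> \<Union>E \<Longrightarrow>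
      \<exists>a b c. triangle a b c \<and> x \<in> triangle_interior a b c \<and> adjacent a b \<and> p \<in> edge a b"
proof -
  obtain \<epsilon> where \<epsilon>: "\<epsilon> > 0" "\<And>e. e \<in> E \<Longrightarrow> e \<inter> ball p \<epsilon> \<noteq> {} \<Longrightarrow> p \<in> e" "V \<inter> ball p \<epsilon> \<subseteq> {p}"
    using isolating_ball[of p] by metis
  have "\<exists>a b c. triangle a b c \<and> x \<in> triangle_interior a b c \<and> adjacent a b \<and> p \<in> edge a b"
    if x: "x \<in> ball p \<epsilon>" "x \<notin> \<Union>E" for x
  proof -
    obtain F where F: "F \<in> faces V E" "x \<in> F"
      using x(2) by (rule in_some_face)
    obtain s t u where stu: "triangle s t u" "F = triangle_interior s t u"
      using F(1) by (rule faceE)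
    have "p \<in> ball p \<epsilon> - F"
      using assms face_Int_Union_E[OF F(1)] \<epsilon>(1) by auto
    then have "ball p \<epsilon> \<inter> frontier F \<noteq> {}"
      using x(1) F(2) by (intro connected_Int_frontier connected_ball) blast+
    then obtain y where y: "y \<in> ball p \<epsilon>" "y \<in> triangle_boundary s t u"
      using frontier_triangle[OF stu(1)] stu(2) by auto
    then obtain a b where ab: "adjacent a b" "y \<in> edge a b" "edge a b \<subseteq> triangle_boundary s t u"
      using triangle_adjacent[OF stu(1)] unfolding triangle_boundary_def by blast
    have "p \<in> edge a b"
      using \<epsilon>(2)[OF edge_in_E[OF ab(1)]] ab(2) y(1) by blast
    moreover have "{a, b} \<subseteq> {s, t, u}"
      using triangle_edge_iff[OF stu(1) ab(1)] ab(3) by simp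
    then obtain c where "triangle a b c" "triangle_boundary a b c = triangle_boundary s t u"
      by (rule triangle_at_edge[OF stu(1) _ adjacent_neq[OF ab(1)]])
    ultimately show ?thesis
      using ab(1) F(2) stu(2) by metis
  qed
  then show ?thesis
    using that[OF \<epsilon>] by simp
qed

lemma triangles_near_edge:
  assumes ab: "adjacent a b" and p: "p \<in> edge a b" "p \<notin> V"
  obtains \<epsilon> where "\<epsilon> > 0"
    "\<And>x. x \<in> ball p \<epsilon> \<Longrightarrow> x \<notin> edge a b \<Longrightarrow> \<exists>c. triangle a b c \<and> x \<in> triangle_interior a b c"
proof -
  have "p \<in> \<Union>E"
    using edge_in_E[OF ab] p(1) by blast
  then obtain \<epsilon> where \<epsilon>: "\<epsilon> > 0" "\<And>e. e \<in> E \<Longrightarrow> e \<inter> ball p \<epsilon> \<noteq> {} \<Longrightarrow> p \<in> e"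
    "\<And>x. x \<in> ball p \<epsilon> \<Longrightarrow> x \<notin> \<Union>E \<Longrightarrow>
      \<exists>a b c. triangle a b c \<and> x \<in> triangle_interior a b c \<and> adjacent a b \<and> p \<in> edge a b"
    using triangles_near_point[of p] by metis
  have "\<exists>c. triangle a b c \<and> x \<in> triangle_interior a b c" if x: "x \<in> ball p \<epsilon>" "x \<notin> edge a b" for x
  proof -
    have "x \<notin> \<Union>E"
      using \<epsilon>(2) edge_eqI_inner[OF _ edge_in_E[OF ab] _ p] x by (metis IntI UnionE empty_iff)
    then obtain s t u where stu: "triangle s t u" "x \<in> triangle_interior s t u" "p \<in> edge s t"
      using \<epsilon>(3) x(1) by blast
    then have "edge a b = edge s t"
      using edge_eqI_inner[OF edge_in_E[OF ab] edge_in_E[OF triangle_adjacent(1)[OF stu(1)]]] p by blast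
    then have "{a, b} \<subseteq> {s, t, u}"
      using edge_eq_iff[OF ab triangle_adjacent(1)[OF stu(1)]] by auto
    then show ?thesis
      using triangle_at_edge[OF stu(1) _ adjacent_neq[OF ab]] stu(2) by metis
  qed
  then show ?thesis
    using that \<epsilon>(1) by blast
qed

lemma ex_triangle:
  assumes "adjacent a b"
  obtains c where "triangle a b c"
proof -
  obtain p where p: "p \<in> edge a b" "p \<notin> V"
    using assms by (rule edge_inner_point)
  obtain \<epsilon> where \<epsilon>: "\<epsilon> > 0"
    "\<And>x. x \<in> ball p \<epsilon> \<Longrightarrow> x \<notin> edge a b \<Longrightarrow> \<exists>c. triangle a b c \<and> x \<in> triangle_interior a b c"
    using triangles_near_edge[OF assms p] by metis
  have "interior (edge a b) = {}"
    using interior_arc_between[OF arc_between_edge[OF assms]] by simp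
  then have "\<not> ball p \<epsilon> \<subseteq> edge a b"
    using \<epsilon>(1) by (metis empty_iff mem_interior)
  then show ?thesis
    using \<epsilon>(2) that by blast
qed

lemma ex_triangle_near:
  assumes ab: "adjacent a b" and p: "p \<in> edge a b" "p \<notin> V"
    and S: "p \<in> closure S" "S \<inter> edge a b = {}"
  obtains c where "triangle a b c" "triangle_interior a b c \<inter> S \<noteq> {}"
proof -
  obtain \<epsilon> where \<epsilon>: "\<epsilon> > 0"
    "\<And>x. x \<in> ball p \<epsilon> \<Longrightarrow> x \<notin> edge a b \<Longrightarrow> \<exists>c. triangle a b c \<and> x \<in> triangle_interior a b c"
    using triangles_near_edge[OF ab p] by metis
  obtain x where x: "x \<in> S" "x \<in> ball p \<epsilon>"
    using S(1) \<epsilon>(1) by (metis closure_approachable mem_ball dist_commute)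
  then have "x \<notin> edge a b"
    using S(2) by blast
  then obtain c where "triangle a b c" "x \<in> triangle_interior a b c"
    using \<epsilon>(2) x(2) by blast
  then show ?thesis
    using that x(1) by blast
qed

lemma ex_other_triangle:
  assumes "triangle a b c"
  obtains d where "triangle a b d" "d \<noteq> c"
proof -
  note ab = triangle_adjacent(1)[OF assms]
  obtain p where p: "p \<in> edge a b" "p \<notin> V"
    using ab by (rule edge_inner_point)
  have "edge a b \<subseteq> triangle_boundary a b c"
    unfolding triangle_boundary_def by blast
  then have "p \<in> closure (outside (triangle_boundary a b c))"
    "outside (triangle_boundary a b c) \<inter> edge a b = {}"
    using p(1) closure_outside_jordan_curve[OF jordan_curve_triangle[OF assms]]
      outside_no_overlap[of "triangle_boundary a b c"] by blast+
  then obtain d where "triangle a b d" "triangle_interior a b d \<inter> outside (triangle_boundary a b c) \<noteq> {}"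
    using ex_triangle_near[OF ab p] by metis
  then show ?thesis
    using that inside_Int_outside[of "triangle_boundary a b c"] by blast
qed

lemma triangle_interiors_disjoint:
  assumes "triangle a b c" "triangle a b d" "c \<noteq> d"
  shows "triangle_interior a b c \<inter> triangle_interior a b d = {}"
proof (rule ccontr)
  assume "\<not> ?thesis"
  then have "{a, b, c} = {a, b, d}"
    using triangle_interior_eqD assms(1,2) by blast
  then show False
    using triangle_neq[OF assms(1)] assms(3) by auto
qed

lemma theta_curve_two_triangles:
  assumes abc: "triangle a b c" and abd: "triangle a b d" and "c \<noteq> d"
  shows "theta_curve (\<Union>(path_edges [a, c, b])) (\<Union>(path_edges [a, d, b])) (\<Union>(path_edges [a, b])) a b"
proof -
  have c_path: "successively adjacent (a # [c] @ [b])" "distinct (a # [c] @ [b])"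
    and d_path: "successively adjacent (a # [d] @ [b])" "distinct (a # [d] @ [b])"
    and ab_path: "successively adjacent (a # [] @ [b])" "distinct (a # [] @ [b])"
    using triangle_adjacent[OF abc] triangle_adjacent[OF abd] adjacent_sym adjacent_neq by auto
  show ?thesis
    unfolding theta_curve_def
    using arc_between_path[OF c_path] arc_between_path[OF d_path] arc_between_path[OF ab_path]
      path_edges_Int[OF c_path d_path] path_edges_Int[OF c_path ab_path] path_edges_Int[OF d_path ab_path]
      \<open>c \<noteq> d\<close> by simp
qed

lemma edge_inside_two_triangles:
  assumes abc: "triangle a b c" and abd: "triangle a b d" and "c \<noteq> d"
  defines "Q \<equiv> inside (\<Union>(path_edges [a, c, b]) \<union> \<Union>(path_edges [a, d, b]))"
  shows "open Q" "edge a b - V \<subseteq> Q" "Q \<subseteq> edge a b \<union> triangle_interior a b c \<union> triangle_interior a b d"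
proof -
  note theta = theta_curve_two_triangles[OF abc abd \<open>c \<noteq> d\<close>]
  have boundaries: "\<Union>(path_edges [a, c, b]) \<union> \<Union>(path_edges [a, b]) = triangle_boundary a b c"
    "\<Union>(path_edges [a, d, b]) \<union> \<Union>(path_edges [a, b]) = triangle_boundary a b d"
    unfolding triangle_boundary_def using edge_commute[of b] by auto
  have "triangle_interior a b c \<inter> \<Union>(path_edges [a, d, b]) = {}"
    "triangle_interior a b d \<inter> \<Union>(path_edges [a, c, b]) = {}"
    using face_Int_Union_E[OF triangle_face[OF abc]] face_Int_Union_E[OF triangle_face[OF abd]]
      path_edges_subset_E[of "[a, c, b]"] path_edges_subset_E[of "[a, d, b]"]
      triangle_adjacent[OF abc] triangle_adjacent[OF abd] adjacent_sym by auto
  then have "edge a b - {a, b} \<subseteq> Q"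
    using theta_curve_middle_inside[OF theta] triangle_interiors_disjoint[OF abc abd \<open>c \<noteq> d\<close>]
    unfolding boundaries Q_def by simp
  then show middle: "edge a b - V \<subseteq> Q"
    using adjacent_in_V[OF triangle_adjacent(1)[OF abc]] by blast
  obtain p where "p \<in> edge a b" "p \<notin> V"
    using triangle_adjacent(1)[OF abc] by (rule edge_inner_point)
  then have "\<Union>(path_edges [a, b]) \<inter> Q \<noteq> {}"
    using middle by auto
  then show "Q \<subseteq> edge a b \<union> triangle_interior a b c \<union> triangle_interior a b d"
    using theta_curve_split_inside(2)[OF theta] unfolding boundaries Q_def by auto
  show "open Q"
    unfolding Q_def by (rule open_inside_jordan_curve[OF theta_curve_jordan_curves(1)[OF theta]])
qed

lemma triangle_at_most_two:
  assumes abc: "triangle a b c" and abd: "triangle a b d" and "c \<noteq> d" and abx: "triangle a b x"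
  shows "x = c \<or> x = d"
proof (rule ccontr)
  assume "\<not> ?thesis"
  then have disjoint: "triangle_interior a b x \<inter> triangle_interior a b c = {}"
    "triangle_interior a b x \<inter> triangle_interior a b d = {}"
    using triangle_interiors_disjoint[OF abx abc] triangle_interiors_disjoint[OF abx abd] by blast+
  define Q where "Q = inside (\<Union>(path_edges [a, c, b]) \<union> \<Union>(path_edges [a, d, b]))"
  note Q = edge_inside_two_triangles[OF abc abd \<open>c \<noteq> d\<close>, folded Q_def]
  obtain p where "p \<in> edge a b" "p \<notin> V"
    using triangle_adjacent(1)[OF abc] by (rule edge_inner_point)
  then have "p \<in> Q" "p \<in> closure (triangle_interior a b x)"
    using Q(2) edge_subset_closure_triangle[OF abx] by blast+
  then have "Q \<inter> triangle_interior a b x \<noteq> {}"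
    using open_Int_closure_eq_empty[OF Q(1)] by blast
  then show False
    using Q(3) disjoint face_Int_edge[OF triangle_face[OF abx] triangle_adjacent(1)[OF abx]] by blast
qed

lemma card_triangles_at_edge:
  assumes "adjacent a b"
  shows "card {x. triangle a b x} = 2"
proof -
  obtain c where abc: "triangle a b c"
    using assms by (rule ex_triangle)
  obtain d where abd: "triangle a b d" "d \<noteq> c"
    using abc by (rule ex_other_triangle)
  have "{x. triangle a b x} = {c, d}"
    using abc abd triangle_at_most_two[OF abc abd(1)] by blast
  then show ?thesis
    using abd(2) by simp
qed

definition wedge :: "complex \<Rightarrow> complex \<Rightarrow> complex set" where
  "wedge w v = edge w v \<union> \<Union>{triangle_interior w v c |c. triangle w v c}"

lemma wedge_minus_V_subset_interior:
  assumes "adjacent w v"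
  shows "wedge w v - V \<subseteq> interior (wedge w v)"
proof
  fix x assume x: "x \<in> wedge w v - V"
  show "x \<in> interior (wedge w v)"
  proof (cases "x \<in> edge w v")
    case True
    then obtain \<epsilon> where "\<epsilon> > 0"
      "\<And>y. y \<in> ball x \<epsilon> \<Longrightarrow> y \<notin> edge w v \<Longrightarrow> \<exists>c. triangle w v c \<and> y \<in> triangle_interior w v c"
      using triangles_near_edge[OF assms True] x by (metis DiffD2)
    then have "\<epsilon> > 0" "ball x \<epsilon> \<subseteq> wedge w v"
      unfolding wedge_def by blast+
    then show ?thesis
      using mem_interior by blast
  next
    case False
    then obtain c where c: "triangle w v c" "x \<in> triangle_interior w v c"
      using x unfolding wedge_def by blast
    have "triangle_interior w v c \<subseteq> wedge w v"
      using c(1) unfolding wedge_def by blast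
    then show ?thesis
      using c(2) open_face[OF triangle_face[OF c(1)]] interiorI by blast
  qed
qed

lemma wedges_cover_punctured_ball:
  assumes w: "w \<in> V"
  obtains \<epsilon> where "\<epsilon> > 0" "V \<inter> ball w \<epsilon> \<subseteq> {w}" "ball w \<epsilon> - {w} \<subseteq> (\<Union>v\<in>{v. adjacent w v}. wedge w v)"
proof -
  obtain \<epsilon> where \<epsilon>: "\<epsilon> > 0" "\<And>e. e \<in> E \<Longrightarrow> e \<inter> ball w \<epsilon> \<noteq> {} \<Longrightarrow> w \<in> e" "V \<inter> ball w \<epsilon> \<subseteq> {w}"
    "\<And>x. x \<in> ball w \<epsilon> \<Longrightarrow> x \<notin> \<Union>E \<Longrightarrow>
      \<exists>a b c. triangle a b c \<and> x \<in> triangle_interior a b c \<and> adjacent a b \<and> w \<in> edge a b"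
    using triangles_near_point[OF subsetD[OF V_subset_Union_E w]] by metis
  have "\<exists>v. adjacent w v \<and> x \<in> wedge w v" if x: "x \<in> ball w \<epsilon>" for x
  proof (cases "x \<in> \<Union>E")
    case True
    then obtain e where e: "e \<in> E" "x \<in> e"
      by blast
    then have "w \<in> e"
      using \<epsilon>(2) x by blast
    then have "e \<in> edge w ` {u. adjacent w u \<and> edge w u \<in> E}"
      using edges_at_vertex[OF subset_refl w] e(1) by blast
    then show ?thesis
      using e(2) unfolding wedge_def by blast
  next
    case False
    then obtain a b c where abc: "triangle a b c" "x \<in> triangle_interior a b c" "adjacent a b" "w \<in> edge a b"
      using \<epsilon>(4) x by blast
    then have "w = a \<or> w = b"
      using edge_Int_V[OF abc(3)] w by blast
    then show ?thesis
      using abc triangle_swap[OF abc(1)] adjacent_sym unfolding wedge_def by fastforce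
  qed
  then show ?thesis
    using that[OF \<epsilon>(1,3)] by blast
qed

lemma wedges_meet:
  assumes v: "adjacent w v" "adjacent w v'" and x: "x \<in> wedge w v" "x \<in> wedge w v'" "x \<notin> V"
  shows "v' = v \<or> triangle w v v'"
proof -
  consider (edges) "x \<in> edge w v" "x \<in> edge w v'"
    | (edge_triangle) c where "x \<in> edge w v" "triangle w v' c" "x \<in> triangle_interior w v' c"
    | (triangle_edge) c where "x \<in> edge w v'" "triangle w v c" "x \<in> triangle_interior w v c"
    | (triangles) c c' where "triangle w v c" "x \<in> triangle_interior w v c"
        "triangle w v' c'" "x \<in> triangle_interior w v' c'"
    using x(1,2) unfolding wedge_def by blast
  then show ?thesis
  proof cases
    case edges
    then have "edge w v = edge w v'"
      using edge_eqI_inner edge_in_E v x(3) by metis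
    then show ?thesis
      using edge_eq_iff v by (metis doubleton_eq_iff)
  next
    case edge_triangle
    then show ?thesis
      using face_Int_edge[OF triangle_face[OF edge_triangle(2)] v(1)] by blast
  next
    case triangle_edge
    then show ?thesis
      using face_Int_edge[OF triangle_face[OF triangle_edge(2)] v(2)] by blast
  next
    case triangles
    then have "{w, v, c} = {w, v', c'}"
      using triangle_interior_eqD[OF triangles(1,3)] by blast
    then have "v' = v \<or> v' = c"
      using adjacent_neq[OF v(2)] by (metis insertCI insertE singletonD)
    then show ?thesis
      using triangles(1) by blast
  qed
qed

lemma open_punctured_ball_Int_wedge:
  assumes "V \<inter> ball w \<epsilon> \<subseteq> {w}" "adjacent w v"
  shows "open ((ball w \<epsilon> - {w}) \<inter> wedge w v)"
proof -
  have "(ball w \<epsilon> - {w}) \<inter> wedge w v = (ball w \<epsilon> - {w}) \<inter> interior (wedge w v)"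
    using wedge_minus_V_subset_interior[OF assms(2)] interior_subset[of "wedge w v"] assms(1) by blast
  then show ?thesis
    by (simp add: open_Int open_delete)
qed

lemma punctured_ball_meets_wedge:
  assumes "\<epsilon> > 0" "adjacent w v"
  shows "(ball w \<epsilon> - {w}) \<inter> wedge w v \<noteq> {}"
proof -
  have "w \<in> closure (edge w v - {w, v})"
    using arc_between_subset_closure_endless[OF arc_between_edge[OF assms(2)]] ends_in_edge(1)[OF assms(2)]
    by blast
  then obtain x where "x \<in> edge w v - {w, v}" "x \<in> ball w \<epsilon>"
    using assms(1) by (metis closure_approachable mem_ball dist_commute)
  then show ?thesis
    unfolding wedge_def by blast
qed

text \<open>The wedges of the neighbours in one connected component of the link and those of the remaining
  neighbours are relatively open disjoint sets that cover a punctured neighbourhood of the vertex.\<close>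
lemma link_connected:
  assumes u: "adjacent w u" and u': "adjacent w u'"
  shows "(triangle w)\<^sup>*\<^sup>* u u'"
proof (rule ccontr)
  assume unreachable: "\<not> ?thesis"
  obtain \<epsilon> where \<epsilon>: "\<epsilon> > 0" "V \<inter> ball w \<epsilon> \<subseteq> {w}"
    "ball w \<epsilon> - {w} \<subseteq> (\<Union>v\<in>{v. adjacent w v}. wedge w v)"
    using wedges_cover_punctured_ball adjacent_in_V(1)[OF u] by blast
  define B where "B = ball w \<epsilon> - {w}"
  have "connected B"
    unfolding B_def by (simp add: connected_punctured_ball)
  define U where "U = {v. adjacent w v \<and> (triangle w)\<^sup>*\<^sup>* u v}"
  define U' where "U' = {v. adjacent w v \<and> \<not> (triangle w)\<^sup>*\<^sup>* u v}"
  define cover where "cover X = (\<Union>v\<in>X. B \<inter> wedge w v)" for X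
  have "open (cover U)" "open (cover U')"
    using open_punctured_ball_Int_wedge[OF \<epsilon>(2)] unfolding cover_def B_def U_def U'_def
    by (blast intro: open_UN)+
  moreover have "B \<subseteq> cover U \<union> cover U'"
    using \<epsilon>(3) unfolding cover_def B_def U_def U'_def by blast
  moreover have "cover U \<inter> cover U' \<inter> B = {}"
  proof (rule ccontr)
    assume "\<not> ?thesis"
    then obtain x v v' where x: "x \<in> B" "x \<in> wedge w v" "x \<in> wedge w v'" and v: "v \<in> U" "v' \<in> U'"
      unfolding cover_def by blast
    then have "v' = v \<or> triangle w v v'"
      using wedges_meet \<epsilon>(2) unfolding B_def U_def U'_def by blast
    then show False
      using v unfolding U_def U'_def by (auto intro: rtranclp.rtrancl_into_rtrancl)
  qed
  moreover have "u \<in> U" "u' \<in> U'"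
    unfolding U_def U'_def using u u' unreachable by auto
  then have "cover U \<inter> B \<noteq> {}" "cover U' \<inter> B \<noteq> {}"
    using punctured_ball_meets_wedge[OF \<epsilon>(1) u] punctured_ball_meets_wedge[OF \<epsilon>(1) u']
    unfolding cover_def B_def by blast+
  ultimately show False
    using connectedD[OF \<open>connected B\<close>] by blast
qed

end

section \<open>Disks bounded by cycles\<close>

context triangulated_mesh
begin

definition edge_circuit :: "complex set set \<Rightarrow> bool" where
  "edge_circuit X \<longleftrightarrow> X \<subseteq> E \<and> jordan_curve (\<Union>X)"

abbreviation closed_disk :: "complex set set \<Rightarrow> complex set" where
  "closed_disk X \<equiv> \<Union>X \<union> inside (\<Union>X)"

definition disk_vertices :: "complex set set \<Rightarrow> complex set" where
  "disk_vertices X = V \<inter> closed_disk X"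

definition disk_edges :: "complex set set \<Rightarrow> complex set set" where
  "disk_edges X = {e \<in> E. e \<subseteq> closed_disk X}"

definition disk_faces :: "complex set set \<Rightarrow> complex set set" where
  "disk_faces X = {F \<in> faces V E. F \<subseteq> inside (\<Union>X)}"

lemma edge_circuit_boundary: "graph_cycle adjacent cs \<Longrightarrow> edge_circuit (boundary_edges cs)"
  unfolding edge_circuit_def by (simp add: boundary_edges_subset_E jordan_curve_boundary)

context
  fixes X assumes circuit: "edge_circuit X"
begin

lemma X_subset_E: "X \<subseteq> E" and jordan_X: "jordan_curve (\<Union>X)"
  using circuit unfolding edge_circuit_def by auto

lemma bounded_closed_disk: "bounded (closed_disk X)"
  using bounded_jordan_curve[OF jordan_X] bounded_inside_jordan_curve[OF jordan_X] by simp

lemma finite_disk_vertices: "finite (disk_vertices X)"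
  unfolding disk_vertices_def by (rule finite_bounded_V[OF bounded_closed_disk])

lemma finite_disk_edges: "finite (disk_edges X)"
proof (rule finite_subset)
  show "disk_edges X \<subseteq> {e \<in> E. e \<inter> closed_disk X \<noteq> {}}"
    unfolding disk_edges_def using edge_minus_V_nonempty by blast
qed (rule finite_edges_meeting_bounded[OF bounded_closed_disk])

lemma face_Int_circuit: "F \<in> faces V E \<Longrightarrow> F \<inter> \<Union>X = {}"
  using face_Int_Union_E[of F] X_subset_E by blast

lemma face_inside_or_outside: "F \<in> faces V E \<Longrightarrow> F \<subseteq> inside (\<Union>X) \<or> F \<subseteq> outside (\<Union>X)"
  by (intro connected_inside_or_outside[OF jordan_X] connected_face face_Int_circuit)

lemma frontier_disk_face: "F \<in> disk_faces X \<Longrightarrow> frontier F \<subseteq> closed_disk X"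
  using closure_mono[of F "inside (\<Union>X)"] closure_inside_jordan_curve[OF jordan_X] closure_Un_frontier[of F]
  unfolding disk_faces_def by blast

lemma finite_disk_faces: "finite (disk_faces X)"
proof (rule finite_imageD)
  have "(\<lambda>F. frontier F \<inter> V) ` disk_faces X \<subseteq> Pow (disk_vertices X)"
    using frontier_disk_face unfolding disk_vertices_def by blast
  then show "finite ((\<lambda>F. frontier F \<inter> V) ` disk_faces X)"
    using finite_disk_vertices finite_subset by blast
  show "inj_on (\<lambda>F. frontier F \<inter> V) (disk_faces X)"
    by (rule inj_on_subset[OF inj_on_frontier_Int_V]) (auto simp: disk_faces_def)
qed

lemma disk_edges_iff:
  assumes "e \<in> E"
  shows "e \<in> disk_edges X \<longleftrightarrow> e \<in> X \<or> e - V \<subseteq> inside (\<Union>X)"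
proof (cases "e \<in> X")
  case True
  then show ?thesis
    using assms unfolding disk_edges_def by blast
next
  case False
  have "e \<subseteq> closed_disk X \<longleftrightarrow> e - V \<subseteq> inside (\<Union>X)"
  proof
    assume "e \<subseteq> closed_disk X"
    then show "e - V \<subseteq> inside (\<Union>X)"
      using edge_Int_Union[OF X_subset_E assms False] by blast
  next
    assume "e - V \<subseteq> inside (\<Union>X)"
    then have "closure (e - V) \<subseteq> closure (inside (\<Union>X))"
      by (rule closure_mono)
    then show "e \<subseteq> closed_disk X"
      using edge_subset_closure[OF assms] closure_inside_jordan_curve[OF jordan_X] by simp
  qed
  then show ?thesis
    using assms False unfolding disk_edges_def by simp
qed

lemma triangle_inside_imp_disk_edge:
  assumes "triangle a b c" "triangle_interior a b c \<subseteq> inside (\<Union>X)"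
  shows "edge a b \<in> disk_edges X"
proof -
  have "closure (triangle_interior a b c) \<subseteq> closed_disk X"
    using closure_mono[OF assms(2)] closure_inside_jordan_curve[OF jordan_X] by simp
  then show ?thesis
    using edge_subset_closure_triangle[OF assms(1)] edge_in_E[OF triangle_adjacent(1)[OF assms(1)]]
    unfolding disk_edges_def by blast
qed

lemma edge_inside_iff_triangle_inside:
  assumes tri: "triangle a b c" and notin: "edge a b \<notin> X"
  shows "edge a b - V \<subseteq> inside (\<Union>X) \<longleftrightarrow> triangle_interior a b c \<subseteq> inside (\<Union>X)"
proof (rule same_side_of_jordan_curve[OF jordan_X])
  have E: "edge a b \<in> E"
    using edge_in_E[OF triangle_adjacent(1)[OF tri]] .
  show "connected (edge a b - V)" "(edge a b - V) \<inter> \<Union>X = {}"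
    using connected_edge_minus_V[OF E] edge_Int_Union[OF X_subset_E E notin] by auto
  show "(edge a b - V) \<inter> closure (triangle_interior a b c) \<noteq> {}"
    using edge_minus_V_nonempty[OF E] edge_subset_closure_triangle[OF tri] by blast
qed (use connected_face face_Int_circuit triangle_face[OF tri] in auto)

lemma disk_edges_iff_triangle_inside:
  assumes "triangle a b c" "edge a b \<notin> X"
  shows "edge a b \<in> disk_edges X \<longleftrightarrow> triangle_interior a b c \<subseteq> inside (\<Union>X)"
  using disk_edges_iff[OF edge_in_E[OF triangle_adjacent(1)[OF assms(1)]]]
    edge_inside_iff_triangle_inside[OF assms] assms(2) by simp

lemma ex_inner_triangle:
  assumes ab: "adjacent a b" "edge a b \<in> X"
  obtains c where "triangle a b c" "triangle_interior a b c \<subseteq> inside (\<Union>X)"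
proof -
  obtain p where p: "p \<in> edge a b" "p \<notin> V"
    using ab(1) by (rule edge_inner_point)
  have "p \<in> closure (inside (\<Union>X))"
    using closure_inside_jordan_curve[OF jordan_X] p(1) ab(2) by blast
  moreover have "inside (\<Union>X) \<inter> edge a b = {}"
    using inside_no_overlap[of "\<Union>X"] ab(2) by blast
  ultimately obtain c where "triangle a b c" "triangle_interior a b c \<inter> inside (\<Union>X) \<noteq> {}"
    by (rule ex_triangle_near[OF ab(1) p])
  then show ?thesis
    using that face_inside_or_outside[OF triangle_face] inside_Int_outside[of "\<Union>X"] by blast
qed

lemma ex_outer_triangle:
  assumes ab: "adjacent a b" "edge a b \<in> X"
  obtains c where "triangle a b c" "\<not> triangle_interior a b c \<subseteq> inside (\<Union>X)"
proof -
  obtain p where p: "p \<in> edge a b" "p \<notin> V"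
    using ab(1) by (rule edge_inner_point)
  have "p \<in> closure (outside (\<Union>X))"
    using closure_outside_jordan_curve[OF jordan_X] p(1) ab(2) by blast
  moreover have "outside (\<Union>X) \<inter> edge a b = {}"
    using outside_no_overlap[of "\<Union>X"] ab(2) by blast
  ultimately obtain c where "triangle a b c" "triangle_interior a b c \<inter> outside (\<Union>X) \<noteq> {}"
    by (rule ex_triangle_near[OF ab(1) p])
  then show ?thesis
    using that inside_Int_outside[of "\<Union>X"] by blast
qed

lemma circuit_edge_separates_triangles:
  assumes "edge a b \<in> X" and abc: "triangle a b c" and abd: "triangle a b d" "c \<noteq> d"
  shows "triangle_interior a b c \<subseteq> inside (\<Union>X) \<longleftrightarrow> \<not> triangle_interior a b d \<subseteq> inside (\<Union>X)"
proof -
  have ab: "adjacent a b"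
    using triangle_adjacent(1)[OF abc] .
  obtain x where x: "triangle a b x" "triangle_interior a b x \<subseteq> inside (\<Union>X)"
    using ab assms(1) by (rule ex_inner_triangle)
  obtain y where y: "triangle a b y" "\<not> triangle_interior a b y \<subseteq> inside (\<Union>X)"
    using ab assms(1) by (rule ex_outer_triangle)
  show ?thesis
    using x y triangle_at_most_two[OF abc abd x(1)] triangle_at_most_two[OF abc abd y(1)] by auto
qed

lemma disk_faces_iff:
  assumes F: "F \<in> faces V E"
  shows "F \<in> disk_faces X \<longleftrightarrow> {e \<in> E. e \<subseteq> frontier F} \<subseteq> disk_edges X"
proof
  assume "F \<in> disk_faces X"
  then show "{e \<in> E. e \<subseteq> frontier F} \<subseteq> disk_edges X"
    using frontier_disk_face unfolding disk_edges_def by blast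
next
  assume edges: "{e \<in> E. e \<subseteq> frontier F} \<subseteq> disk_edges X"
  obtain e\<^sub>1 e\<^sub>2 e\<^sub>3 where "e\<^sub>1 \<in> E" "e\<^sub>2 \<in> E" "e\<^sub>3 \<in> E" "frontier F = e\<^sub>1 \<union> e\<^sub>2 \<union> e\<^sub>3"
    using F by (rule frontier_face)
  then have frontier: "frontier F \<subseteq> closed_disk X"
    using edges unfolding disk_edges_def by blast
  have "\<not> F \<subseteq> outside (\<Union>X)"
  proof
    assume "F \<subseteq> outside (\<Union>X)"
    moreover have "outside (\<Union>X) \<inter> frontier F = {}"
      using frontier outside_no_overlap[of "\<Union>X"] inside_Int_outside[of "\<Union>X"] by blast
    ultimately have "outside (\<Union>X) \<subseteq> F"
      using connected_Int_frontier[OF connected_outside_jordan_curve[OF jordan_X], of F]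
        face_nonempty[OF F] by blast
    then show False
      using unbounded_outside_jordan_curve[OF jordan_X] bounded_face[OF F] bounded_subset by blast
  qed
  then show "F \<in> disk_faces X"
    using face_inside_or_outside[OF F] F unfolding disk_faces_def by blast
qed

end

definition edge_theta :: "complex set set \<Rightarrow> complex set set \<Rightarrow> complex set set \<Rightarrow> bool" where
  "edge_theta X Y M \<longleftrightarrow> X \<subseteq> E \<and> Y \<subseteq> E \<and> M \<subseteq> E \<and>
     (\<exists>x y. theta_curve (\<Union>X) (\<Union>Y) (\<Union>M) x y) \<and> \<Union>M \<inter> inside (\<Union>X \<union> \<Union>Y) \<noteq> {}"

context
  fixes X Y M assumes theta: "edge_theta X Y M"
begin

lemma edge_theta_circuits: "edge_circuit (X \<union> Y)" "edge_circuit (X \<union> M)" "edge_circuit (Y \<union> M)"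
  using theta theta_curve_jordan_curves unfolding edge_theta_def edge_circuit_def Union_Un_distrib by blast+

lemma edge_theta_disjoint_insides: "inside (\<Union>(X \<union> M)) \<inter> inside (\<Union>(Y \<union> M)) = {}"
  using theta theta_curve_split_inside(1) unfolding edge_theta_def Union_Un_distrib by blast

lemma edge_theta_inside_cover:
  "inside (\<Union>(X \<union> Y)) \<subseteq> inside (\<Union>(X \<union> M)) \<union> inside (\<Union>(Y \<union> M)) \<union> \<Union>M"
  "inside (\<Union>(X \<union> M)) \<union> inside (\<Union>(Y \<union> M)) \<subseteq> inside (\<Union>(X \<union> Y))"
  using theta theta_curve_split_inside(2) unfolding edge_theta_def Union_Un_distrib by blast+

lemma edge_theta_closed_disk:
  "closed_disk (X \<union> Y) = closed_disk (X \<union> M) \<union> closed_disk (Y \<union> M)"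
  "closed_disk (X \<union> M) \<inter> closed_disk (Y \<union> M) = \<Union>M"
proof -
  obtain x y where curve: "theta_curve (\<Union>X) (\<Union>Y) (\<Union>M) x y"
    using theta unfolding edge_theta_def by blast
  have split: "inside (\<Union>(X \<union> M)) \<union> inside (\<Union>(Y \<union> M)) \<union> (\<Union>M - {x, y}) = inside (\<Union>(X \<union> Y))"
    using theta theta_curve_split_inside(2)[OF curve] unfolding edge_theta_def Union_Un_distrib by blast
  have arcs: "arc_between (\<Union>X) x y" "arc_between (\<Union>M) x y" and Int: "\<Union>X \<inter> \<Union>Y \<subseteq> {x, y}"
    using curve unfolding theta_curve_def by auto
  have ends: "{x, y} \<subseteq> \<Union>X" "\<Union>X \<inter> \<Union>Y \<subseteq> \<Union>M"
    using arc_between_ends(1,2)[OF arcs(1)] arc_between_ends(1,2)[OF arcs(2)] Int by blast+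
  show "closed_disk (X \<union> Y) = closed_disk (X \<union> M) \<union> closed_disk (Y \<union> M)"
    unfolding split[symmetric] using ends(1) by blast
  have set_eq: "(A \<union> C \<union> P) \<inter> (B \<union> C \<union> Q) = C"
    if "A \<inter> Q = {}" "B \<inter> P = {}" "P \<inter> Q = {}" "A \<inter> B \<subseteq> C" for A B C P Q :: "complex set"
    using that by blast
  have "(\<Union>X \<union> \<Union>Y) \<inter> inside (\<Union>(X \<union> Y)) = {}"
    using inside_no_overlap[of "\<Union>(X \<union> Y)"] unfolding Union_Un_distrib by blast
  then have "\<Union>X \<inter> inside (\<Union>(Y \<union> M)) = {}" "\<Union>Y \<inter> inside (\<Union>(X \<union> M)) = {}"
    using edge_theta_inside_cover(2) by blast+
  then show "closed_disk (X \<union> M) \<inter> closed_disk (Y \<union> M) = \<Union>M"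
    using edge_theta_disjoint_insides ends(2) set_eq[of "\<Union>X"] unfolding Union_Un_distrib by simp
qed

lemma edge_theta_connected_split:
  assumes "connected S" "S \<subseteq> inside (\<Union>(X \<union> Y))" "S \<inter> \<Union>M = {}"
  shows "S \<subseteq> inside (\<Union>(X \<union> M)) \<or> S \<subseteq> inside (\<Union>(Y \<union> M))"
  using theta assms theta_curve_connected_split unfolding edge_theta_def Union_Un_distrib by blast

lemma edge_theta_vertices:
  "disk_vertices (X \<union> Y) = disk_vertices (X \<union> M) \<union> disk_vertices (Y \<union> M)"
  "disk_vertices (X \<union> M) \<inter> disk_vertices (Y \<union> M) = V \<inter> \<Union>M"
  using edge_theta_closed_disk unfolding disk_vertices_def by blast+

lemma edge_theta_edges:
  "disk_edges (X \<union> Y) = disk_edges (X \<union> M) \<union> disk_edges (Y \<union> M)"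
  "disk_edges (X \<union> M) \<inter> disk_edges (Y \<union> M) = M"
proof -
  have sub: "X \<subseteq> E" "Y \<subseteq> E" "M \<subseteq> E"
    using theta unfolding edge_theta_def by auto
  show "disk_edges (X \<union> M) \<inter> disk_edges (Y \<union> M) = M"
  proof
    have "e \<in> M" if "e \<in> E" "e \<subseteq> closed_disk (X \<union> M) \<inter> closed_disk (Y \<union> M)" for e
      using edge_subset_Union[OF sub(3) that(1)] that(2) unfolding edge_theta_closed_disk(2) .
    then show "disk_edges (X \<union> M) \<inter> disk_edges (Y \<union> M) \<subseteq> M"
      unfolding disk_edges_def by blast
    show "M \<subseteq> disk_edges (X \<union> M) \<inter> disk_edges (Y \<union> M)"
      using sub(3) unfolding disk_edges_def by blast
  qed
  show "disk_edges (X \<union> Y) = disk_edges (X \<union> M) \<union> disk_edges (Y \<union> M)"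
  proof
    show "disk_edges (X \<union> M) \<union> disk_edges (Y \<union> M) \<subseteq> disk_edges (X \<union> Y)"
      unfolding disk_edges_def edge_theta_closed_disk(1) by blast
    show "disk_edges (X \<union> Y) \<subseteq> disk_edges (X \<union> M) \<union> disk_edges (Y \<union> M)"
    proof
      fix e assume e: "e \<in> disk_edges (X \<union> Y)"
      then have E: "e \<in> E"
        unfolding disk_edges_def by blast
      note iff = disk_edges_iff[OF edge_theta_circuits(1) E] disk_edges_iff[OF edge_theta_circuits(2) E]
        disk_edges_iff[OF edge_theta_circuits(3) E]
      show "e \<in> disk_edges (X \<union> M) \<union> disk_edges (Y \<union> M)"
      proof (cases "e \<in> X \<union> Y \<union> M")
        case True
        then show ?thesis
          using iff(2,3) by blast
      next
        case False
        then have "e - V \<subseteq> inside (\<Union>(X \<union> Y))" "(e - V) \<inter> \<Union>M = {}"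
          using e iff(1) edge_Int_Union[OF sub(3) E] by blast+
        then show ?thesis
          using edge_theta_connected_split[OF connected_edge_minus_V[OF E]] iff(2,3) by blast
      qed
    qed
  qed
qed

lemma edge_theta_faces:
  "disk_faces (X \<union> Y) = disk_faces (X \<union> M) \<union> disk_faces (Y \<union> M)"
  "disk_faces (X \<union> M) \<inter> disk_faces (Y \<union> M) = {}"
proof -
  show "disk_faces (X \<union> M) \<inter> disk_faces (Y \<union> M) = {}"
    using edge_theta_disjoint_insides face_nonempty unfolding disk_faces_def by blast
  show "disk_faces (X \<union> Y) = disk_faces (X \<union> M) \<union> disk_faces (Y \<union> M)"
  proof
    show "disk_faces (X \<union> M) \<union> disk_faces (Y \<union> M) \<subseteq> disk_faces (X \<union> Y)"
      using edge_theta_inside_cover(2) unfolding disk_faces_def by blast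
    show "disk_faces (X \<union> Y) \<subseteq> disk_faces (X \<union> M) \<union> disk_faces (Y \<union> M)"
    proof
      fix F assume "F \<in> disk_faces (X \<union> Y)"
      then have F: "F \<in> faces V E" "F \<subseteq> inside (\<Union>(X \<union> Y))"
        unfolding disk_faces_def by auto
      have "F \<inter> \<Union>M = {}"
        using face_Int_Union_E[OF F(1)] theta unfolding edge_theta_def by blast
      then show "F \<in> disk_faces (X \<union> M) \<union> disk_faces (Y \<union> M)"
        using edge_theta_connected_split[OF connected_face[OF F(1)] F(2)] F(1)
        unfolding disk_faces_def by blast
    qed
  qed
qed

end

text \<open>The disk bounded by the cycle \<^term>\<open>x # p @ y # q\<close> is cut along the path \<^term>\<open>x # m @ [y]\<close>.\<close>
definition disk_split ::
  "complex \<Rightarrow> complex list \<Rightarrow> complex \<Rightarrow> complex list \<Rightarrow> complex list \<Rightarrow> bool" where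
  "disk_split x p y q m \<longleftrightarrow> graph_cycle adjacent (x # p @ y # q) \<and> successively adjacent (x # m @ [y]) \<and>
     distinct (x # p @ m @ q @ [y]) \<and> (p \<noteq> [] \<or> m \<noteq> []) \<and> (q \<noteq> [] \<or> m \<noteq> []) \<and>
     \<Union>(path_edges (x # m @ [y])) \<inter> inside (\<Union>(boundary_edges (x # p @ y # q))) \<noteq> {}"

context
  fixes x p y q m assumes split: "disk_split x p y q m"
begin

lemma disk_split_paths:
  "successively adjacent (x # p @ [y])" "distinct (x # p @ [y])"
  "successively adjacent (x # rev q @ [y])" "distinct (x # rev q @ [y])"
  "successively adjacent (x # m @ [y])" "distinct (x # m @ [y])"
  using split unfolding disk_split_def graph_cycle_split_iff[OF symp_adjacent] by auto

lemma disk_split_cycles: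
  "graph_cycle adjacent (x # p @ y # q)" "graph_cycle adjacent (x # p @ y # rev m)"
  "graph_cycle adjacent (x # m @ y # q)"
  using split unfolding disk_split_def graph_cycle_split_iff[OF symp_adjacent] by auto

lemma disk_split_boundary_edges:
  "boundary_edges (x # p @ y # q) = path_edges (x # p @ [y]) \<union> path_edges (x # rev q @ [y])"
  "boundary_edges (x # p @ y # rev m) = path_edges (x # p @ [y]) \<union> path_edges (x # m @ [y])"
  "boundary_edges (x # m @ y # q) = path_edges (x # rev q @ [y]) \<union> path_edges (x # m @ [y])"
  unfolding boundary_edges_split by auto

lemma edge_theta_disk_split:
  "edge_theta (path_edges (x # p @ [y])) (path_edges (x # rev q @ [y])) (path_edges (x # m @ [y]))"
proof -
  note paths = disk_split_paths
  have "set p \<inter> set (rev q) = {}" "p \<noteq> [] \<or> rev q \<noteq> []" "set p \<inter> set m = {}" "p \<noteq> [] \<or> m \<noteq> []"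
    "set (rev q) \<inter> set m = {}" "rev q \<noteq> [] \<or> m \<noteq> []"
    using split unfolding disk_split_def graph_cycle_split_iff[OF symp_adjacent] by auto
  then have "theta_curve (\<Union>(path_edges (x # p @ [y]))) (\<Union>(path_edges (x # rev q @ [y])))
      (\<Union>(path_edges (x # m @ [y]))) x y"
    unfolding theta_curve_def
    using arc_between_path[OF paths(1,2)] arc_between_path[OF paths(3,4)] arc_between_path[OF paths(5,6)]
      path_edges_Int[OF paths(1-4)] path_edges_Int[OF paths(1,2,5,6)] path_edges_Int[OF paths(3-6)] by simp
  moreover have "\<Union>(path_edges (x # m @ [y])) \<inter>
      inside (\<Union>(path_edges (x # p @ [y])) \<union> \<Union>(path_edges (x # rev q @ [y]))) \<noteq> {}"
    using split unfolding disk_split_def boundary_edges_split Union_Un_distrib by simp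
  ultimately show ?thesis
    unfolding edge_theta_def using path_edges_subset_E[OF paths(1)] path_edges_subset_E[OF paths(3)]
      path_edges_subset_E[OF paths(5)] by blast
qed

lemma disk_split_vertices:
  "disk_vertices (boundary_edges (x # p @ y # q)) =
     disk_vertices (boundary_edges (x # p @ y # rev m)) \<union> disk_vertices (boundary_edges (x # m @ y # q))"
  "disk_vertices (boundary_edges (x # p @ y # rev m)) \<inter> disk_vertices (boundary_edges (x # m @ y # q)) =
     set (x # m @ [y])"
  using edge_theta_vertices[OF edge_theta_disk_split] Union_path_edges_Int_V[OF disk_split_paths(5)]
  unfolding disk_split_boundary_edges by (simp_all add: Int_commute)

lemma disk_split_edges:
  "disk_edges (boundary_edges (x # p @ y # q)) =
     disk_edges (boundary_edges (x # p @ y # rev m)) \<union> disk_edges (boundary_edges (x # m @ y # q))"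
  "disk_edges (boundary_edges (x # p @ y # rev m)) \<inter> disk_edges (boundary_edges (x # m @ y # q)) =
     path_edges (x # m @ [y])"
  using edge_theta_edges[OF edge_theta_disk_split] unfolding disk_split_boundary_edges by simp_all

lemma disk_split_faces:
  "disk_faces (boundary_edges (x # p @ y # q)) =
     disk_faces (boundary_edges (x # p @ y # rev m)) \<union> disk_faces (boundary_edges (x # m @ y # q))"
  "disk_faces (boundary_edges (x # p @ y # rev m)) \<inter> disk_faces (boundary_edges (x # m @ y # q)) = {}"
  using edge_theta_faces[OF edge_theta_disk_split] unfolding disk_split_boundary_edges by simp_all

lemma card_disk_split_vertices:
  "card (disk_vertices (boundary_edges (x # p @ y # q))) + (length m + 2) =
     card (disk_vertices (boundary_edges (x # p @ y # rev m))) + card (disk_vertices (boundary_edges (x # m @ y # q)))"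
  using card_Un_Int[OF finite_disk_vertices finite_disk_vertices, of "boundary_edges (x # p @ y # rev m)"
      "boundary_edges (x # m @ y # q)"] distinct_card[OF disk_split_paths(6)]
  by (simp add: edge_circuit_boundary disk_split_cycles disk_split_vertices)

lemma card_disk_split_edges:
  "card (disk_edges (boundary_edges (x # p @ y # q))) + (length m + 1) =
     card (disk_edges (boundary_edges (x # p @ y # rev m))) + card (disk_edges (boundary_edges (x # m @ y # q)))"
  using card_Un_Int[OF finite_disk_edges finite_disk_edges, of "boundary_edges (x # p @ y # rev m)"
      "boundary_edges (x # m @ y # q)"] card_path_edges[OF disk_split_paths(5,6)]
  by (simp add: edge_circuit_boundary disk_split_cycles disk_split_edges)

lemma card_disk_split_faces:
  "card (disk_faces (boundary_edges (x # p @ y # q))) =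
     card (disk_faces (boundary_edges (x # p @ y # rev m))) + card (disk_faces (boundary_edges (x # m @ y # q)))"
  using card_Un_disjoint[OF finite_disk_faces finite_disk_faces disk_split_faces(2)]
  by (simp add: edge_circuit_boundary disk_split_cycles disk_split_faces)

end

lemma card_disk_faces_pos:
  assumes cycle: "graph_cycle adjacent cs"
  shows "card (disk_faces (boundary_edges cs)) > 0"
proof -
  note circuit = edge_circuit_boundary[OF cycle]
  obtain x y zs where cs: "cs = x # y # zs" "adjacent x y"
    using cycle by (auto elim!: graph_cycleE)
  then have "edge x y \<in> boundary_edges cs"
    unfolding boundary_edges_def by simp
  then obtain c where "triangle x y c" "triangle_interior x y c \<subseteq> inside (\<Union>(boundary_edges cs))"
    by (rule ex_inner_triangle[OF circuit cs(2)])
  then have "triangle_interior x y c \<in> disk_faces (boundary_edges cs)"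
    using triangle_face unfolding disk_faces_def by blast
  then show ?thesis
    using finite_disk_faces[OF circuit] by (auto simp: card_gt_0_iff)
qed

lemma chord_notin_boundary_edges:
  assumes cycle: "graph_cycle adjacent (x # p @ y # q)" and "adjacent x y" "p \<noteq> []" "q \<noteq> []"
  shows "edge x y \<notin> boundary_edges (x # p @ y # q)"
proof -
  have "successively adjacent (x # p @ [y])" "distinct (x # p @ [y])"
    "successively adjacent (x # rev q @ [y])" "distinct (x # rev q @ [y])"
    using cycle unfolding graph_cycle_split_iff[OF symp_adjacent] by auto
  then show ?thesis
    using end_edge_in_path_edges[of x p y] end_edge_in_path_edges[of x "rev q" y] assms(2-4)
    unfolding boundary_edges_split by auto
qed

lemma inner_triangle_edge_meets_inside:
  assumes cycle: "graph_cycle adjacent cs" and tri: "triangle a b c"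
    and "triangle_interior a b c \<subseteq> inside (\<Union>(boundary_edges cs))" "edge a b \<notin> boundary_edges cs"
  shows "edge a b \<inter> inside (\<Union>(boundary_edges cs)) \<noteq> {}"
  using edge_inside_iff_triangle_inside[OF edge_circuit_boundary[OF cycle] tri assms(4)] assms(3)
    edge_minus_V_nonempty[OF edge_in_E[OF triangle_adjacent(1)[OF tri]]] by blast

lemma chord_disk_split:
  assumes cycle: "graph_cycle adjacent (x # p @ y # q)" and "p \<noteq> []" "q \<noteq> []"
    and tri: "triangle x y z" "triangle_interior x y z \<subseteq> inside (\<Union>(boundary_edges (x # p @ y # q)))"
  shows "disk_split x p y q []"
proof -
  have "adjacent x y"
    using triangle_adjacent(1)[OF tri(1)] .
  moreover from this have "edge x y \<notin> boundary_edges (x # p @ y # q)"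
    using chord_notin_boundary_edges[OF cycle] assms(2,3) by simp
  then have "edge x y \<inter> inside (\<Union>(boundary_edges (x # p @ y # q))) \<noteq> {}"
    by (rule inner_triangle_edge_meets_inside[OF cycle tri])
  ultimately show ?thesis
    using cycle assms(2,3) unfolding disk_split_def graph_cycle_def by simp
qed

lemma inner_vertex_disk_split:
  assumes cycle: "graph_cycle adjacent (a # b # zs)"
    and tri: "triangle a b w" "triangle_interior a b w \<subseteq> inside (\<Union>(boundary_edges (a # b # zs)))"
    and w: "w \<notin> set (a # b # zs)"
  shows "disk_split a [] b zs [w]"
proof -
  have adjacents: "adjacent a w" "adjacent w b"
    using triangle_adjacent[OF tri(1)] adjacent_sym by blast+
  have "w \<notin> \<Union>(boundary_edges (a # b # zs))"
    using Union_boundary_edges_Int_V[OF cycle] adjacent_in_V(2)[OF adjacents(1)] w by blast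
  then have "edge a w \<notin> boundary_edges (a # b # zs)"
    using ends_in_edge(2)[OF adjacents(1)] by blast
  moreover have "triangle a w b" "triangle_interior a w b \<subseteq> inside (\<Union>(boundary_edges (a # b # zs)))"
    using triangle_swap(2,4)[OF tri(1)] tri(2) by simp_all
  ultimately have "edge a w \<inter> inside (\<Union>(boundary_edges (a # b # zs))) \<noteq> {}"
    using inner_triangle_edge_meets_inside[OF cycle] by simp
  moreover have "zs \<noteq> []"
    using cycle by (auto simp: graph_cycle_def)
  ultimately show ?thesis
    using cycle adjacents w unfolding disk_split_def graph_cycle_def by auto
qed

lemma second_vertex_chord_split:
  assumes cycle: "graph_cycle adjacent (a # b # p @ w # q)" and "q \<noteq> []"
    and tri: "triangle a b w" "triangle_interior a b w \<subseteq> inside (\<Union>(boundary_edges (a # b # p @ w # q)))"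
  shows "disk_split a (b # p) w q []"
proof (rule chord_disk_split)
  show "triangle a w b" "triangle_interior a w b \<subseteq> inside (\<Union>(boundary_edges (a # (b # p) @ w # q)))"
    using triangle_swap(2,4)[OF tri(1)] tri(2) by simp_all
qed (use cycle \<open>q \<noteq> []\<close> in auto)

lemma last_vertex_chord_split:
  assumes cycle: "graph_cycle adjacent (a # b # p @ [w])" and "p \<noteq> []"
    and tri: "triangle a b w" "triangle_interior a b w \<subseteq> inside (\<Union>(boundary_edges (a # b # p @ [w])))"
  shows "disk_split b p w [a] []"
proof (rule chord_disk_split)
  have rotate: "boundary_edges (b # p @ [w, a]) = boundary_edges (a # b # p @ [w])"
    "graph_cycle adjacent (b # p @ [w, a])"
    using boundary_edges_rotate[of "b # p @ [w]" a] graph_cycle_rotate_iff[of adjacent "b # p @ [w]" a] cycle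
    by simp_all
  show "graph_cycle adjacent (b # p @ w # [a])"
    using rotate(2) by simp
  have "{b, w, a} = {a, b, w}"
    by blast
  from triangle_cong[OF tri(1) this]
  show "triangle b w a" "triangle_interior b w a \<subseteq> inside (\<Union>(boundary_edges (b # p @ w # [a])))"
    using tri(2) rotate(1) by simp_all
qed (use \<open>p \<noteq> []\<close> in auto)

lemma cycle_triangle_or_split:
  assumes cycle: "graph_cycle adjacent cs"
  obtains (triangle) a b c where "triangle a b c" "cs = [a, b, c]"
    | (split) x p y q m where "disk_split x p y q m" "cs = x # p @ y # q"
    | (split_rotated) a x p y m where "disk_split x p y [a] m" "cs = a # x # p @ [y]"
proof -
  obtain a b zs where cs: "cs = a # b # zs" "adjacent a b"
    using cycle by (auto elim!: graph_cycleE)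
  then have "edge a b \<in> boundary_edges cs"
    unfolding boundary_edges_def by simp
  then obtain w where tri: "triangle a b w" "triangle_interior a b w \<subseteq> inside (\<Union>(boundary_edges cs))"
    by (rule ex_inner_triangle[OF edge_circuit_boundary[OF cycle] cs(2)])
  consider (off) "w \<notin> set cs" | (on) "w \<in> set zs"
    using triangle_neq[OF tri(1)] cs(1) by auto
  then show thesis
  proof cases
    case off
    then show ?thesis
      using split[of a "[]" b zs "[w]"] inner_vertex_disk_split[of a b zs w] tri cycle cs(1) by simp
  next
    case on
    then obtain p q where zs: "zs = p @ w # q"
      by (metis split_list)
    consider (triangle) "p = []" "q = []" | (inner) "q \<noteq> []" | (last) "q = []" "p \<noteq> []"
      by blast
    then show ?thesis
    proof cases
      case triangle
      then show ?thesis
        using that(1)[OF tri(1)] cs(1) zs by simp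
    next
      case inner
      then show ?thesis
        using second_vertex_chord_split[of a b p w q] split[of a "b # p" w q "[]"] tri cycle cs(1) zs by simp
    next
      case last
      then show ?thesis
        using last_vertex_chord_split[of a b p w] split_rotated[of b p w a "[]"] tri cycle cs(1) zs by simp
    qed
  qed
qed

lemma disk_induct [consumes 1, case_names triangle rotate split]:
  assumes "graph_cycle adjacent cs"
    and triangle: "\<And>a b c. triangle a b c \<Longrightarrow> P [a, b, c]"
    and rotate: "\<And>x xs. graph_cycle adjacent (x # xs) \<Longrightarrow> P (xs @ [x]) \<Longrightarrow> P (x # xs)"
    and split: "\<And>x p y q m. disk_split x p y q m \<Longrightarrow> P (x # p @ y # rev m) \<Longrightarrow> P (x # m @ y # q) \<Longrightarrow>
      P (x # p @ y # q)"
  shows "P cs"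
  using assms(1)
proof (induction "card (disk_faces (boundary_edges cs))" arbitrary: cs rule: less_induct)
  case less
  have by_split: "P (x # p @ y # q)"
    if "disk_split x p y q m" "boundary_edges (x # p @ y # q) = boundary_edges cs" for x p y q m
  proof -
    note cycles = disk_split_cycles[OF that(1)]
    have "card (disk_faces (boundary_edges cs)) =
        card (disk_faces (boundary_edges (x # p @ y # rev m))) + card (disk_faces (boundary_edges (x # m @ y # q)))"
      using card_disk_split_faces[OF that(1)] that(2) by simp
    then have "P (x # p @ y # rev m)" "P (x # m @ y # q)"
      using less.hyps cycles(2,3) card_disk_faces_pos[OF cycles(2)] card_disk_faces_pos[OF cycles(3)]
      by simp_all
    then show ?thesis
      by (rule split[OF that(1)])
  qed
  from less.prems show ?case
  proof (cases rule: cycle_triangle_or_split)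
    case (split_rotated a x p y m)
    then have "boundary_edges (x # p @ y # [a]) = boundary_edges cs"
      using boundary_edges_rotate[of "x # p @ [y]" a] by simp
    then have "P ((x # p @ [y]) @ [a])"
      using by_split[OF split_rotated(1)] by simp
    then show ?thesis
      using rotate[of a "x # p @ [y]"] less.prems split_rotated(2) by simp
  qed (use triangle by_split in auto)
qed

lemma
  assumes tri: "triangle a b c"
  shows disk_vertices_triangle: "disk_vertices (boundary_edges [a, b, c]) = {a, b, c}"
    and disk_edges_triangle: "disk_edges (boundary_edges [a, b, c]) = {edge a b, edge b c, edge a c}"
    and disk_faces_triangle: "disk_faces (boundary_edges [a, b, c]) = {triangle_interior a b c}"
proof -
  have face: "triangle_interior a b c \<in> faces V E"
    using triangle_face[OF tri] .
  show "disk_vertices (boundary_edges [a, b, c]) = {a, b, c}"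
    using face_Int_V[OF face] triangle_boundary_Int_V[OF tri]
    unfolding disk_vertices_def Union_boundary_edges_triangle by blast
  have sub: "boundary_edges [a, b, c] \<subseteq> E"
    using boundary_edges_subset_E[OF triangle_graph_cycle[OF tri]] .
  have "e \<in> boundary_edges [a, b, c]" if "e \<in> E" "e \<subseteq> closed_disk (boundary_edges [a, b, c])" for e
    using edge_subset_Union[OF sub that(1)] face_Int_Union_E[OF face] that
    unfolding Union_boundary_edges_triangle by blast
  then have "disk_edges (boundary_edges [a, b, c]) = boundary_edges [a, b, c]"
    using sub unfolding disk_edges_def by blast
  then show "disk_edges (boundary_edges [a, b, c]) = {edge a b, edge b c, edge a c}"
    unfolding boundary_edges_triangle .
  have "F = triangle_interior a b c" if "F \<in> faces V E" "F \<subseteq> triangle_interior a b c" for F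
    using faces_eqI[OF that(1) face] that(2) face_nonempty[OF that(1)] by blast
  then show "disk_faces (boundary_edges [a, b, c]) = {triangle_interior a b c}"
    unfolding disk_faces_def Union_boundary_edges_triangle using face by blast
qed

lemma card_disk_edges_triangle:
  assumes tri: "triangle a b c"
  shows "card (disk_edges (boundary_edges [a, b, c])) = 3"
proof -
  note adjacents = triangle_adjacent[OF tri]
  have "edge a b \<noteq> edge b c" "edge a b \<noteq> edge a c" "edge b c \<noteq> edge a c"
    using edge_eq_iff[OF adjacents(1,2)] edge_eq_iff[OF adjacents(1,3)] edge_eq_iff[OF adjacents(2,3)]
      triangle_neq[OF tri] by (auto simp: doubleton_eq_iff)
  then show ?thesis
    unfolding disk_edges_triangle[OF tri] by simp
qed

theorem euler_disk:
  assumes "graph_cycle adjacent cs"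
  shows "card (disk_vertices (boundary_edges cs)) + card (disk_faces (boundary_edges cs)) =
    card (disk_edges (boundary_edges cs)) + 1"
  using assms
proof (induction rule: disk_induct)
  case (triangle a b c)
  then show ?case
    using card_disk_edges_triangle[OF triangle] triangle_neq[OF triangle]
    by (simp add: disk_vertices_triangle disk_faces_triangle)
next
  case (rotate x xs)
  then show ?case
    using boundary_edges_rotate[of xs x] by (cases "xs = []") (auto simp: graph_cycle_def)
next
  case (split x p y q m)
  then show ?case
    using card_disk_split_vertices[OF split(1)] card_disk_split_edges[OF split(1)]
      card_disk_split_faces[OF split(1)] by simp
qed

definition disk_adjacent :: "complex set set \<Rightarrow> complex \<Rightarrow> complex \<Rightarrow> bool" where
  "disk_adjacent X u w \<longleftrightarrow> adjacent u w \<and> edge u w \<in> disk_edges X"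

lemma disk_adjacent_sym: "disk_adjacent X u w \<Longrightarrow> disk_adjacent X w u"
  unfolding disk_adjacent_def using adjacent_sym edge_commute by metis

lemma disk_connected:
  assumes "graph_cycle adjacent cs"
    and "u \<in> disk_vertices (boundary_edges cs)" "w \<in> disk_vertices (boundary_edges cs)"
  shows "(disk_adjacent (boundary_edges cs))\<^sup>*\<^sup>* u w"
  using assms
proof (induction arbitrary: u w rule: disk_induct)
  case (triangle a b c)
  have "disk_adjacent (boundary_edges [a, b, c]) s t" if "s \<in> {a, b, c}" "t \<in> {a, b, c}" "s \<noteq> t" for s t
    unfolding disk_adjacent_def disk_edges_triangle[OF triangle(1)]
    using that triangle_adjacent[OF triangle(1)] adjacent_sym edge_commute by blast
  then show ?case
    using triangle(2,3) unfolding disk_vertices_triangle[OF triangle(1)]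
    by (metis r_into_rtranclp rtranclp.rtrancl_refl)
next
  case (rotate x xs)
  then show ?case
    using boundary_edges_rotate[of xs x] by (cases "xs = []") (auto simp: graph_cycle_def)
next
  case (split x p y q m)
  define R where "R = disk_adjacent (boundary_edges (x # p @ y # q))"
  have "disk_adjacent (boundary_edges (x # p @ y # rev m)) \<le> R" "disk_adjacent (boundary_edges (x # m @ y # q)) \<le> R"
    unfolding R_def disk_adjacent_def disk_split_edges(1)[OF split(1)] by blast+
  then have "(disk_adjacent (boundary_edges (x # p @ y # rev m)))\<^sup>*\<^sup>* \<le> R\<^sup>*\<^sup>*"
    "(disk_adjacent (boundary_edges (x # m @ y # q)))\<^sup>*\<^sup>* \<le> R\<^sup>*\<^sup>*"
    by (simp_all add: rtranclp_mono)
  then have connected: "R\<^sup>*\<^sup>* s t"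
    if "s \<in> disk_vertices (boundary_edges (x # p @ y # rev m)) \<and>
          t \<in> disk_vertices (boundary_edges (x # p @ y # rev m)) \<or>
        s \<in> disk_vertices (boundary_edges (x # m @ y # q)) \<and>
          t \<in> disk_vertices (boundary_edges (x # m @ y # q))" for s t
    using that split.IH by blast
  have "x \<in> disk_vertices (boundary_edges (x # p @ y # rev m))"
    "x \<in> disk_vertices (boundary_edges (x # m @ y # q))"
    using disk_split_vertices(2)[OF split(1)] by auto
  then have "R\<^sup>*\<^sup>* u x" "R\<^sup>*\<^sup>* x w"
    using connected split.prems unfolding disk_split_vertices(1)[OF split(1)] by blast+
  then show ?case
    unfolding R_def by (rule rtranclp_trans)
qed

lemma comb_disk_eq:
  assumes "graph_cycle adjacent cs"
  shows "comb_disk V E cs = (disk_vertices (boundary_edges cs), disk_edges (boundary_edges cs))"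
  unfolding comb_disk_def cycle_image_def disk_vertices_def disk_edges_def Let_def
    cycle_edges_eq_boundary_edges[OF assms] ..

end

section \<open>Links and coverings of triangulated surfaces\<close>

locale triangulated_surface =
  fixes r :: nat and adjacent :: "'v \<Rightarrow> 'v \<Rightarrow> bool" and triangle :: "'v \<Rightarrow> 'v \<Rightarrow> 'v \<Rightarrow> bool"
  assumes degree_pos: "r > 0"
    and triangle_swap: "triangle a b c \<Longrightarrow> triangle b a c" "triangle a b c \<Longrightarrow> triangle a c b"
    and triangle_adjacent: "triangle a b c \<Longrightarrow> adjacent a b"
    and adjacent_sym: "adjacent a b \<Longrightarrow> adjacent b a"
    and adjacent_irrefl: "\<not> adjacent a a"
    and card_triangles_at_edge: "adjacent a b \<Longrightarrow> card {x. triangle a b x} = 2"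
    and card_adjacent: "adjacent w u \<Longrightarrow> card {v. adjacent w v} = r"
    and link_connected: "adjacent w u \<Longrightarrow> adjacent w v \<Longrightarrow> (triangle w)\<^sup>*\<^sup>* u v"
begin

lemma triangle_sides:
  assumes "triangle a b c"
  shows "adjacent a b" "adjacent a c" "adjacent b c"
  using assms triangle_swap triangle_adjacent by metis+

lemma triangle_neq:
  assumes "triangle a b c"
  shows "a \<noteq> b" "a \<noteq> c" "b \<noteq> c"
  using triangle_sides[OF assms] adjacent_irrefl by auto

lemma triangles_at_edgeE:
  assumes "triangle a b c"
  obtains d where "d \<noteq> c" "{x. triangle a b x} = {c, d}"
proof -
  have "card {x. triangle a b x} = 2" "c \<in> {x. triangle a b x}"
    using card_triangles_at_edge triangle_adjacent assms by auto
  then show ?thesis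
    using that by (metis card_2_iff doubleton_eq_iff insert_iff singletonD)
qed

lemma triangle_at_most_two:
  assumes "triangle a b c" "triangle a b d" "c \<noteq> d" "triangle a b x"
  shows "x = c \<or> x = d"
proof -
  obtain d' where "{x. triangle a b x} = {c, d'}"
    using assms(1) by (rule triangles_at_edgeE)
  then have "d \<in> {c, d'}" "x \<in> {c, d'}"
    using assms(2,4) by blast+
  then show ?thesis
    using assms(3) by blast
qed

definition opposite :: "'v \<Rightarrow> 'v \<Rightarrow> 'v \<Rightarrow> 'v" where
  "opposite a b c = (THE d. triangle a b d \<and> d \<noteq> c)"

lemma opposite_eq:
  assumes "triangle a b c" "triangle a b d" "d \<noteq> c"
  shows "opposite a b c = d"
  unfolding opposite_def
  using assms triangle_at_most_two[OF assms(1,2)] by (intro the_equality) blast+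

lemma
  assumes "triangle a b c"
  shows triangle_opposite: "triangle a b (opposite a b c)" and opposite_neq: "opposite a b c \<noteq> c"
proof -
  obtain d where "d \<noteq> c" "{x. triangle a b x} = {c, d}"
    using assms by (rule triangles_at_edgeE)
  then have "triangle a b d" "d \<noteq> c"
    by auto
  then show "triangle a b (opposite a b c)" "opposite a b c \<noteq> c"
    using opposite_eq[OF assms] by simp_all
qed

definition link_walk :: "'v \<Rightarrow> (int \<Rightarrow> 'v) \<Rightarrow> bool" where
  "link_walk w z \<longleftrightarrow> (\<forall>i. triangle w (z i) (z (i + 1)) \<and> z (i + 1) \<noteq> z (i - 1))"

lemma
  assumes "link_walk w z"
  shows link_walk_succ: "triangle w (z i) (z (i + 1))"
    and link_walk_pred: "triangle w (z i) (z (i - 1))"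
    and link_walk_neq: "z (i + 1) \<noteq> z (i - 1)"
    and link_walk_adjacent: "adjacent w (z i)"
proof -
  have succ: "triangle w (z i) (z (i + 1))" for i
    using assms unfolding link_walk_def by blast
  then show "triangle w (z i) (z (i + 1))" "adjacent w (z i)"
    using triangle_adjacent by blast+
  show "triangle w (z i) (z (i - 1))"
    using triangle_swap(2)[OF succ[of "i - 1"]] by simp
  show "z (i + 1) \<noteq> z (i - 1)"
    using assms unfolding link_walk_def by blast
qed

lemma link_walk_neighbour: "link_walk w z \<Longrightarrow> triangle w (z i) x \<Longrightarrow> x = z (i + 1) \<or> x = z (i - 1)"
  using triangle_at_most_two link_walk_succ link_walk_pred link_walk_neq by metis

lemma link_walk_reflect:
  assumes "link_walk w z"
  shows "link_walk w (\<lambda>i. z (k - i))"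
  unfolding link_walk_def
proof
  fix i
  show "triangle w (z (k - i)) (z (k - (i + 1))) \<and> z (k - (i + 1)) \<noteq> z (k - (i - 1))"
    using link_walk_pred[OF assms, of "k - i"] link_walk_neq[OF assms, of "k - i"]
    by (simp add: algebra_simps)
qed

lemma link_walk_unique:
  assumes z: "link_walk w z" and y: "link_walk w y" and start: "z i = y j" "z (i + 1) = y (j + 1)"
  shows "z (i + k) = y (j + k)"
proof -
  define agree where "agree k \<longleftrightarrow> z (i + k) = y (j + k) \<and> z (i + (k + 1)) = y (j + (k + 1))" for k
  have "agree k \<longleftrightarrow> agree (k + 1)" for k
  proof
    assume "agree k"
    then show "agree (k + 1)"
      using link_walk_neighbour[OF z, of "i + (k + 1)" "y (j + (k + 1) + 1)"]
        link_walk_succ[OF y, of "j + (k + 1)"] link_walk_neq[OF y, of "j + (k + 1)"]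
      unfolding agree_def by (auto simp: algebra_simps)
  next
    assume "agree (k + 1)"
    then show "agree k"
      using link_walk_neighbour[OF z, of "i + (k + 1)" "y (j + (k + 1) - 1)"]
        link_walk_pred[OF y, of "j + (k + 1)"] link_walk_neq[OF y, of "j + (k + 1)"]
      unfolding agree_def by (auto simp: algebra_simps)
  qed
  moreover have "agree 0"
    using start unfolding agree_def by simp
  ultimately have "agree k"
    using int_step_induct[of agree] by blast
  then show ?thesis
    unfolding agree_def by simp
qed

lemma link_walk_unique_reflect:
  assumes z: "link_walk w z" and y: "link_walk w y" and start: "z i = y j" "z (i + 1) = y (j - 1)"
  shows "z (i + k) = y (j - k)"
  using link_walk_unique[OF z link_walk_reflect[OF y, of j], of i 0 k] start by simp

text \<open>A walk that came back to a vertex in the opposite direction would fold up, hence reverse somewhere in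
  between.\<close>
lemma link_walk_shift_eq:
  assumes z: "link_walk w z" and ij: "z i = z j"
  shows "z (i + k) = z (j + k)"
proof -
  have "z (i + 1) \<noteq> z (j - 1)"
  proof
    assume reversed: "z (i + 1) = z (j - 1)"
    have fold: "z (i + k) = z (j - k)" for k
      using link_walk_unique_reflect[OF z z ij reversed] .
    define d where "d = (j - i) div 2"
    have "j = i + 2 * d \<or> j = i + 2 * d + 1"
      unfolding d_def by presburger
    then show False
    proof
      assume "j = i + 2 * d"
      then have "z (i + d + 1) = z (i + d - 1)"
        using fold[of "d + 1"] by (simp add: algebra_simps)
      then show False
        using link_walk_neq[OF z] by blast
    next
      assume "j = i + 2 * d + 1"
      then have "z (i + d) = z (i + d + 1)"
        using fold[of d] by (simp add: algebra_simps)
      then show False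
        using triangle_neq(3)[OF link_walk_succ[OF z]] by blast
    qed
  qed
  moreover have "triangle w (z j) (z (i + 1))"
    using link_walk_succ[OF z, of i] ij by simp
  ultimately have "z (i + 1) = z (j + 1)"
    using link_walk_neighbour[OF z] by blast
  then show ?thesis
    using link_walk_unique[OF z z ij] by blast
qed

lemma range_link_walk:
  assumes z: "link_walk w z"
  shows "range z = {u. adjacent w u}"
proof
  show "range z \<subseteq> {u. adjacent w u}"
    using link_walk_adjacent[OF z] by blast
  show "{u. adjacent w u} \<subseteq> range z"
  proof
    fix u assume "u \<in> {u. adjacent w u}"
    then have "(triangle w)\<^sup>*\<^sup>* (z 0) u"
      using link_connected link_walk_adjacent[OF z] by blast
    then show "u \<in> range z"
      by induction (use link_walk_neighbour[OF z] in blast)+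
  qed
qed

lemma link_walk_eq_iff:
  assumes z: "link_walk w z"
  shows "z i = z j \<longleftrightarrow> int r dvd i - j"
proof -
  have "card (range z) = r"
    unfolding range_link_walk[OF z] by (rule card_adjacent[OF link_walk_adjacent[OF z]])
  then show ?thesis
    using eq_iff_card_range_dvd[of z i j] link_walk_shift_eq[OF z] degree_pos card_ge_0_finite[of "range z"]
    by metis
qed

lemma link_walk_periodic: "link_walk w z \<Longrightarrow> z (i + int r) = z i"
  by (simp add: link_walk_eq_iff)

lemma bij_betw_link_walk:
  assumes z: "link_walk w z"
  shows "bij_betw z {1..int r} {u. adjacent w u}"
proof -
  have "{1..int r} = {1..<1 + int r}"
    by auto
  then show ?thesis
    using bij_betw_period[of z "int r" 1] link_walk_eq_iff[OF z] degree_pos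
    by (simp add: range_link_walk[OF z])
qed

lemma link_walk_positionE:
  assumes "link_walk w z" "adjacent w u"
  obtains t where "1 \<le> t" "t \<le> int r" "u = z t"
  using bij_betw_link_walk[OF assms(1)] assms(2) unfolding bij_betw_def by force

lemma link_walk_inj:
  assumes "link_walk w z" "z s = z t" "\<bar>s - t\<bar> < int r"
  shows "s = t"
  using assms link_walk_eq_iff dvd_diff_small_imp_eq by blast

lemma ex_link_walk:
  assumes "triangle w a b"
  obtains z where "link_walk w z" "z 0 = a" "z 1 = b"
proof -
  define turn where "turn = (\<lambda>(a, b). (b, opposite w b a))"
  define unturn where "unturn = (\<lambda>(a, b). (opposite w a b, a))"
  define S where "S = {(a, b). triangle w a b}"
  have "bij_betw turn S S"
  proof (rule bij_betw_byWitness[where f' = unturn])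
    show "\<forall>s\<in>S. unturn (turn s) = s" "\<forall>s\<in>S. turn (unturn s) = s"
      unfolding S_def turn_def unturn_def
      using triangle_swap(2) triangle_opposite opposite_neq opposite_eq by (auto; metis)+
    show "turn ` S \<subseteq> S" "unturn ` S \<subseteq> S"
      unfolding S_def turn_def unturn_def using triangle_swap(2) triangle_opposite by auto
  qed
  moreover have "(a, b) \<in> S"
    using assms unfolding S_def by simp
  ultimately obtain x :: "int \<Rightarrow> 'v \<times> 'v" where x: "x 0 = (a, b)" "\<And>i. x i \<in> S" "\<And>i. x (i + 1) = turn (x i)"
    by (rule bij_betw_int_orbit) blast
  define z where "z i = fst (x i)" for i
  have step: "x i = (z i, z (i + 1))" for i
    unfolding z_def x(3) turn_def by (simp add: case_prod_beta)
  have tri: "triangle w (z i) (z (i + 1))" for i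
    using x(2)[of i] unfolding step S_def by simp
  have "z (i + 1) \<noteq> z (i - 1)" for i
    using x(3)[of "i - 1"] opposite_neq[OF triangle_swap(2)[OF tri[of "i - 1"]]]
    unfolding step turn_def by simp
  then have "link_walk w z"
    unfolding link_walk_def using tri by blast
  moreover have "z 0 = a" "z 1 = b"
    using step[of 0] x(1) by simp_all
  ultimately show ?thesis
    by (rule that)
qed

definition link_from :: "'v \<Rightarrow> 'v \<Rightarrow> 'v \<Rightarrow> int \<Rightarrow> 'v" where
  "link_from w a b = (SOME z. link_walk w z \<and> z 0 = a \<and> z 1 = b)"

lemma
  assumes "triangle w a b"
  shows link_walk_link_from: "link_walk w (link_from w a b)"
    and link_from_0: "link_from w a b 0 = a" and link_from_1: "link_from w a b 1 = b"
proof -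
  have "\<exists>z. link_walk w z \<and> z 0 = a \<and> z 1 = b"
    using ex_link_walk[OF assms] by blast
  then show "link_walk w (link_from w a b)" "link_from w a b 0 = a" "link_from w a b 1 = b"
    unfolding link_from_def by (metis (mono_tags, lifting) someI_ex)+
qed

inductive null_cycle :: "'v list \<Rightarrow> bool" where
  triangle: "triangle a b c \<Longrightarrow> null_cycle [a, b, c]"
| rotate: "graph_cycle adjacent (x # xs) \<Longrightarrow> null_cycle (xs @ [x]) \<Longrightarrow> null_cycle (x # xs)"
| split: "graph_cycle adjacent (x # p @ y # q) \<Longrightarrow> graph_cycle adjacent (x # p @ y # rev m) \<Longrightarrow>
    null_cycle (x # p @ y # rev m) \<Longrightarrow> null_cycle (x # m @ y # q) \<Longrightarrow> null_cycle (x # p @ y # q)"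

end

locale simply_connected_surface = triangulated_surface +
  assumes cycles_null: "graph_cycle adjacent cs \<Longrightarrow> null_cycle cs"

locale surface_covering = simply_connected_surface r adjacent triangle
  for r :: nat and adjacent :: "'v \<Rightarrow> 'v \<Rightarrow> bool" and triangle :: "'v \<Rightarrow> 'v \<Rightarrow> 'v \<Rightarrow> bool" +
  fixes cover :: "'x set" and nbrs :: "'x \<Rightarrow> 'x set" and proj :: "'x \<Rightarrow> 'v"
  assumes nbrs_subset: "x \<in> cover \<Longrightarrow> nbrs x \<subseteq> cover"
    and nbrs_sym: "x \<in> cover \<Longrightarrow> y \<in> nbrs x \<Longrightarrow> x \<in> nbrs y"
    and bij_betw_nbrs: "x \<in> cover \<Longrightarrow> bij_betw proj (nbrs x) {u. adjacent (proj x) u}"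
    and nbrs_triangle: "x \<in> cover \<Longrightarrow> y \<in> nbrs x \<Longrightarrow> z \<in> nbrs x \<Longrightarrow>
      triangle (proj x) (proj y) (proj z) \<Longrightarrow> z \<in> nbrs y"
    and cover_connected: "x \<in> cover \<Longrightarrow> y \<in> cover \<Longrightarrow> (\<lambda>x y. y \<in> nbrs x)\<^sup>*\<^sup>* x y"
begin

definition lift_step :: "'x \<Rightarrow> 'v \<Rightarrow> 'x" where
  "lift_step x u = inv_into (nbrs x) proj u"

definition lift :: "'x \<Rightarrow> 'v list \<Rightarrow> 'x" where
  "lift x us = foldl lift_step x us"

lemma lift_simps [simp]:
  "lift x [] = x" "lift x (u # us) = lift (lift_step x u) us" "lift x (us @ vs) = lift (lift x us) vs"
  by (simp_all add: lift_def)

lemma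
  assumes "x \<in> cover" "adjacent (proj x) u"
  shows lift_step_in_nbrs: "lift_step x u \<in> nbrs x"
    and proj_lift_step: "proj (lift_step x u) = u"
    and lift_step_in_cover: "lift_step x u \<in> cover"
proof -
  have "u \<in> proj ` nbrs x"
    using bij_betw_nbrs[OF assms(1)] assms(2) by (simp add: bij_betw_def)
  then show "lift_step x u \<in> nbrs x" "proj (lift_step x u) = u"
    unfolding lift_step_def by (simp_all add: inv_into_into f_inv_into_f)
  then show "lift_step x u \<in> cover"
    using nbrs_subset[OF assms(1)] by blast
qed

lemma lift_step_proj: "x \<in> cover \<Longrightarrow> y \<in> nbrs x \<Longrightarrow> lift_step x (proj y) = y"
  unfolding lift_step_def using bij_betw_nbrs by (simp add: bij_betw_def inv_into_f_f)

lemma adjacent_proj: "x \<in> cover \<Longrightarrow> y \<in> nbrs x \<Longrightarrow> adjacent (proj x) (proj y)"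
  using bij_betw_nbrs bij_betwE by fastforce

lemma lift_step_back: "x \<in> cover \<Longrightarrow> adjacent (proj x) u \<Longrightarrow> lift_step (lift_step x u) (proj x) = x"
  using lift_step_in_nbrs lift_step_in_cover nbrs_sym lift_step_proj by metis

lemma lift_walk:
  assumes "x \<in> cover" "successively adjacent (proj x # us)"
  shows "lift x us \<in> cover" "proj (lift x us) = last (proj x # us)"
proof -
  have "lift x us \<in> cover \<and> proj (lift x us) = last (proj x # us)"
    using assms
  proof (induction us arbitrary: x)
    case (Cons u us)
    then have "adjacent (proj x) u" "successively adjacent (u # us)"
      by auto
    then show ?case
      using Cons.IH[of "lift_step x u"] Cons.prems(1) by (simp add: proj_lift_step lift_step_in_cover)
  qed simp
  then show "lift x us \<in> cover" "proj (lift x us) = last (proj x # us)"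
    by auto
qed

lemma lift_reverse:
  "x \<in> cover \<Longrightarrow> successively adjacent (proj x # us @ [b]) \<Longrightarrow>
    lift (lift x (us @ [b])) (rev us @ [proj x]) = x"
proof (induction us arbitrary: x)
  case Nil
  then show ?case
    using lift_step_back by simp
next
  case (Cons u us)
  then have u: "adjacent (proj x) u" "successively adjacent (u # us @ [b])"
    by auto
  then have "lift (lift (lift_step x u) (us @ [b])) (rev us @ [u]) = lift_step x u"
    using Cons.IH[of "lift_step x u"] Cons.prems(1) by (simp add: proj_lift_step lift_step_in_cover)
  then show ?case
    using lift_step_back[OF Cons.prems(1) u(1)] by simp
qed

definition lifts_closed :: "'v list \<Rightarrow> bool" where
  "lifts_closed ws \<longleftrightarrow> (\<forall>x\<in>cover. proj x = hd ws \<longrightarrow> lift x (tl ws) = x)"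

lemma lifts_closed_triangle:
  assumes tri: "triangle a b c"
  shows "lifts_closed [a, b, c, a]"
  unfolding lifts_closed_def
proof (intro ballI impI)
  fix x assume x: "x \<in> cover" "proj x = hd [a, b, c, a]"
  then have xb: "adjacent (proj x) b" and xc: "adjacent (proj x) c"
    using triangle_sides[OF tri] by simp_all
  have "lift_step x c \<in> nbrs (lift_step x b)"
    using nbrs_triangle[OF x(1) lift_step_in_nbrs[OF x(1) xb] lift_step_in_nbrs[OF x(1) xc]] tri x xb xc
    by (simp add: proj_lift_step)
  then have "lift_step (lift_step x b) c = lift_step x c"
    using lift_step_proj[OF lift_step_in_cover[OF x(1) xb], of "lift_step x c"] x(1) xc
    by (simp add: proj_lift_step)
  then show "lift x (tl [a, b, c, a]) = x"
    using lift_step_back[OF x(1) xc] x(2) by simp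
qed

lemma lifts_closed_rotate:
  assumes closed: "lifts_closed (y # ys @ [a, y])" and walk: "successively adjacent (a # y # ys @ [a])"
  shows "lifts_closed (a # y # ys @ [a])"
  unfolding lifts_closed_def
proof (intro ballI impI)
  fix x assume x: "x \<in> cover" "proj x = hd (a # y # ys @ [a])"
  then have y: "adjacent (proj x) y"
    using walk by simp
  define x' where "x' = lift x (y # ys @ [a])"
  have x': "x' \<in> cover" "proj x' = a"
    unfolding x'_def using lift_walk[OF x(1), of "y # ys @ [a]"] walk x(2) by simp_all
  have "lift_step x' y = lift_step x y"
    using closed lift_step_in_cover[OF x(1) y] proj_lift_step[OF x(1) y]
    unfolding lifts_closed_def x'_def by simp
  then have "lift_step (lift_step x y) a = x'"
    using lift_step_back[OF x'(1), of y] x' x(2) y by simp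
  then have "x' = x"
    using lift_step_back[OF x(1) y] x(2) by simp
  then show "lift x (tl (a # y # ys @ [a])) = x"
    unfolding x'_def by simp
qed

lemma lifts_closed_split:
  assumes p: "successively adjacent (a # p @ [y])" and m: "successively adjacent (y # rev m @ [a])"
    and closed: "lifts_closed (a # p @ y # rev m @ [a])" "lifts_closed (a # m @ y # q @ [a])"
  shows "lifts_closed (a # p @ y # q @ [a])"
  unfolding lifts_closed_def
proof (intro ballI impI)
  fix x assume x: "x \<in> cover" "proj x = hd (a # p @ y # q @ [a])"
  define x' where "x' = lift x (p @ [y])"
  have x': "x' \<in> cover" "proj x' = y"
    unfolding x'_def using lift_walk[OF x(1), of "p @ [y]"] p x(2) by simp_all
  have "lift x' (rev m @ [a]) = x"
    using closed(1) x unfolding lifts_closed_def x'_def by simp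
  then have "lift x (m @ [y]) = x'"
    using lift_reverse[OF x'(1), of "rev m" a] m x'(2) by simp
  moreover have "lift x ((m @ [y]) @ q @ [a]) = x"
    using closed(2) x unfolding lifts_closed_def by simp
  ultimately have "lift x' (q @ [a]) = x"
    by simp
  then show "lift x (tl (a # p @ y # q @ [a])) = x"
    unfolding x'_def by simp
qed

lemma lifts_closed_null_cycle: "null_cycle cs \<Longrightarrow> lifts_closed (cs @ [hd cs])"
proof (induction rule: null_cycle.induct)
  case (triangle a b c)
  then show ?case
    using lifts_closed_triangle by simp
next
  case (rotate a xs)
  then obtain y ys where "xs = y # ys"
    by (auto elim!: graph_cycleE)
  then show ?case
    using rotate lifts_closed_rotate[of y ys a] by (simp add: graph_cycle_def)
next
  case (split a p y q m)
  then show ?case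
    using lifts_closed_split[of a p y m q] graph_cycle_split(1)[of adjacent a p y q]
      graph_cycle_split(2)[of adjacent a p y "rev m"] by simp
qed

lemma lifts_closed_splice:
  assumes walk: "successively adjacent (xs @ y # ys @ y # zs)"
    and closed: "lifts_closed (y # ys @ [y])" "lifts_closed (xs @ y # zs)"
  shows "lifts_closed (xs @ y # ys @ y # zs)"
  unfolding lifts_closed_def
proof (intro ballI impI)
  fix x assume x: "x \<in> cover" "proj x = hd (xs @ y # ys @ y # zs)"
  have tails: "proj x # tl (xs @ [y]) = xs @ [y]" "tl (xs @ y # us) = tl (xs @ [y]) @ us" for us
    using x(2) by (cases xs; simp)+
  define x' where "x' = lift x (tl (xs @ [y]))"
  have x': "x' \<in> cover" "proj x' = y"
    unfolding x'_def using lift_walk[OF x(1), of "tl (xs @ [y])"] walk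
      successively_append_Cons_iff[of adjacent xs y "ys @ y # zs"] by (simp_all add: tails(1))
  have "lift x' (ys @ [y]) = x'"
    using closed(1) x' unfolding lifts_closed_def by simp
  moreover have "lift x' zs = x"
    using closed(2) x unfolding lifts_closed_def x'_def by (cases xs) auto
  ultimately show "lift x (tl (xs @ y # ys @ y # zs)) = x"
    using tails(2)[of "ys @ y # zs"] unfolding x'_def by simp
qed

lemma lifts_closed_walk:
  assumes "successively adjacent ws" "ws \<noteq> []" "last ws = hd ws"
  shows "lifts_closed ws"
  using assms adjacent_irrefl
proof (induction rule: closed_walk_induct)
  case (trivial a)
  then show ?case
    by (simp add: lifts_closed_def)
next
  case (backtrack a b)
  then show ?case
    using lift_step_back by (auto simp: lifts_closed_def)
next
  case (cycle cs)
  then show ?case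
    using lifts_closed_null_cycle cycles_null by blast
next
  case (splice xs y ys zs)
  then show ?case
    by (rule lifts_closed_splice)
qed

lemma ex_lift:
  assumes x: "x \<in> cover" "y \<in> cover"
  obtains us where "successively adjacent (proj x # us)" "lift x us = y"
proof -
  have "(\<lambda>x y. y \<in> nbrs x)\<^sup>*\<^sup>* x y"
    using cover_connected x by blast
  then have "\<exists>us. successively adjacent (proj x # us) \<and> lift x us = y"
  proof induction
    case base
    show ?case
      by (rule exI[of _ "[]"]) simp
  next
    case (step y z)
    then obtain us where us: "successively adjacent (proj x # us)" "lift x us = y"
      by blast
    have y: "y \<in> cover" "proj y = last (proj x # us)"
      using lift_walk[OF x(1) us(1)] us(2) by auto
    have "successively adjacent ((proj x # us) @ [proj z])"
      unfolding successively_append_iff using us(1) adjacent_proj[OF y(1) step(2)] y(2) by simp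
    moreover have "lift x (us @ [proj z]) = z"
      using us(2) lift_step_proj[OF y(1) step(2)] by simp
    ultimately show ?case
      by (intro exI[of _ "us @ [proj z]"]) simp
  qed
  then show ?thesis
    using that by blast
qed

theorem covering_inj: "inj_on proj cover"
proof
  fix x y assume xy: "x \<in> cover" "y \<in> cover" "proj x = proj y"
  obtain us where us: "successively adjacent (proj x # us)" "lift x us = y"
    using xy(1,2) by (rule ex_lift)
  have "last (proj x # us) = proj x"
    using lift_walk(2)[OF xy(1) us(1)] us(2) xy(3) by simp
  then show "x = y"
    using lifts_closed_walk[OF us(1)] xy(1) us(2) unfolding lifts_closed_def by simp
qed

end

section \<open>Layers around a boundary walk\<close>

text \<open>If the \<open>i\<close>-th vertex of a boundary walk has \<open>u i\<close> outer neighbours, of which consecutive vertices share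
  one, then \<open>first_child u i\<close> is the index in the next layer of the vertex shared by \<open>i - 1\<close> and \<open>i\<close>.\<close>
definition first_child :: "(int \<Rightarrow> int) \<Rightarrow> int \<Rightarrow> int" where
  "first_child u i = (if i \<ge> 0 then (\<Sum>j\<in>{0..<i}. u j - 1) else - (\<Sum>j\<in>{i..<0}. u j - 1))"

lemma first_child_0 [simp]: "first_child u 0 = 0"
  by (simp add: first_child_def)

lemma first_child_succ: "first_child u (i + 1) = first_child u i + u i - 1"
proof -
  consider (nonneg) "i \<ge> 0" | (minus_one) "i = -1" | (below) "i < -1"
    by linarith
  then show ?thesis
  proof cases
    case nonneg
    then have "{0..<i + 1} = insert i {0..<i}"
      by auto
    then show ?thesis
      using nonneg by (simp add: first_child_def)
  next
    case minus_one
    have "{-1..<0} = {-1::int}"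
      by auto
    then show ?thesis
      using minus_one by (simp add: first_child_def)
  next
    case below
    then have "{i..<0} = insert i {i + 1..<0}"
      by auto
    then show ?thesis
      using below by (simp add: first_child_def)
  qed
qed

lemma first_child_nonneg: "b \<ge> 0 \<Longrightarrow> first_child u b = (\<Sum>i\<in>{0..<b}. u i) - b"
  by (simp add: first_child_def sum_subtractf)

lemma first_child_shift:
  assumes "\<And>i. u (i + b) = u i"
  shows "first_child u (i + b * m) = first_child u i + first_child u b * m"
proof -
  have period: "first_child u (i + b) = first_child u i + first_child u b" for i
  proof (rule int_step_induct[where P = "\<lambda>i. first_child u (i + b) = first_child u i + first_child u b"])
    fix i
    have "first_child u (i + 1 + b) = first_child u (i + b) + u i - 1"
      using first_child_succ[of u "i + b"] assms[of i] by (simp add: algebra_simps)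
    then show "first_child u (i + b) = first_child u i + first_child u b \<longleftrightarrow>
        first_child u (i + 1 + b) = first_child u (i + 1) + first_child u b"
      using first_child_succ[of u i] by linarith
  qed simp
  show ?thesis
  proof (rule int_step_induct[where P = "\<lambda>m. first_child u (i + b * m) = first_child u i + first_child u b * m"])
    fix m
    show "first_child u (i + b * m) = first_child u i + first_child u b * m \<longleftrightarrow>
        first_child u (i + b * (m + 1)) = first_child u i + first_child u b * (m + 1)"
      using period[of "i + b * m"] by (simp add: algebra_simps)
  qed simp
qed

definition parent :: "(int \<Rightarrow> int) \<Rightarrow> int \<Rightarrow> int" where
  "parent u k = (THE j. first_child u j \<le> k \<and> k < first_child u (j + 1))"

context
  fixes u :: "int \<Rightarrow> int"
  assumes u_ge_2: "\<And>i. u i \<ge> 2"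
begin

lemma first_child_less_succ: "first_child u i < first_child u (i + 1)"
  using first_child_succ[of u i] u_ge_2[of i] by simp

lemma first_child_ge: "i \<le> j \<Longrightarrow> first_child u i + (j - i) \<le> first_child u j"
proof (induction j rule: int_ge_induct)
  case (step j)
  then show ?case
    using first_child_less_succ[of j] by simp
qed simp

lemma first_child_less_iff: "first_child u i < first_child u j \<longleftrightarrow> i < j"
  using first_child_ge[of i j] first_child_ge[of j i] by linarith

lemma first_child_le_iff: "first_child u i \<le> first_child u j \<longleftrightarrow> i \<le> j"
  using first_child_less_iff[of j i] by linarith

lemma parent_eq:
  assumes "first_child u j \<le> k" "k < first_child u (j + 1)"
  shows "parent u k = j"
  unfolding parent_def
proof (rule the_equality)
  fix i assume "first_child u i \<le> k \<and> k < first_child u (i + 1)"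
  then have "first_child u i < first_child u (j + 1)" "first_child u j < first_child u (i + 1)"
    using assms by auto
  then show "i = j"
    unfolding first_child_less_iff by simp
qed (use assms in simp)

lemma ex_parent: "\<exists>j. first_child u j \<le> k \<and> k < first_child u (j + 1)"
proof (induction k rule: int_induct[of _ 0])
  case base
  then show ?case
    using first_child_less_succ[of 0] by (intro exI[of _ 0]) simp
next
  case (step1 k)
  then obtain j where "first_child u j \<le> k" "k < first_child u (j + 1)"
    by blast
  then show ?case
    using first_child_less_succ[of "j + 1"]
    by (cases "k + 1 < first_child u (j + 1)") (auto intro: exI[of _ j] exI[of _ "j + 1"])
next
  case (step2 k)
  then obtain j where "first_child u j \<le> k" "k < first_child u (j + 1)"
    by blast
  then show ?case
    using first_child_less_succ[of "j - 1"]
    by (cases "first_child u j \<le> k - 1") (auto intro: exI[of _ j] exI[of _ "j - 1"])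
qed

lemma first_child_parent: "first_child u (parent u k) \<le> k" "k < first_child u (parent u k + 1)"
  using ex_parent[of k] parent_eq by blast+

lemma parent_first_child: "parent u (first_child u j) = j"
  using parent_eq first_child_less_succ by blast

lemma parent_pred:
  "parent u (k - 1) = (if k = first_child u (parent u k) then parent u k - 1 else parent u k)"
proof (cases "k = first_child u (parent u k)")
  case True
  then have "parent u (k - 1) = parent u k - 1"
    using first_child_less_succ[of "parent u k - 1"] by (intro parent_eq) auto
  then show ?thesis
    using True by simp
next
  case False
  then have "parent u (k - 1) = parent u k"
    using first_child_parent[of k] by (intro parent_eq) auto
  then show ?thesis
    using False by simp
qed

lemma parent_shift:
  assumes "\<And>i. u (i + b) = u i"
  shows "parent u (k + first_child u b * m) = parent u k + b * m"
proof (rule parent_eq)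
  have "parent u k + b * m + 1 = (parent u k + 1) + b * m"
    by simp
  then have "first_child u (parent u k + b * m + 1) = first_child u (parent u k + 1) + first_child u b * m"
    using first_child_shift[of u b, OF assms] by metis
  then show "k + first_child u b * m < first_child u (parent u k + b * m + 1)"
    using first_child_parent(2)[of k] by simp
qed (use first_child_shift[of u b, OF assms] first_child_parent(1)[of k] in simp)

end

definition (in triangulated_surface) spoke :: "(int \<Rightarrow> 'v) \<Rightarrow> (int \<Rightarrow> 'v) \<Rightarrow> int \<Rightarrow> int \<Rightarrow> 'v" where
  "spoke c apex i = link_from (c i) (apex (i - 1)) (c (i - 1))"

locale walk_with_apexes = triangulated_surface r adjacent triangle
  for r :: nat and adjacent :: "'v \<Rightarrow> 'v \<Rightarrow> bool" and triangle :: "'v \<Rightarrow> 'v \<Rightarrow> 'v \<Rightarrow> bool" +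
  fixes c apex :: "int \<Rightarrow> 'v"
  assumes inner_triangle: "triangle (c i) (c (i + 1)) (apex i)"
begin

lemma previous_inner_triangle: "triangle (c i) (apex (i - 1)) (c (i - 1))"
  using inner_triangle[of "i - 1"] triangle_swap by (metis diff_add_cancel)

lemma link_walk_spoke: "link_walk (c i) (spoke c apex i)"
  and spoke_0: "spoke c apex i 0 = apex (i - 1)" and spoke_pred: "spoke c apex i 1 = c (i - 1)"
  unfolding spoke_def using previous_inner_triangle link_walk_link_from link_from_0 link_from_1 by blast+

lemma spoke_period: "spoke c apex i (t + int r) = spoke c apex i t"
  by (rule link_walk_periodic[OF link_walk_spoke])

lemma spoke_r: "spoke c apex i (int r) = apex (i - 1)"
  and spoke_r_succ: "spoke c apex i (int r + 1) = c (i - 1)"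
  using spoke_period[of i 0] spoke_period[of i 1] spoke_0[of i] spoke_pred[of i] by (simp_all add: add.commute)

end

text \<open>A closed boundary walk \<^term>\<open>c\<close> of length \<^term>\<open>b\<close>, indexed periodically by the integers. The third vertex
  of the triangle on the inner side of the edge from \<^term>\<open>c i\<close> to \<^term>\<open>c (i + 1)\<close> is \<^term>\<open>apex i\<close>, and
  \<^term>\<open>u i\<close> is the number of neighbours of \<^term>\<open>c i\<close> strictly outside: around \<^term>\<open>c i\<close> they have the
  positions from \<^term>\<open>2\<close> to \<^term>\<open>u i + 1\<close>, between \<^term>\<open>c (i - 1)\<close> and \<^term>\<open>c (i + 1)\<close>.\<close>
locale boundary_walk = walk_with_apexes r adjacent triangle c apex
  for r :: nat and adjacent :: "'v \<Rightarrow> 'v \<Rightarrow> bool" and triangle :: "'v \<Rightarrow> 'v \<Rightarrow> 'v \<Rightarrow> bool"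
    and b :: int and c apex :: "int \<Rightarrow> 'v" +
  fixes u :: "int \<Rightarrow> int"
  assumes length_ge_3: "b \<ge> 3"
    and c_periodic: "c (i + b) = c i" and apex_periodic: "apex (i + b) = apex i"
    and u_periodic: "u (i + b) = u i" and u_le: "u i \<le> int r - 2"
    and spoke_succ: "spoke c apex i (u i + 2) = c (i + 1)"
    and spoke_apex: "spoke c apex i (u i + 3) = apex i"
begin

lemma spoke_index_periodic: "spoke c apex (i + b) = spoke c apex i"
  unfolding spoke_def using c_periodic[of "i - 1"] apex_periodic[of "i - 1"] c_periodic[of i]
  by (simp add: algebra_simps)

text \<open>Both sides are the third vertex of the outer triangle at the edge from \<^term>\<open>c i\<close> to \<^term>\<open>c (i + 1)\<close>.\<close>
lemma last_spoke_eq_first_spoke: "spoke c apex i (u i + 1) = spoke c apex (i + 1) 2"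
proof -
  have "triangle (c i) (c (i + 1)) (spoke c apex i (u i + 1))"
    "spoke c apex i (u i + 1) \<noteq> apex i"
    using link_walk_pred[OF link_walk_spoke, of i "u i + 2"] link_walk_neq[OF link_walk_spoke, of i "u i + 2"]
      spoke_succ[of i] spoke_apex[of i] by (simp_all add: algebra_simps)
  then have "opposite (c i) (c (i + 1)) (apex i) = spoke c apex i (u i + 1)"
    by (rule opposite_eq[OF inner_triangle])
  moreover have "triangle (c (i + 1)) (c i) (spoke c apex (i + 1) 2)" "spoke c apex (i + 1) 2 \<noteq> apex i"
    using link_walk_succ[OF link_walk_spoke, of "i + 1" 1] link_walk_neq[OF link_walk_spoke, of "i + 1" 1]
      spoke_pred[of "i + 1"] spoke_0[of "i + 1"] by simp_all
  then have "opposite (c i) (c (i + 1)) (apex i) = spoke c apex (i + 1) 2"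
    using triangle_swap(1) by (intro opposite_eq[OF inner_triangle])
  ultimately show ?thesis
    by simp
qed

end

context triangulated_surface
begin

definition next_vertex :: "(int \<Rightarrow> 'v) \<Rightarrow> (int \<Rightarrow> 'v) \<Rightarrow> (int \<Rightarrow> int) \<Rightarrow> int \<Rightarrow> 'v" where
  "next_vertex c apex u k = spoke c apex (parent u k) (2 + k - first_child u (parent u k))"

definition next_out_degree :: "(int \<Rightarrow> int) \<Rightarrow> int \<Rightarrow> int" where
  "next_out_degree u k = (if k = first_child u (parent u k) then int r - 4 else int r - 3)"

end

locale convex_boundary_walk = boundary_walk +
  assumes degree_ge_6: "r \<ge> 6" and u_ge_2: "2 \<le> u i"
begin

lemmas child_less_succ = first_child_less_succ[of u, OF u_ge_2]
  and child_less_iff = first_child_less_iff[of u, OF u_ge_2]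
  and child_le_iff = first_child_le_iff[of u, OF u_ge_2]
  and parent_eqI = parent_eq[of u, OF u_ge_2]
  and child_parent = first_child_parent[of u, OF u_ge_2]
  and parent_child = parent_first_child[of u, OF u_ge_2]
  and parent_pred_eq = parent_pred[of u, OF u_ge_2]

abbreviation next_c :: "int \<Rightarrow> 'a" where
  "next_c \<equiv> next_vertex c apex u"

abbreviation next_apex :: "int \<Rightarrow> 'a" where
  "next_apex k \<equiv> c (parent u k)"

lemma next_c_eq:
  assumes "first_child u j \<le> k" "k \<le> first_child u (j + 1)"
  shows "next_c k = spoke c apex j (2 + k - first_child u j)"
proof (cases "k = first_child u (j + 1)")
  case True
  then have "next_c k = spoke c apex (j + 1) 2"
    unfolding next_vertex_def by (simp add: parent_child)
  also have "\<dots> = spoke c apex j (u j + 1)"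
    by (rule last_spoke_eq_first_spoke[symmetric])
  also have "u j + 1 = 2 + k - first_child u j"
    using True first_child_succ[of u j] by simp
  finally show ?thesis .
next
  case False
  then have "parent u k = j"
    using assms parent_eqI[of j k] by simp
  then show ?thesis
    unfolding next_vertex_def by simp
qed

lemma next_c_first_child: "next_c (first_child u j) = spoke c apex j 2"
  using next_c_eq[of j "first_child u j"] child_less_succ[of j] by simp

lemma next_inner_triangle: "triangle (next_c k) (next_c (k + 1)) (next_apex k)"
proof -
  have "next_c k = spoke c apex (parent u k) (2 + k - first_child u (parent u k))"
    "next_c (k + 1) = spoke c apex (parent u k) (2 + k - first_child u (parent u k) + 1)"
    using child_parent[of k] next_c_eq[of "parent u k" k] next_c_eq[of "parent u k" "k + 1"]
    by (simp_all add: algebra_simps)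
  then show ?thesis
    using link_walk_succ[OF link_walk_spoke] triangle_swap by metis
qed

lemma peak_triangle: "triangle (next_c (first_child u j)) (c (j - 1)) (c j)"
  using link_walk_succ[OF link_walk_spoke, of j 1] spoke_pred[of j] triangle_swap
  unfolding next_c_first_child by (metis one_add_one)

interpretation next_layer: walk_with_apexes r adjacent triangle next_c next_apex
  by unfold_locales (rule next_inner_triangle)

lemma next_spoke_backwards:
  assumes "triangle (next_c k) (spoke next_c next_apex k t) x" "x \<noteq> spoke next_c next_apex k (t + 1)"
  shows "spoke next_c next_apex k (t - 1) = x"
  using link_walk_neighbour[OF next_layer.link_walk_spoke assms(1)] assms(2) by simp

lemma next_spokes_single_parent:
  assumes "k \<noteq> first_child u (parent u k)"
  shows "spoke next_c next_apex k (- 1) = next_c (k + 1)"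
    and "spoke next_c next_apex k 0 = next_apex k"
proof -
  define j where "j = parent u k"
  have j: "first_child u j \<le> k - 1" "k + 1 \<le> first_child u (j + 1)"
    using child_parent[of k] assms unfolding j_def by auto
  show next_apex: "spoke next_c next_apex k 0 = next_apex k"
    using next_layer.spoke_0[of k] parent_pred_eq[of k] assms by simp
  have "next_c (k + 1) \<noteq> next_c (k - 1)"
    using next_c_eq[of j "k + 1"] next_c_eq[of j "k - 1"] j
      link_walk_neq[OF link_walk_spoke, of j "2 + k - first_child u j"] by (simp add: algebra_simps)
  moreover have "triangle (next_c k) (next_apex k) (next_c (k + 1))"
    using next_inner_triangle[of k] triangle_swap by blast
  ultimately show "spoke next_c next_apex k (- 1) = next_c (k + 1)"
    using next_spoke_backwards[of k 0 "next_c (k + 1)"] next_apex next_layer.spoke_pred[of k] by simp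
qed

lemma next_spokes_two_parents:
  assumes k: "k = first_child u (parent u k)"
  shows "spoke next_c next_apex k (- 2) = next_c (k + 1)"
    and "spoke next_c next_apex k (- 1) = next_apex k"
proof -
  define j where "j = parent u k"
  have k_eq: "k = first_child u j"
    using k unfolding j_def .
  have next_spoke_0: "spoke next_c next_apex k 0 = c (j - 1)"
    using next_layer.spoke_0[of k] parent_pred_eq[of k] k unfolding j_def by simp
  have "k - 1 = first_child u (j - 1) + u (j - 1) - 2"
    using first_child_succ[of u "j - 1"] k_eq by simp
  then have "next_c (k - 1) = spoke c apex (j - 1) (u (j - 1))"
    using next_c_eq[of "j - 1" "k - 1"] child_less_succ[of "j - 1"] k_eq by simp
  then have "c j \<noteq> next_c (k - 1)"
    using link_walk_neq[OF link_walk_spoke, of "j - 1" "u (j - 1) + 1"] spoke_succ[of "j - 1"]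
    by (simp add: add.assoc)
  moreover have "triangle (next_c k) (c (j - 1)) (c j)"
    unfolding k_eq by (rule peak_triangle)
  ultimately have next_spoke_minus_1: "spoke next_c next_apex k (- 1) = c j"
    using next_spoke_backwards[of k 0 "c j"] next_spoke_0 next_layer.spoke_pred[of k] by simp
  then show "spoke next_c next_apex k (- 1) = next_apex k"
    unfolding j_def .
  have "next_c (k + 1) = spoke c apex j 3"
    using next_c_eq[of j "k + 1"] k_eq child_less_succ[of j] by simp
  then have "next_c (k + 1) \<noteq> c (j - 1)"
    using link_walk_neq[OF link_walk_spoke, of j 2] spoke_pred[of j] by simp
  moreover have "triangle (next_c k) (c j) (next_c (k + 1))"
    using next_inner_triangle[of k] triangle_swap unfolding j_def by blast
  ultimately show "spoke next_c next_apex k (- 2) = next_c (k + 1)"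
    using next_spoke_backwards[of k "- 1" "next_c (k + 1)"] next_spoke_0 next_spoke_minus_1 by simp
qed

lemma next_boundary_walk:
  "convex_boundary_walk r adjacent triangle (first_child u b) next_c next_apex (next_out_degree u)"
proof unfold_locales
  show "3 \<le> first_child u b"
    using first_child_ge[of u 0 b, OF u_ge_2] length_ge_3 by simp
next
  fix k
  have shift: "parent u (k + first_child u b) = parent u k + b"
    "first_child u (parent u k + b) = first_child u (parent u k) + first_child u b"
    using parent_shift[of u b k 1, OF u_ge_2] first_child_shift[of u b "parent u k" 1] u_periodic by simp_all
  show "next_c (k + first_child u b) = next_c k"
    unfolding next_vertex_def shift spoke_index_periodic by (simp add: algebra_simps)
  show "next_apex (k + first_child u b) = next_apex k"
    unfolding shift by (rule c_periodic)
  show "next_out_degree u (k + first_child u b) = next_out_degree u k"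
    unfolding next_out_degree_def shift by simp
next
  fix k
  show "next_out_degree u k \<le> int r - 2" "2 \<le> next_out_degree u k"
    unfolding next_out_degree_def using degree_ge_6 by auto
  show "spoke next_c next_apex k (next_out_degree u k + 2) = next_c (k + 1)"
    "spoke next_c next_apex k (next_out_degree u k + 3) = next_apex k"
    using next_spokes_single_parent[of k] next_spokes_two_parents[of k]
      next_layer.spoke_period[of k "- 2"] next_layer.spoke_period[of k "- 1"]
      next_layer.spoke_period[of k 0] unfolding next_out_degree_def by auto
qed (rule degree_ge_6)

end

section \<open>The covering by layers around a convex patch\<close>

locale convex_patch = simply_connected_surface r adjacent triangle +
  convex_boundary_walk r adjacent triangle b\<^sub>0 c\<^sub>0 apex\<^sub>0 u\<^sub>0
  for r :: nat and adjacent :: "'v \<Rightarrow> 'v \<Rightarrow> bool" and triangle :: "'v \<Rightarrow> 'v \<Rightarrow> 'v \<Rightarrow> bool"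
    and b\<^sub>0 :: int and c\<^sub>0 apex\<^sub>0 :: "int \<Rightarrow> 'v" and u\<^sub>0 :: "int \<Rightarrow> int" +
  fixes D :: "'v set" and adjacent_D :: "'v \<Rightarrow> 'v \<Rightarrow> bool"
  assumes finite_D: "finite D"
    and adjacent_D_imp_adjacent: "adjacent_D v w \<Longrightarrow> adjacent v w"
    and adjacent_D_in_D: "adjacent_D v w \<Longrightarrow> v \<in> D"
    and adjacent_D_sym: "adjacent_D v w \<Longrightarrow> adjacent_D w v"
    and D_connected: "v \<in> D \<Longrightarrow> w \<in> D \<Longrightarrow> adjacent_D\<^sup>*\<^sup>* v w"
    and boundary_in_D: "c\<^sub>0 i \<in> D"
    and boundary_eq_iff: "c\<^sub>0 i = c\<^sub>0 j \<longleftrightarrow> b\<^sub>0 dvd i - j"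
    and interior_adjacent: "v \<in> D \<Longrightarrow> v \<notin> range c\<^sub>0 \<Longrightarrow> adjacent v w \<Longrightarrow> adjacent_D v w"
    and interior_triangle: "v \<in> D \<Longrightarrow> v \<notin> range c\<^sub>0 \<Longrightarrow> triangle v x y \<Longrightarrow> adjacent_D x y"
    and boundary_adjacent_iff: "adjacent_D (c\<^sub>0 i) w \<longleftrightarrow> w \<in> spoke c\<^sub>0 apex\<^sub>0 i ` {u\<^sub>0 i + 2..int r + 1}"
    and boundary_triangle: "u\<^sub>0 i + 2 \<le> t \<Longrightarrow> t \<le> int r \<Longrightarrow>
      adjacent_D (spoke c\<^sub>0 apex\<^sub>0 i t) (spoke c\<^sub>0 apex\<^sub>0 i (t + 1))"
begin

primrec out_degree :: "nat \<Rightarrow> int \<Rightarrow> int" where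
  "out_degree 0 = u\<^sub>0"
| "out_degree (Suc n) = next_out_degree (out_degree n)"

primrec len :: "nat \<Rightarrow> int" where
  "len 0 = b\<^sub>0"
| "len (Suc n) = first_child (out_degree n) (len n)"

primrec vertex_apex :: "nat \<Rightarrow> (int \<Rightarrow> 'v) \<times> (int \<Rightarrow> 'v)" where
  "vertex_apex 0 = (c\<^sub>0, apex\<^sub>0)"
| "vertex_apex (Suc n) = (case vertex_apex n of (c, apex) \<Rightarrow>
     (next_vertex c apex (out_degree n), \<lambda>k. c (parent (out_degree n) k)))"

definition vertex :: "nat \<Rightarrow> int \<Rightarrow> 'v" where
  "vertex n = fst (vertex_apex n)"

definition apex :: "nat \<Rightarrow> int \<Rightarrow> 'v" where
  "apex n = snd (vertex_apex n)"

abbreviation child :: "nat \<Rightarrow> int \<Rightarrow> int" where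
  "child n \<equiv> first_child (out_degree n)"

abbreviation par :: "nat \<Rightarrow> int \<Rightarrow> int" where
  "par n \<equiv> parent (out_degree n)"

abbreviation nbr :: "nat \<Rightarrow> int \<Rightarrow> int \<Rightarrow> 'v" where
  "nbr n \<equiv> spoke (vertex n) (apex n)"

lemma vertex_0: "vertex 0 = c\<^sub>0" and apex_0: "apex 0 = apex\<^sub>0"
  by (simp_all add: vertex_def apex_def)

lemma vertex_Suc: "vertex (Suc n) = next_vertex (vertex n) (apex n) (out_degree n)"
  and apex_Suc: "apex (Suc n) = (\<lambda>k. vertex n (par n k))"
  by (simp_all add: vertex_def apex_def split: prod.splits)

lemma layer_boundary_walk: "convex_boundary_walk r adjacent triangle (len n) (vertex n) (apex n) (out_degree n)"
proof (induction n)
  case 0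
  show ?case
    using convex_boundary_walk_axioms by (simp add: vertex_0 apex_0)
next
  case (Suc n)
  then show ?case
    unfolding vertex_Suc apex_Suc len.simps out_degree.simps
    by (rule convex_boundary_walk.next_boundary_walk)
qed

sublocale layer: convex_boundary_walk r adjacent triangle "len n" "vertex n" "apex n" "out_degree n" for n
  by (rule layer_boundary_walk)

lemma out_degree_Suc: "out_degree (Suc n) k = (if k = child n (par n k) then int r - 4 else int r - 3)"
  by (simp add: next_out_degree_def)

lemma len_Suc: "len (Suc n) = child n (len n)"
  by simp

declare out_degree.simps(2) [simp del] len.simps(2) [simp del]

lemma len_pos: "len n > 0"
  using layer.length_ge_3[of n] by simp

lemma vertex_Suc_eq_nbr:
  "child n j \<le> k \<Longrightarrow> k \<le> child n (j + 1) \<Longrightarrow> vertex (Suc n) k = nbr n j (2 + k - child n j)"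
  unfolding vertex_Suc by (rule layer.next_c_eq)

lemma child_shift: "child n (i + len n * m) = child n i + len (Suc n) * m"
  using first_child_shift[of "out_degree n" "len n", OF layer.u_periodic] by (simp add: len_Suc)

lemma child_succ_shift: "child n (i + len n * m + 1) = child n (i + 1) + len (Suc n) * m"
  using child_shift[of n "i + 1" m] by (simp add: algebra_simps)

lemma vertex_shift: "vertex n (i + len n * m) = vertex n i"
proof (rule int_step_induct[where P = "\<lambda>m. vertex n (i + len n * m) = vertex n i"])
  fix m
  show "vertex n (i + len n * m) = vertex n i \<longleftrightarrow> vertex n (i + len n * (m + 1)) = vertex n i"
    using layer.c_periodic[of n "i + len n * m"] by (simp add: algebra_simps)
qed simp

lemma vertex_mod: "vertex n (k mod len n) = vertex n k"
  using vertex_shift[of n "k mod len n" "k div len n"] by (simp add: mult.commute)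

text \<open>In the abstract complex, \<open>Inl v\<close> is a vertex of the patch and \<open>Inr (n, k)\<close> with \<open>n > 0\<close> the \<open>k\<close>-th vertex
  of the \<open>n\<close>-th layer, while layer \<open>0\<close> is identified with the boundary of the patch.\<close>
definition point :: "nat \<Rightarrow> int \<Rightarrow> 'v + nat \<times> int" where
  "point n k = (if n = 0 then Inl (c\<^sub>0 k) else Inr (n, k mod len n))"

fun proj :: "'v + nat \<times> int \<Rightarrow> 'v" where
  "proj (Inl v) = v"
| "proj (Inr (n, k)) = vertex n k"

definition points :: "('v + nat \<times> int) set" where
  "points = Inl ` D \<union> {point n k |n k. True}"

inductive joined :: "'v + nat \<times> int \<Rightarrow> 'v + nat \<times> int \<Rightarrow> bool" where
  disk: "adjacent_D v w \<Longrightarrow> joined (Inl v) (Inl w)"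
| forward: "n \<ge> 1 \<Longrightarrow> joined (point n k) (point n (k + 1))"
| backward: "n \<ge> 1 \<Longrightarrow> joined (point n (k + 1)) (point n k)"
| up: "child n j \<le> k \<Longrightarrow> k \<le> child n (j + 1) \<Longrightarrow> joined (point n j) (point (Suc n) k)"
| down: "child n j \<le> k \<Longrightarrow> k \<le> child n (j + 1) \<Longrightarrow> joined (point (Suc n) k) (point n j)"

lemma joined_sym: "joined x y \<Longrightarrow> joined y x"
  by (induction rule: joined.induct) (auto intro: joined.intros adjacent_D_sym)

lemma proj_point [simp]: "proj (point n k) = vertex n k"
  by (simp add: point_def vertex_0 vertex_mod)

lemma point_eq_iff: "point n i = point m j \<longleftrightarrow> n = m \<and> len n dvd i - j"
  by (auto simp: point_def boundary_eq_iff mod_eq_dvd_iff)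

lemma point_eqE:
  assumes "point n i = point m j"
  obtains s where "m = n" "i = j + len n * s"
proof -
  have "m = n" "len n dvd i - j"
    using assms unfolding point_eq_iff by auto
  then show ?thesis
    using that by (metis dvd_diffE)
qed

lemma point_shift: "point n (i + len n * s) = point n i"
  unfolding point_eq_iff by simp

lemma point_eq_Inl_iff: "point n i = Inl v \<longleftrightarrow> n = 0 \<and> v = c\<^sub>0 i"
  by (auto simp: point_def)

lemma point_in_points: "point n i \<in> points"
  unfolding points_def by blast

lemma points_cases:
  assumes "x \<in> points"
  obtains (inner) v where "x = Inl v" "v \<in> D" "v \<notin> range c\<^sub>0" | (layer) n i where "x = point n i"
proof -
  consider (off) v where "x = Inl v" "v \<in> D" "v \<notin> range c\<^sub>0" | (boundary) i where "x = Inl (c\<^sub>0 i)"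
    | (on_layer) n i where "x = point n i"
    using assms unfolding points_def by blast
  then show ?thesis
  proof cases
    case (boundary i)
    then have "x = point 0 i"
      by (simp add: point_def)
    then show ?thesis
      by (rule layer)
  qed (use inner layer in blast)+
qed

lemma joined_in_points: "joined x y \<Longrightarrow> y \<in> points"
  by (induction rule: joined.induct)
    (auto simp: point_in_points points_def dest: adjacent_D_in_D[OF adjacent_D_sym])

lemma joined_succ: "joined (point n k) (point n (k + 1))"
proof (cases "n = 0")
  case True
  have "adjacent_D (c\<^sub>0 k) (c\<^sub>0 (k + 1))"
    using spoke_succ[of k] u_le[of k] unfolding boundary_adjacent_iff by force
  then show ?thesis
    using True joined.disk by (simp add: point_def)
qed (use joined.forward in simp)

lemma joined_pred: "joined (point n k) (point n (k - 1))"
  using joined_sym[OF joined_succ[of n "k - 1"]] by simp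

lemma joined_parent: "joined (point (Suc n) k) (point n (par n k))"
  using layer.child_parent(1)[of n k] layer.child_parent(2)[of k n] by (intro joined.down) auto

lemma joined_pointE:
  assumes "joined (point n i) y"
  obtains (disk) w where "n = 0" "y = Inl w" "adjacent_D (c\<^sub>0 i) w"
    | (right) "y = point n (i + 1)" | (left) "y = point n (i - 1)"
    | (up) k where "child n i \<le> k" "k \<le> child n (i + 1)" "y = point (Suc n) k"
    | (down) m j where "n = Suc m" "child m j \<le> i" "i \<le> child m (j + 1)" "y = point m j"
  using assms
proof cases
  case (disk v w)
  then have "n = 0" "v = c\<^sub>0 i"
    unfolding point_eq_Inl_iff by auto
  then show ?thesis
    using that(1) disk by simp
next
  case (forward m k)
  from forward(1) obtain s where "m = n" "i = k + len n * s"
    by (rule point_eqE)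
  then show ?thesis
    using that(2) forward(2) point_shift[of n "k + 1" s] by (simp add: algebra_simps)
next
  case (backward m k)
  from backward(1) obtain s where "m = n" "i = k + 1 + len n * s"
    by (rule point_eqE)
  then show ?thesis
    using that(3) backward(2) point_shift[of n k s] by (simp add: algebra_simps)
next
  case (up m j k)
  from up(1) obtain s where s: "m = n" "i = j + len n * s"
    by (rule point_eqE)
  then show ?thesis
    using that(4)[of "k + len (Suc n) * s"] up(2-4) child_shift[of n _ s] child_succ_shift[of n _ s]
      point_shift[of "Suc n" k s] by simp
next
  case (down m j k)
  from down(1) obtain s where s: "Suc m = n" "i = k + len n * s"
    by (rule point_eqE)
  then show ?thesis
    using that(5)[of m "j + len m * s"] down(2-4) child_shift[of m _ s] child_succ_shift[of m _ s]
      point_shift[of m j s] by simp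
qed

text \<open>Positions \<open>1\<close> and \<open>r + 1\<close> coincide, so that \<open>r\<close> steps lead from position \<open>1\<close> once around the vertex.\<close>
definition around :: "nat \<Rightarrow> int \<Rightarrow> int \<Rightarrow> 'v + nat \<times> int" where
  "around n i t =
    (if 2 \<le> t \<and> t \<le> out_degree n i + 1 then point (Suc n) (child n i + t - 2)
     else if n = 0 then Inl (nbr 0 i t)
     else if t = 1 \<or> t = int r + 1 then point n (i - 1)
     else if t = out_degree n i + 2 then point n (i + 1)
     else if t = out_degree n i + 3 then point (n - 1) (par (n - 1) i)
     else point (n - 1) (par (n - 1) i - 1))"

lemma around_pred: "around n i 1 = point n (i - 1)" "around n i (int r + 1) = point n (i - 1)"
proof -
  have "int r + 1 > out_degree n i + 1"
    using layer.u_le[of n i] by simp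
  then show "around n i 1 = point n (i - 1)" "around n i (int r + 1) = point n (i - 1)"
    using layer.spoke_pred[of 0 i] layer.spoke_r_succ[of 0 i] by (auto simp: around_def point_def vertex_0)
qed

lemma around_up: "2 \<le> t \<Longrightarrow> t \<le> out_degree n i + 1 \<Longrightarrow> around n i t = point (Suc n) (child n i + t - 2)"
  by (simp add: around_def)

lemma around_succ: "around n i (out_degree n i + 2) = point n (i + 1)"
  using layer.u_ge_2[of n i] layer.u_le[of n i] layer.spoke_succ[of 0 i]
  by (simp add: around_def point_def vertex_0)

lemma around_disk: "out_degree 0 i + 2 \<le> t \<Longrightarrow> around 0 i t = Inl (nbr 0 i t)"
  by (simp add: around_def)

lemma around_parent: "around (Suc n) i (out_degree (Suc n) i + 3) = point n (par n i)"
  using layer.u_ge_2[of "Suc n" i] by (simp add: around_def out_degree_Suc)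

lemma around_second_parent:
  assumes "i = child n (par n i)"
  shows "around (Suc n) i (int r) = point n (par n i - 1)"
  using layer.u_ge_2[of "Suc n" i] assms by (simp add: around_def out_degree_Suc)

lemma position_cases:
  assumes "1 \<le> t" "t \<le> int r"
  obtains (left) "t = 1" | (up) "2 \<le> t" "t \<le> out_degree n i + 1" | (right) "t = out_degree n i + 2"
    | (disk) "n = 0" "out_degree n i + 3 \<le> t"
    | (parent) m where "n = Suc m" "t = out_degree n i + 3"
    | (second_parent) m where "n = Suc m" "t = int r" "out_degree n i = int r - 4" "i = child m (par m i)"
proof (cases "t \<le> out_degree n i + 2 \<or> n = 0 \<or> t = out_degree n i + 3")
  case True
  then show ?thesis
    using that(1-4) that(5)[of "n - 1"] assms(1) by (cases "n = 0") force+
next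
  case False
  then obtain m where "n = Suc m"
    using not0_implies_Suc by blast
  then show ?thesis
    using that(6)[of m] out_degree_Suc[of m i] False assms by (auto split: if_splits)
qed

lemma nbr_parent: "nbr (Suc n) k (out_degree (Suc n) k + 3) = vertex n (par n k)"
  using layer.spoke_apex[of "Suc n" k] by (simp add: apex_Suc)

lemma nbr_second_parent:
  assumes "k = child n (par n k)"
  shows "nbr (Suc n) k (int r) = vertex n (par n k - 1)"
  using layer.spoke_r[of "Suc n" k] layer.parent_pred_eq[of n k] assms by (simp add: apex_Suc)

lemma nbr_up: "2 \<le> t \<Longrightarrow> t \<le> out_degree n i + 1 \<Longrightarrow> nbr n i t = vertex (Suc n) (child n i + t - 2)"
  using vertex_Suc_eq_nbr[of n i "child n i + t - 2"] first_child_succ[of "out_degree n" i] by simp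

lemma proj_around:
  assumes "1 \<le> t" "t \<le> int r"
  shows "proj (around n i t) = nbr n i t"
  using assms
proof (cases rule: position_cases[where t = t and n = n and i = i])
  case left
  then show ?thesis
    using around_pred(1) layer.spoke_pred by simp
next
  case up
  then show ?thesis
    using around_up nbr_up by simp
next
  case right
  then show ?thesis
    using around_succ layer.spoke_succ by simp
next
  case disk
  then show ?thesis
    using around_disk[of i t] by simp
next
  case (parent m)
  then show ?thesis
    using around_parent[of m i] nbr_parent[of m i] by simp
next
  case (second_parent m)
  then show ?thesis
    using around_second_parent[of i m] nbr_second_parent[of i m] by simp
qed

lemma joined_around:
  assumes "1 \<le> t" "t \<le> int r"
  shows "joined (point n i) (around n i t)"
  using assms
proof (cases rule: position_cases[where t = t and n = n and i = i])
  case left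
  then show ?thesis
    using around_pred(1) joined_pred by simp
next
  case up
  then show ?thesis
    using around_up[OF up] first_child_succ[of "out_degree n" i] by (auto intro: joined.up)
next
  case right
  then show ?thesis
    using around_succ joined_succ by simp
next
  case disk
  then have "adjacent_D (c\<^sub>0 i) (nbr 0 i t)"
    unfolding boundary_adjacent_iff using assms by (auto simp: vertex_0 apex_0)
  then show ?thesis
    using around_disk[of i t] disk joined.disk by (simp add: point_def)
next
  case (parent m)
  then show ?thesis
    using around_parent[of m i] joined_parent by simp
next
  case (second_parent m)
  then show ?thesis
    using around_second_parent[of i m] layer.child_less_succ[of m "par m i - 1"]
    by (auto intro!: joined.down)
qed

lemma around_disk_neighbourE:
  assumes "adjacent_D (c\<^sub>0 i) w"
  obtains t where "1 \<le> t" "t \<le> int r" "Inl w = around 0 i t"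
proof -
  obtain t where t: "out_degree 0 i + 2 \<le> t" "t \<le> int r + 1" "w = nbr 0 i t"
    using assms unfolding boundary_adjacent_iff by (auto simp: vertex_0 apex_0)
  then have "Inl w = around 0 i t"
    using around_disk by simp
  then show ?thesis
    using that[of 1] that[of t] t around_pred[of 0 i] layer.u_ge_2[of 0 i] degree_pos
    by (cases "t = int r + 1") auto
qed

lemma around_parentE:
  assumes "child n j \<le> i" "i \<le> child n (j + 1)"
  obtains t where "1 \<le> t" "t \<le> int r" "point n j = around (Suc n) i t"
proof (cases "i = child n (j + 1)")
  case True
  then have "par n i = j + 1"
    using layer.parent_child by simp
  then show ?thesis
    using that[of "int r"] around_second_parent[of i n] True degree_pos by simp
next
  case False
  then have "par n i = j"
    using layer.parent_eqI[of n j i] assms by simp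
  moreover have "out_degree (Suc n) i + 3 \<le> int r"
    using out_degree_Suc[of n i] by auto
  ultimately show ?thesis
    using that[of "out_degree (Suc n) i + 3"] around_parent[of n i] layer.u_ge_2[of "Suc n" i] by simp
qed

lemma joined_imp_around:
  assumes "joined (point n i) y"
  obtains t where "1 \<le> t" "t \<le> int r" "y = around n i t"
  using assms
proof (cases rule: joined_pointE)
  case (disk w)
  then show ?thesis
    using that by (auto elim: around_disk_neighbourE)
next
  case right
  then show ?thesis
    using that[of "out_degree n i + 2"] around_succ layer.u_ge_2[of n i] layer.u_le[of n i] by simp
next
  case left
  then show ?thesis
    using that[of 1] around_pred(1) degree_pos by simp
next
  case (up k)
  then have "y = around n i (k - child n i + 2)"
    using around_up[of "k - child n i + 2" n i] first_child_succ[of "out_degree n" i] by simp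
  then show ?thesis
    using that[of "k - child n i + 2"] up first_child_succ[of "out_degree n" i] layer.u_le[of n i] by simp
next
  case (down m j)
  then show ?thesis
    using that by (auto elim: around_parentE)
qed

lemma joined_around_disk:
  assumes "u\<^sub>0 i + 2 \<le> t" "t \<le> int r"
  shows "joined (around 0 i t) (around 0 i (t + 1))"
  using boundary_triangle[OF assms] around_disk[of i t] around_disk[of i "t + 1"] assms(1)
  by (auto simp: vertex_0 apex_0 intro: joined.disk)

lemma joined_around_up:
  assumes "2 \<le> t" "t \<le> out_degree n i + 1"
  shows "joined (around n i t) (around n i (t + 1))"
proof (cases "t = out_degree n i + 1")
  case True
  have "joined (point (Suc n) (child n (i + 1))) (point n (i + 1))"
    using layer.child_less_succ[of n "i + 1"] by (intro joined.down) auto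
  then show ?thesis
    using True around_up[OF assms] around_succ[of n i] first_child_succ[of "out_degree n" i]
    by (simp add: add.commute)
next
  case False
  then show ?thesis
    using around_up[OF assms] around_up[of "t + 1" n i] assms joined_succ[of "Suc n" "child n i + t - 2"]
    by (simp add: algebra_simps)
qed

lemma joined_around_right:
  "joined (around (Suc n) i (out_degree (Suc n) i + 2)) (around (Suc n) i (out_degree (Suc n) i + 3))"
proof -
  have "joined (point (Suc n) (i + 1)) (point n (par n i))"
    using layer.child_parent(1)[of n i] layer.child_parent(2)[of i n] by (intro joined.down) auto
  then show ?thesis
    using around_succ[of "Suc n" i] around_parent[of n i] by simp
qed

lemma joined_around_parent:
  assumes "t = out_degree (Suc n) i + 3"
  shows "joined (around (Suc n) i t) (around (Suc n) i (t + 1))"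
proof (cases "i = child n (par n i)")
  case True
  then have "t + 1 = int r"
    using out_degree_Suc[of n i] assms by simp
  then show ?thesis
    using assms around_parent[of n i] around_second_parent[OF True] joined_pred[of n "par n i"] by simp
next
  case False
  then have "t = int r"
    using out_degree_Suc[of n i] assms by simp
  moreover have "joined (point n (par n i)) (point (Suc n) (i - 1))"
    using layer.child_parent(1)[of n i] layer.child_parent(2)[of i n] False by (intro joined.up) auto
  ultimately show ?thesis
    using assms around_parent[of n i] around_pred(2)[of "Suc n" i] by simp
qed

lemma joined_around_succ:
  assumes "1 \<le> t" "t \<le> int r"
  shows "joined (around n i t) (around n i (t + 1))"
  using assms
proof (cases rule: position_cases[where t = t and n = n and i = i])
  case left
  have "joined (point n (i - 1)) (point (Suc n) (child n i))"
    using layer.child_less_succ[of n "i - 1"] by (intro joined.up) auto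
  then show ?thesis
    using left around_pred(1) around_up[of 2 n i] layer.u_ge_2[of n i] by simp
next
  case up
  then show ?thesis
    by (rule joined_around_up)
next
  case right
  then show ?thesis
    using joined_around_disk[of i t] joined_around_right[of "n - 1" i] assms(2)
    by (cases n) (simp_all add: algebra_simps)
next
  case disk
  then show ?thesis
    using joined_around_disk[of i t] assms(2) by simp
next
  case (parent m)
  then show ?thesis
    using joined_around_parent by simp
next
  case (second_parent m)
  have "joined (point m (par m i - 1)) (point n (i - 1))"
    unfolding second_parent(1) using layer.child_less_succ[of m "par m i - 1"] second_parent(4)
    by (intro joined.up) auto
  then show ?thesis
    using second_parent around_second_parent[OF second_parent(4)] around_pred(2)[of n i] by simp
qed

lemma joined_around_if_nbr_succ:
  assumes s: "1 \<le> s" "s \<le> int r" and t: "1 \<le> t" "t \<le> int r" and "nbr n i t = nbr n i (s + 1)"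
  shows "joined (around n i s) (around n i t)"
proof (cases "s = int r")
  case True
  then have "t = 1"
    using t assms(5) layer.spoke_r_succ[of n i] layer.spoke_pred[of n i]
      link_walk_inj[OF layer.link_walk_spoke[of n i], of t 1] by simp
  then show ?thesis
    using joined_around_succ[OF s, of n i] True around_pred[of n i] by simp
next
  case False
  then have "t = s + 1"
    using s t assms(5) link_walk_inj[OF layer.link_walk_spoke[of n i], of t "s + 1"] by simp
  then show ?thesis
    using joined_around_succ[OF s, of n i] by simp
qed

definition neighbours :: "'v + nat \<times> int \<Rightarrow> ('v + nat \<times> int) set" where
  "neighbours x = {y. joined x y}"

lemma neighbours_point: "neighbours (point n i) = around n i ` {1..int r}"
  unfolding neighbours_def using joined_around by (auto elim: joined_imp_around)

lemma neighbours_inner: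
  assumes "v \<notin> range c\<^sub>0"
  shows "neighbours (Inl v) = Inl ` {w. adjacent_D v w}"
proof -
  have not_point: "Inl v \<noteq> point n i" for n i
    using assms point_eq_Inl_iff[of n i v] by (metis rangeI)
  have "y \<in> Inl ` {w. adjacent_D v w}" if "joined (Inl v) y" for y
    using that by (cases rule: joined.cases) (auto simp: not_point)
  then show ?thesis
    unfolding neighbours_def using joined.disk by blast
qed

lemma bij_betw_neighbours:
  assumes "x \<in> points"
  shows "bij_betw proj (neighbours x) {u. adjacent (proj x) u}"
  using assms
proof (cases rule: points_cases)
  case (inner v)
  have "{w. adjacent_D v w} = {w. adjacent v w}"
    using interior_adjacent[OF inner(2,3)] adjacent_D_imp_adjacent by blast
  moreover have "inj_on proj (Inl ` {w. adjacent_D v w})"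
    by (rule inj_onI) auto
  ultimately show ?thesis
    unfolding inner(1) neighbours_inner[OF inner(3)] bij_betw_def by (simp add: image_image)
next
  case (layer n i)
  have "bij_betw (proj \<circ> around n i) {1..int r} {u. adjacent (vertex n i) u}"
    using bij_betw_link_walk[OF layer.link_walk_spoke[of n i]] proj_around[of _ n i]
    by (subst bij_betw_cong[where g = "nbr n i"]) auto
  then show ?thesis
    unfolding layer neighbours_point bij_betw_def by (auto simp: image_comp intro: inj_on_imageI)
qed

lemma neighbours_triangle:
  assumes "x \<in> points" "y \<in> neighbours x" "z \<in> neighbours x" and tri: "triangle (proj x) (proj y) (proj z)"
  shows "z \<in> neighbours y"
  using assms(1)
proof (cases rule: points_cases)
  case (inner v)
  then obtain v' v'' where "y = Inl v'" "z = Inl v''"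
    using assms(2,3) neighbours_inner by auto
  then show ?thesis
    using interior_triangle[OF inner(2,3)] tri inner(1) joined.disk unfolding neighbours_def by simp
next
  case (layer n i)
  obtain s t where s: "y = around n i s" "1 \<le> s" "s \<le> int r" and t: "z = around n i t" "1 \<le> t" "t \<le> int r"
    using assms(2,3) unfolding layer neighbours_point by auto
  note walk = layer.link_walk_spoke[of n i]
  have "triangle (vertex n i) (nbr n i s) (nbr n i t)"
    using tri proj_around[of _ n i] s t layer by simp
  then consider (succ) "nbr n i t = nbr n i (s + 1)" | (pred) "nbr n i t = nbr n i (s - 1)"
    using link_walk_neighbour[OF walk] by blast
  then have "joined (around n i s) (around n i t)"
  proof cases
    case succ
    then show ?thesis
      using joined_around_if_nbr_succ s t by blast
  next
    case pred
    then have "nbr n i s = nbr n i (t + 1)"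
      using link_walk_shift_eq[OF walk, of t "s - 1" 1] by simp
    then show ?thesis
      using joined_around_if_nbr_succ joined_sym s t by blast
  qed
  then show ?thesis
    unfolding neighbours_def s(1) t(1) by simp
qed

lemma joined_reaches_base:
  assumes "x \<in> points"
  shows "joined\<^sup>*\<^sup>* x (point 0 0)"
proof -
  have "joined\<^sup>*\<^sup>* (Inl v) (Inl w)" if "adjacent_D\<^sup>*\<^sup>* v w" for v w
    using that by induction (auto intro: joined.disk rtranclp.rtrancl_into_rtrancl)
  then have inner: "joined\<^sup>*\<^sup>* (Inl v) (point 0 0)" if "v \<in> D" for v
    using D_connected[OF that boundary_in_D] by (simp add: point_def)
  have "joined\<^sup>*\<^sup>* (point n i) (point 0 0)" for n i
  proof (induction n arbitrary: i)
    case 0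
    then show ?case
      using inner[OF boundary_in_D] by (simp add: point_def)
  next
    case (Suc n)
    then show ?case
      using joined_parent by (rule converse_rtranclp_into_rtranclp[rotated])
  qed
  then show ?thesis
    using assms inner unfolding points_def by auto
qed

sublocale layers: surface_covering r adjacent triangle points neighbours proj
proof unfold_locales
  show "neighbours x \<subseteq> points" for x
    using joined_in_points unfolding neighbours_def by blast
  show "y \<in> neighbours x \<Longrightarrow> x \<in> neighbours y" for x y
    using joined_sym[of x y] unfolding neighbours_def by simp
next
  fix x y assume xy: "x \<in> points" "y \<in> points"
  have "symp joined"
    using joined_sym by (rule sympI)
  then have "joined\<^sup>*\<^sup>* (point 0 0) y"
    using joined_reaches_base[OF xy(2)] symp_rtranclp sympD by metis
  then have "joined\<^sup>*\<^sup>* x y"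
    using joined_reaches_base[OF xy(1)] by (rule rtranclp_trans[rotated])
  then show "(\<lambda>x y. y \<in> neighbours x)\<^sup>*\<^sup>* x y"
    by (simp add: neighbours_def)
qed (fact bij_betw_neighbours neighbours_triangle)+

end

section \<open>Counting the cells of a layer\<close>

context triangulated_surface
begin

definition edges_within :: "'v set \<Rightarrow> 'v set set" where
  "edges_within S = {{v, w} |v w. adjacent v w \<and> v \<in> S \<and> w \<in> S}"

definition triangles_within :: "'v set \<Rightarrow> 'v set set" where
  "triangles_within S = {{x, y, z} |x y z. triangle x y z \<and> x \<in> S \<and> y \<in> S \<and> z \<in> S}"

lemma edges_within_mono: "S \<subseteq> S' \<Longrightarrow> edges_within S \<subseteq> edges_within S'"
  and triangles_within_mono: "S \<subseteq> S' \<Longrightarrow> triangles_within S \<subseteq> triangles_within S'"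
  unfolding edges_within_def triangles_within_def by blast+

lemma edges_within_subset_Pow: "edges_within S \<subseteq> Pow S"
  and triangles_within_subset_Pow: "triangles_within S \<subseteq> Pow S"
  unfolding edges_within_def triangles_within_def by blast+

lemma finite_edges_within: "finite S \<Longrightarrow> finite (edges_within S)"
  and finite_triangles_within: "finite S \<Longrightarrow> finite (triangles_within S)"
  by (simp_all add: finite_subset[OF edges_within_subset_Pow] finite_subset[OF triangles_within_subset_Pow])

lemma edges_within_handshake:
  assumes "finite S"
  shows "(\<Sum>v\<in>S. card {w \<in> S. adjacent v w}) = 2 * card (edges_within S)"
proof -
  have "card {v \<in> S. v \<in> e} = 2" if e: "e \<in> edges_within S" for e
  proof -
    obtain v w where "e = {v, w}" "adjacent v w" "v \<in> S" "w \<in> S"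
      using e unfolding edges_within_def by auto
    then have "{v \<in> S. v \<in> e} = {v, w}" "v \<noteq> w"
      using adjacent_irrefl by auto
    then show ?thesis
      by simp
  qed
  then have "(\<Sum>v\<in>S. card {e \<in> edges_within S. v \<in> e}) = 2 * card (edges_within S)"
    using assms by (intro sum_multicount finite_edges_within) auto
  moreover have "card {e \<in> edges_within S. v \<in> e} = card {w \<in> S. adjacent v w}" if "v \<in> S" for v
  proof -
    have "{e \<in> edges_within S. v \<in> e} = (\<lambda>w. {v, w}) ` {w \<in> S. adjacent v w}"
      using that adjacent_sym unfolding edges_within_def by (auto simp: insert_commute)
    moreover have "inj_on (\<lambda>w. {v, w}) {w \<in> S. adjacent v w}"
      by (auto simp: inj_on_def doubleton_eq_iff)
    ultimately show ?thesis
      by (simp add: card_image)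
  qed
  ultimately show ?thesis
    by simp
qed

lemma triangles_within_handshake:
  assumes "finite S"
  shows "(\<Sum>v\<in>S. card {f \<in> triangles_within S. v \<in> f}) = 3 * card (triangles_within S)"
proof (rule sum_multicount)
  show "\<forall>f\<in>triangles_within S. card {v \<in> S. v \<in> f} = 3"
  proof
    fix f assume "f \<in> triangles_within S"
    then obtain x y z where xyz: "f = {x, y, z}" "triangle x y z" "x \<in> S" "y \<in> S" "z \<in> S"
      unfolding triangles_within_def by auto
    then have "{v \<in> S. v \<in> f} = {x, y, z}"
      by auto
    then show "card {v \<in> S. v \<in> f} = 3"
      using triangle_neq[OF xyz(2)] by simp
  qed
qed (use assms in \<open>simp_all add: finite_triangles_within\<close>)

lemma card_neighbours_within:
  assumes "link_walk w z"
  shows "card {v \<in> S. adjacent w v} = card {t \<in> {1..int r}. z t \<in> S}"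
proof -
  have inj: "inj_on z {1..int r}" and range: "{v. adjacent w v} = z ` {1..int r}"
    using bij_betw_link_walk[OF assms] unfolding bij_betw_def by auto
  have "{v \<in> S. adjacent w v} = S \<inter> z ` {1..int r}"
    unfolding range[symmetric] by auto
  then have image: "z ` {t \<in> {1..int r}. z t \<in> S} = {v \<in> S. adjacent w v}"
    by auto
  have "inj_on z {t \<in> {1..int r}. z t \<in> S}"
    using inj by (rule inj_on_subset) blast
  then show ?thesis
    unfolding image[symmetric] by (rule card_image)
qed

lemma triangle_within_atE:
  assumes "f \<in> triangles_within S" "w \<in> f"
  obtains x y where "triangle w x y" "f = {w, x, y}" "x \<in> S" "y \<in> S"
proof -
  obtain a b c where abc: "f = {a, b, c}" "triangle a b c" "a \<in> S" "b \<in> S" "c \<in> S"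
    using assms(1) unfolding triangles_within_def by auto
  then consider (first) "w = a" | (second) "w = b" | (third) "w = c"
    using assms(2) by blast
  then show ?thesis
  proof cases
    case first
    then show ?thesis
      using that[of b c] abc by simp
  next
    case second
    then show ?thesis
      using that[of a c] abc triangle_swap(1)[OF abc(2)] by (simp add: insert_commute)
  next
    case third
    then show ?thesis
      using that[of a b] abc triangle_swap(1)[OF triangle_swap(2)[OF abc(2)]] by (simp add: insert_commute)
  qed
qed

lemma triangle_link_positionE:
  assumes z: "link_walk w z" and tri: "triangle w x y"
  obtains t where "1 \<le> t" "t \<le> int r" "{x, y} = {z t, z (t + 1)}"
proof -
  obtain s where s: "1 \<le> s" "s \<le> int r" "x = z s"
    using z triangle_sides(1)[OF tri] by (rule link_walk_positionE)
  obtain t where t: "1 \<le> t" "t \<le> int r" "y = z t"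
    using z triangle_sides(2)[OF tri] by (rule link_walk_positionE)
  consider (succ) "y = z (s + 1)" | (pred) "y = z (s - 1)"
    using link_walk_neighbour[OF z] tri s(3) by blast
  then show ?thesis
  proof cases
    case succ
    then show ?thesis
      using that[of s] s by simp
  next
    case pred
    then have "x = z (t + 1)"
      using link_walk_shift_eq[OF z, of t "s - 1" 1] s(3) t(3) by simp
    then show ?thesis
      using that[of t] t by (simp add: insert_commute)
  qed
qed

lemma inj_on_link_triangle:
  assumes z: "link_walk w z" and "r \<ge> 3"
  shows "inj_on (\<lambda>t. {w, z t, z (t + 1)}) {1..int r}"
proof
  fix s t assume st: "s \<in> {1..int r}" "t \<in> {1..int r}" and eq: "{w, z s, z (s + 1)} = {w, z t, z (t + 1)}"
  have "{z i, z (i + 1)} = {w, z i, z (i + 1)} - {w}" for i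
    using triangle_neq[OF link_walk_succ[OF z, of i]] by auto
  then have "{z s, z (s + 1)} = {z t, z (t + 1)}"
    using eq by metis
  then consider (same) "z s = z t" | (crossed) "z s = z (t + 1)" "z (s + 1) = z t"
    by (auto simp: doubleton_eq_iff)
  then show "s = t"
  proof cases
    case same
    then show ?thesis
      using link_walk_inj[OF z] st by auto
  next
    case crossed
    then have "int r dvd (s + 1 - t) - (s - (t + 1))"
      using link_walk_eq_iff[OF z] dvd_diff by blast
    then show ?thesis
      using zdvd_imp_le[of "int r" 2] \<open>r \<ge> 3\<close> by simp
  qed
qed

lemma card_triangles_within_at:
  assumes z: "link_walk w z" and "w \<in> S" "r \<ge> 3"
  shows "card {f \<in> triangles_within S. w \<in> f} = card {t \<in> {1..int r}. z t \<in> S \<and> z (t + 1) \<in> S}"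
proof -
  define I where "I = {t \<in> {1..int r}. z t \<in> S \<and> z (t + 1) \<in> S}"
  have image: "(\<lambda>t. {w, z t, z (t + 1)}) ` I = {f \<in> triangles_within S. w \<in> f}"
  proof
    show "(\<lambda>t. {w, z t, z (t + 1)}) ` I \<subseteq> {f \<in> triangles_within S. w \<in> f}"
      unfolding I_def triangles_within_def using link_walk_succ[OF z] \<open>w \<in> S\<close> by blast
    show "{f \<in> triangles_within S. w \<in> f} \<subseteq> (\<lambda>t. {w, z t, z (t + 1)}) ` I"
    proof
      fix f assume "f \<in> {f \<in> triangles_within S. w \<in> f}"
      then obtain x y where xy: "triangle w x y" "f = {w, x, y}" "x \<in> S" "y \<in> S"
        by (auto elim: triangle_within_atE)
      obtain t where t: "1 \<le> t" "t \<le> int r" "{x, y} = {z t, z (t + 1)}"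
        using z xy(1) by (rule triangle_link_positionE)
      then have "t \<in> I"
        unfolding I_def using xy(3,4) by (auto simp: doubleton_eq_iff)
      then show "f \<in> (\<lambda>t. {w, z t, z (t + 1)}) ` I"
        using xy(2) t(3) by auto
    qed
  qed
  have "inj_on (\<lambda>t. {w, z t, z (t + 1)}) I"
    using inj_on_link_triangle[OF z \<open>r \<ge> 3\<close>] by (rule inj_on_subset) (auto simp: I_def)
  then show ?thesis
    unfolding image[symmetric] I_def by (rule card_image)
qed

end

context convex_patch
begin

definition patch :: "nat \<Rightarrow> 'v set" where
  "patch n = D \<union> (\<Union>m\<in>{..n}. range (vertex m))"

lemma patch_0: "patch 0 = D"
  unfolding patch_def using boundary_in_D by (auto simp: vertex_0)

lemma patch_Suc: "patch (Suc n) = patch n \<union> range (vertex (Suc n))"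
  unfolding patch_def by (auto simp: atMost_Suc)

lemma patch_mono: "m \<le> n \<Longrightarrow> patch m \<subseteq> patch n"
  unfolding patch_def by fastforce

lemma vertex_in_patch: "m \<le> n \<Longrightarrow> vertex m i \<in> patch n"
  unfolding patch_def by blast

lemma vertex_eq_iff: "vertex n i = vertex m j \<longleftrightarrow> n = m \<and> len n dvd i - j"
  using inj_on_eq_iff[OF layers.covering_inj point_in_points[of n i] point_in_points[of m j]]
  by (simp add: point_eq_iff)

lemma vertex_in_D_iff: "vertex n i \<in> D \<longleftrightarrow> n = 0"
proof
  assume "vertex n i \<in> D"
  then have "Inl (vertex n i) \<in> points"
    unfolding points_def by blast
  then have "point n i = Inl (vertex n i)"
    using inj_on_eq_iff[OF layers.covering_inj point_in_points[of n i], of "Inl (vertex n i)"] by simp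
  then show "n = 0"
    unfolding point_eq_Inl_iff by simp
qed (use boundary_in_D in \<open>simp add: vertex_0\<close>)

lemma vertex_in_range_iff: "vertex m i \<in> range (vertex n) \<longleftrightarrow> m = n"
  using vertex_eq_iff by blast

lemma vertex_in_patch_iff: "vertex m i \<in> patch n \<longleftrightarrow> m \<le> n"
  unfolding patch_def by (auto simp: vertex_in_D_iff vertex_in_range_iff)

lemma patch_Suc_Diff: "patch (Suc n) - patch n = range (vertex (Suc n))"
  unfolding patch_Suc using vertex_in_patch_iff[of "Suc n" _ n] by auto

lemma bij_betw_vertex: "bij_betw (vertex n) {0..<len n} (range (vertex n))"
  using bij_betw_period[of "vertex n" "len n" 0] len_pos by (simp add: vertex_eq_iff)

lemma card_range_vertex: "card (range (vertex n)) = nat (len n)"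
  using card_range_period[of "vertex n" "len n"] len_pos by (simp add: vertex_eq_iff)

lemma finite_patch: "finite (patch n)"
  unfolding patch_def using finite_D bij_betw_finite[OF bij_betw_vertex] by simp

lemma patch_liftE:
  assumes "v \<in> patch n"
  obtains x where "x \<in> points" "proj x = v"
proof -
  consider (disk) "v \<in> D" | (layer) m i where "v = vertex m i"
    using assms unfolding patch_def by blast
  then show ?thesis
  proof cases
    case disk
    then show ?thesis
      using that[of "Inl v"] by (simp add: points_def)
  next
    case (layer m i)
    then show ?thesis
      using that[of "point m i"] point_in_points by simp
  qed
qed

lemma neighbour_liftE:
  assumes "x \<in> points" "adjacent (proj x) w"
  obtains y where "joined x y" "proj y = w"
proof -
  have "w \<in> proj ` neighbours x"
    using bij_betw_neighbours[OF assms(1)] assms(2) by (simp add: bij_betw_def)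
  then show ?thesis
    using that unfolding neighbours_def by blast
qed

lemma adjacent_D_iff:
  assumes "v \<in> D" "w \<in> D"
  shows "adjacent_D v w \<longleftrightarrow> adjacent v w"
proof
  assume "adjacent v w"
  have points: "Inl v \<in> points" "Inl w \<in> points"
    using assms unfolding points_def by auto
  obtain y where y: "joined (Inl v) y" "proj y = w"
    using neighbour_liftE[OF points(1)] \<open>adjacent v w\<close> by auto
  then have "y = Inl w"
    using inj_onD[OF layers.covering_inj _ joined_in_points[OF y(1)] points(2)] by simp
  with y(1) have "joined (Inl v) (Inl w)"
    by simp
  then show "adjacent_D v w"
    by (cases rule: joined.cases) (auto simp: point_def split: if_splits)
qed (rule adjacent_D_imp_adjacent)

lemma joined_in_next_patch: "joined x y \<Longrightarrow> proj x \<in> patch n \<Longrightarrow> proj y \<in> patch (Suc n)"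
proof (induction rule: joined.induct)
  case (disk v w)
  then show ?case
    using adjacent_D_in_D[OF adjacent_D_sym] unfolding patch_def by simp
qed (simp_all add: vertex_in_patch_iff)

lemma patch_Suc_eq_neighbours: "patch (Suc n) = patch n \<union> {w. \<exists>v\<in>patch n. adjacent v w}"
proof
  have "adjacent (vertex n (par n k)) (vertex (Suc n) k)" for k
    using layer.inner_triangle[of "Suc n" k] triangle_sides(2) adjacent_sym unfolding apex_Suc by blast
  then show "patch (Suc n) \<subseteq> patch n \<union> {w. \<exists>v\<in>patch n. adjacent v w}"
    unfolding patch_Suc using vertex_in_patch[of n n] by blast
  have "w \<in> patch (Suc n)" if v: "v \<in> patch n" and w: "adjacent v w" for v w
  proof -
    obtain x where "x \<in> points" "proj x = v"
      using v by (rule patch_liftE)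
    moreover from this obtain y where "joined x y" "proj y = w"
      using w neighbour_liftE by metis
    ultimately show ?thesis
      using joined_in_next_patch v by metis
  qed
  then show "patch n \<union> {w. \<exists>v\<in>patch n. adjacent v w} \<subseteq> patch (Suc n)"
    using patch_Suc by blast
qed

lemma interior_neighbour_in_patch:
  assumes "v \<in> patch n" "v \<notin> range (vertex n)" "adjacent v w"
  shows "w \<in> patch n"
proof (cases n)
  case 0
  then show ?thesis
    using assms interior_adjacent[of v w] adjacent_D_in_D[OF adjacent_D_sym] by (simp add: patch_0 vertex_0)
next
  case (Suc m)
  then have "v \<in> patch m"
    using assms(1,2) by (simp add: patch_Suc)
  then show ?thesis
    using assms(3) patch_Suc_eq_neighbours[of m] Suc by blast
qed

lemma nbr_in_patch_iff:
  assumes "1 \<le> t" "t \<le> int r + 1"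
  shows "nbr n i t \<in> patch n \<longleftrightarrow> \<not> (2 \<le> t \<and> t \<le> out_degree n i + 1)"
proof (cases "t = int r + 1")
  case True
  then show ?thesis
    using layer.spoke_r_succ[of n i] layer.u_le[of n i] vertex_in_patch by simp
next
  case False
  then have "t \<le> int r"
    using assms(2) by simp
  with assms(1) show ?thesis
  proof (cases rule: position_cases[where t = t and n = n and i = i])
    case left
    then show ?thesis
      using layer.spoke_pred[of n i] vertex_in_patch by simp
  next
    case up
    then show ?thesis
      using nbr_up vertex_in_patch_iff by simp
  next
    case right
    then show ?thesis
      using layer.spoke_succ[of n i] vertex_in_patch by simp
  next
    case disk
    then have "adjacent_D (c\<^sub>0 i) (nbr 0 i t)"
      unfolding boundary_adjacent_iff using \<open>t \<le> int r\<close> by (auto simp: vertex_0 apex_0)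
    then show ?thesis
      using adjacent_D_in_D[OF adjacent_D_sym] disk patch_0 by simp
  next
    case (parent m)
    then show ?thesis
      using nbr_parent[of m i] vertex_in_patch by simp
  next
    case (second_parent m)
    then show ?thesis
      using nbr_second_parent[of i m] vertex_in_patch by simp
  qed
qed

lemma card_neighbours_layer: "int (card {w \<in> patch n. adjacent (vertex n i) w}) = int r - out_degree n i"
proof -
  have "{t \<in> {1..int r}. nbr n i t \<in> patch n} = insert 1 {out_degree n i + 2..int r}"
    using nbr_in_patch_iff[of _ n i] layer.u_ge_2[of n i] degree_pos by auto
  then show ?thesis
    using card_neighbours_within[OF layer.link_walk_spoke[of n i]] layer.u_ge_2[of n i] layer.u_le[of n i]
    by simp
qed

lemma card_triangles_layer:
  "int (card {f \<in> triangles_within (patch n). vertex n i \<in> f}) = int r - out_degree n i - 1"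
proof -
  have "{t \<in> {1..int r}. nbr n i t \<in> patch n \<and> nbr n i (t + 1) \<in> patch n} = {out_degree n i + 2..int r}"
    using nbr_in_patch_iff[of _ n i] layer.u_ge_2[of n i] by auto
  then show ?thesis
    using card_triangles_within_at[OF layer.link_walk_spoke[of n i] vertex_in_patch] degree_ge_6
      layer.u_le[of n i] by simp
qed

lemma interior_link_walkE:
  assumes "v \<in> patch n" "v \<notin> range (vertex n)"
  obtains z where "link_walk v z" "\<And>t. z t \<in> patch n"
proof -
  have "\<exists>w. adjacent v w"
  proof (cases "v \<in> D")
    case True
    show ?thesis
    proof (cases "v = c\<^sub>0 0")
      case True
      then show ?thesis
        using triangle_sides(1)[OF inner_triangle] by blast
    next
      case False
      then show ?thesis
        using D_connected[OF True boundary_in_D[of 0]] adjacent_D_imp_adjacent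
        by (metis converse_rtranclpE)
    qed
  next
    case False
    then show ?thesis
      using assms(1) triangle_sides(1)[OF layer.inner_triangle] unfolding patch_def by blast
  qed
  then obtain a where a: "adjacent v a"
    by blast
  then have "card {x. triangle v a x} = 2"
    by (rule card_triangles_at_edge)
  then obtain b where "triangle v a b"
    by (metis card.empty empty_Collect_eq zero_neq_numeral)
  then obtain z where "link_walk v z"
    by (rule ex_link_walk)
  then show ?thesis
    using that interior_neighbour_in_patch[OF assms] link_walk_adjacent by blast
qed

lemma card_neighbours_interior:
  assumes "v \<in> patch n" "v \<notin> range (vertex n)"
  shows "card {w \<in> patch n. adjacent v w} = r"
proof -
  obtain z where z: "link_walk v z" "\<And>t. z t \<in> patch n"
    using interior_link_walkE[OF assms] by metis
  then have "{t \<in> {1..int r}. z t \<in> patch n} = {1..int r}"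
    by auto
  then show ?thesis
    unfolding card_neighbours_within[OF z(1)] by simp
qed

lemma card_triangles_interior:
  assumes "v \<in> patch n" "v \<notin> range (vertex n)"
  shows "card {f \<in> triangles_within (patch n). v \<in> f} = r"
proof -
  obtain z where z: "link_walk v z" "\<And>t. z t \<in> patch n"
    using interior_link_walkE[OF assms] by metis
  then have "{t \<in> {1..int r}. z t \<in> patch n \<and> z (t + 1) \<in> patch n} = {1..int r}"
    by auto
  then show ?thesis
    using card_triangles_within_at[OF z(1) assms(1)] degree_ge_6 by simp
qed

lemma sum_over_patch:
  fixes g :: "'v \<Rightarrow> int"
  assumes interior: "\<And>v. v \<in> patch n \<Longrightarrow> v \<notin> range (vertex n) \<Longrightarrow> g v = int r"
    and layer: "\<And>i. g (vertex n i) = int r - h i"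
  shows "(\<Sum>v\<in>patch n. g v) = int r * int (card (patch n)) - (\<Sum>i\<in>{0..<len n}. h i)"
proof -
  have "(\<Sum>i\<in>{0..<len n}. h i) = (\<Sum>v\<in>range (vertex n). int r - g v)"
    using sum.reindex_bij_betw[OF bij_betw_vertex, of "\<lambda>v. int r - g v" n] layer by simp
  also have "\<dots> = (\<Sum>v\<in>patch n. int r - g v)"
    using interior vertex_in_patch by (intro sum.mono_neutral_left) (auto simp: finite_patch)
  finally show ?thesis
    by (simp add: sum_subtractf)
qed

lemma card_edges_patch:
  "2 * int (card (edges_within (patch n))) = int r * int (card (patch n)) - (\<Sum>i\<in>{0..<len n}. out_degree n i)"
proof -
  have "2 * int (card (edges_within (patch n))) = (\<Sum>v\<in>patch n. int (card {w \<in> patch n. adjacent v w}))"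
    unfolding of_nat_sum[symmetric] edges_within_handshake[OF finite_patch] by simp
  also have "\<dots> = int r * int (card (patch n)) - (\<Sum>i\<in>{0..<len n}. out_degree n i)"
    by (rule sum_over_patch) (simp_all add: card_neighbours_interior card_neighbours_layer)
  finally show ?thesis .
qed

lemma card_triangles_patch:
  "3 * int (card (triangles_within (patch n))) =
    int r * int (card (patch n)) - (\<Sum>i\<in>{0..<len n}. out_degree n i) - len n"
proof -
  have "3 * int (card (triangles_within (patch n))) =
      (\<Sum>v\<in>patch n. int (card {f \<in> triangles_within (patch n). v \<in> f}))"
    unfolding of_nat_sum[symmetric] triangles_within_handshake[OF finite_patch] by simp
  also have "\<dots> = int r * int (card (patch n)) - (\<Sum>i\<in>{0..<len n}. out_degree n i + 1)"
    by (rule sum_over_patch) (simp_all add: card_triangles_interior card_triangles_layer)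
  finally show ?thesis
    using len_pos[of n] by (simp add: sum.distrib)
qed

lemma len_Suc_eq_sum: "len (Suc n) = (\<Sum>i\<in>{0..<len n}. out_degree n i) - len n"
  unfolding len_Suc using len_pos[of n] by (intro first_child_nonneg) simp

lemma sum_out_degree_Suc: "(\<Sum>k\<in>{0..<len (Suc n)}. out_degree (Suc n) k) = (int r - 3) * len (Suc n) - len n"
proof -
  have "{k \<in> {0..<len (Suc n)}. k = child n (par n k)} = child n ` {0..<len n}"
  proof
    show "{k \<in> {0..<len (Suc n)}. k = child n (par n k)} \<subseteq> child n ` {0..<len n}"
    proof
      fix k assume "k \<in> {k \<in> {0..<len (Suc n)}. k = child n (par n k)}"
      then have k: "k = child n (par n k)" "child n 0 \<le> k" "k < child n (len n)"
        by (auto simp: len_Suc)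
      then have "par n k \<in> {0..<len n}"
        using layer.child_le_iff[of n 0 "par n k"] layer.child_less_iff[of n "par n k" "len n"] by simp
      then show "k \<in> child n ` {0..<len n}"
        using k(1) by blast
    qed
    have "child n i \<in> {0..<len (Suc n)}" if "i \<in> {0..<len n}" for i
      using that layer.child_le_iff[of n 0 i] layer.child_less_iff[of n i "len n"] by (simp add: len_Suc)
    then show "child n ` {0..<len n} \<subseteq> {k \<in> {0..<len (Suc n)}. k = child n (par n k)}"
      by (auto simp: layer.parent_child)
  qed
  moreover have "inj_on (child n) {0..<len n}"
    using layer.parent_child by (rule inj_on_inverseI)
  ultimately have "int (card {k \<in> {0..<len (Suc n)}. k = child n (par n k)}) = len n"
    using len_pos[of n] by (simp add: card_image)
  moreover have "(\<Sum>k\<in>{0..<len (Suc n)}. out_degree (Suc n) k) =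
      (\<Sum>k\<in>{0..<len (Suc n)}. (int r - 3) - of_bool (k = child n (par n k)))"
    by (intro sum.cong) (auto simp: out_degree_Suc)
  ultimately show ?thesis
    using len_pos[of "Suc n"] by (simp add: sum_subtractf sum.If_cases Int_def)
qed

lemma len_recurrence: "len (Suc (Suc n)) = (int r - 4) * len (Suc n) - len n"
  using len_Suc_eq_sum[of "Suc n"] sum_out_degree_Suc[of n] by (simp add: algebra_simps)

lemma card_patch_Suc_Diff: "int (card (patch (Suc n) - patch n)) = len (Suc n)"
  unfolding patch_Suc_Diff card_range_vertex using len_pos[of "Suc n"] by simp

lemma card_patch_Suc: "int (card (patch (Suc n))) = int (card (patch n)) + len (Suc n)"
  using card_patch_Suc_Diff[of n] card_Diff_subset[OF finite_patch patch_mono[of n "Suc n"]]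
    card_mono[OF finite_patch patch_mono[of n "Suc n"]] by simp

lemma card_edges_patch_Suc_Diff:
  "int (card (edges_within (patch (Suc n)) - edges_within (patch n))) = 2 * len (Suc n) + len n"
proof -
  have sub: "edges_within (patch n) \<subseteq> edges_within (patch (Suc n))"
    by (rule edges_within_mono[OF patch_mono]) simp
  have "int (card (edges_within (patch (Suc n)) - edges_within (patch n))) =
      int (card (edges_within (patch (Suc n)))) - int (card (edges_within (patch n)))"
    using card_Diff_subset[OF _ sub] card_mono[OF _ sub] finite_edges_within[OF finite_patch] by simp
  then show ?thesis
    using card_edges_patch[of n] card_edges_patch[of "Suc n"] card_patch_Suc[of n] sum_out_degree_Suc[of n]
      len_Suc_eq_sum[of n] by (simp add: algebra_simps)
qed

lemma card_triangles_patch_Suc_Diff: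
  "int (card (triangles_within (patch (Suc n)) - triangles_within (patch n))) = len (Suc n) + len n"
proof -
  have sub: "triangles_within (patch n) \<subseteq> triangles_within (patch (Suc n))"
    by (rule triangles_within_mono[OF patch_mono]) simp
  have "int (card (triangles_within (patch (Suc n)) - triangles_within (patch n))) =
      int (card (triangles_within (patch (Suc n)))) - int (card (triangles_within (patch n)))"
    using card_Diff_subset[OF _ sub] card_mono[OF _ sub] finite_triangles_within[OF finite_patch] by simp
  then show ?thesis
    using card_triangles_patch[of n] card_triangles_patch[of "Suc n"] card_patch_Suc[of n]
      sum_out_degree_Suc[of n] len_Suc_eq_sum[of n] by (simp add: algebra_simps)
qed

end

section \<open>The boundary of a combinatorial disk\<close>

context triangulated_mesh
begin

sublocale surface: triangulated_surface r adjacent triangle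
proof
  show "card {v. adjacent w v} = r" if "adjacent w u" for w u
    using adjacent_in_V(1)[OF that] by (rule card_adjacent)
  show "\<not> adjacent a a" for a
    using adjacent_neq by blast
  show "(triangle w)\<^sup>*\<^sup>* u v" if "adjacent w u" "adjacent w v" for w u v
    using that by (rule link_connected)
  show "card {x. triangle a b x} = 2" if "adjacent a b" for a b
    using that by (rule card_triangles_at_edge)
  show "triangle b a c" "triangle a c b" "adjacent a b" if "triangle a b c" for a b c
    using triangle_swap(1,2)[OF that] triangle_adjacent(1)[OF that] by simp_all
  show "adjacent b a" if "adjacent a b" for a b
    using that by (rule adjacent_sym)
qed (rule degree_pos)

lemma null_cycle: "graph_cycle adjacent cs \<Longrightarrow> surface.null_cycle cs"
proof (induction rule: disk_induct)
  case (split x p y q m)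
  then show ?case
    using disk_split_cycles(1,2)[OF split(1)] surface.null_cycle.split by metis
qed (rule surface.null_cycle.triangle surface.null_cycle.rotate; assumption)+

sublocale surface: simply_connected_surface r adjacent triangle
  by unfold_locales (rule null_cycle)

context
  fixes X w z assumes circuit: "edge_circuit X" and z: "surface.link_walk w z"
begin

lemma triangle_inside_step:
  assumes "edge w (z t) \<notin> X"
  shows "triangle_interior w (z t) (z (t + 1)) \<subseteq> inside (\<Union>X) \<longleftrightarrow>
    triangle_interior w (z (t - 1)) (z t) \<subseteq> inside (\<Union>X)"
  using edge_inside_iff_triangle_inside[OF circuit surface.link_walk_succ[OF z] assms]
    edge_inside_iff_triangle_inside[OF circuit surface.link_walk_pred[OF z] assms]
    triangle_swap(4)[OF surface.link_walk_pred[OF z, of t]] by simp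

lemma triangle_inside_flip:
  assumes "edge w (z t) \<in> X"
  shows "triangle_interior w (z t) (z (t + 1)) \<subseteq> inside (\<Union>X) \<longleftrightarrow>
    \<not> triangle_interior w (z (t - 1)) (z t) \<subseteq> inside (\<Union>X)"
  using circuit_edge_separates_triangles[OF circuit assms surface.link_walk_succ[OF z]
      surface.link_walk_pred[OF z] surface.link_walk_neq[OF z]]
    triangle_swap(4)[OF surface.link_walk_pred[OF z, of t]] by simp

end

end

locale mesh_disk = triangulated_mesh +
  fixes cs assumes cycle: "graph_cycle adjacent cs"
begin

abbreviation X :: "complex set set" where
  "X \<equiv> boundary_edges cs"

abbreviation c :: "int \<Rightarrow> complex" where
  "c \<equiv> cyclic_nth cs"

lemma length_cs: "int (length cs) \<ge> 3" and distinct_cs: "distinct cs" and cs_neq_Nil: "cs \<noteq> []"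
  using cycle unfolding graph_cycle_def by auto

lemmas c_eq_iff = cyclic_nth_eq_iff[OF distinct_cs cs_neq_Nil]

lemmas circuit = edge_circuit_boundary[OF cycle]

lemma c_adjacent: "adjacent (c i) (c (i + 1))"
  using cycle by (rule graph_cycle_cyclic_nth)

lemma range_c: "range c = V \<inter> \<Union>X"
  using Union_boundary_edges_Int_V[OF cycle] range_cyclic_nth[OF cs_neq_Nil] by blast

lemma c_in_disk: "c i \<in> disk_vertices X"
  using range_c unfolding disk_vertices_def by blast

lemma edge_c_in_X: "edge (c i) (c (i + 1)) \<in> X"
  unfolding boundary_edges_conv_nth using cs_neq_Nil by (metis (mono_tags, lifting) cyclic_nthE mem_Collect_eq)

lemma boundary_edgeE:
  assumes "e \<in> X"
  obtains j where "e = edge (c j) (c (j + 1))"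
proof -
  obtain i where "i < length cs" "e = edge (cs ! i) (cs ! ((i + 1) mod length cs))"
    using assms unfolding boundary_edges_conv_nth by auto
  then show ?thesis
    using that[of "int i"] by (simp add: cyclic_nth_of_nat cyclic_nth_succ_of_nat)
qed

lemma edge_in_X_iff:
  assumes w: "adjacent (c i) w"
  shows "edge (c i) w \<in> X \<longleftrightarrow> w = c (i + 1) \<or> w = c (i - 1)"
proof
  assume "edge (c i) w \<in> X"
  then obtain j where "edge (c i) w = edge (c j) (c (j + 1))"
    by (rule boundary_edgeE)
  then consider (same) "c i = c j" "w = c (j + 1)" | (swapped) "c i = c (j + 1)" "w = c j"
    unfolding edge_eq_iff[OF w c_adjacent] doubleton_eq_iff by blast
  then show "w = c (i + 1) \<or> w = c (i - 1)"
  proof cases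
    case same
    then have "c (i + 1) = c (j + 1)"
      unfolding c_eq_iff by simp
    then show ?thesis
      using same by simp
  next
    case swapped
    then have "c (i - 1) = c j"
      unfolding c_eq_iff by (simp add: algebra_simps)
    then show ?thesis
      using swapped by simp
  qed
next
  assume "w = c (i + 1) \<or> w = c (i - 1)"
  then show "edge (c i) w \<in> X"
    using edge_c_in_X[of i] edge_c_in_X[of "i - 1"] edge_commute[of "c i" "c (i - 1)"] by auto
qed

definition inner_apex :: "int \<Rightarrow> complex" where
  "inner_apex i = (SOME x. triangle (c i) (c (i + 1)) x \<and> triangle_interior (c i) (c (i + 1)) x \<subseteq> inside (\<Union>X))"

lemma inner_apex: "triangle (c i) (c (i + 1)) (inner_apex i)"
  and inner_apex_inside: "triangle_interior (c i) (c (i + 1)) (inner_apex i) \<subseteq> inside (\<Union>X)"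
proof -
  have "\<exists>x. triangle (c i) (c (i + 1)) x \<and> triangle_interior (c i) (c (i + 1)) x \<subseteq> inside (\<Union>X)"
    using ex_inner_triangle[OF circuit c_adjacent edge_c_in_X] by metis
  then show "triangle (c i) (c (i + 1)) (inner_apex i)"
    "triangle_interior (c i) (c (i + 1)) (inner_apex i) \<subseteq> inside (\<Union>X)"
    unfolding inner_apex_def by (metis (mono_tags, lifting) someI_ex)+
qed

lemma inner_apex_eq:
  assumes "triangle (c i) (c (i + 1)) x" "triangle_interior (c i) (c (i + 1)) x \<subseteq> inside (\<Union>X)"
  shows "inner_apex i = x"
  using circuit_edge_separates_triangles[OF circuit edge_c_in_X assms(1) inner_apex] assms(2) inner_apex_inside
  by blast

abbreviation nbr :: "int \<Rightarrow> int \<Rightarrow> complex" where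
  "nbr \<equiv> surface.spoke c inner_apex"

sublocale walk: walk_with_apexes r adjacent triangle c inner_apex
  by unfold_locales (rule inner_apex)

lemmas nbr_adjacent = surface.link_walk_adjacent[OF walk.link_walk_spoke]

lemmas nbr_inj = surface.link_walk_inj[OF walk.link_walk_spoke]

definition out_degree :: "int \<Rightarrow> int" where
  "out_degree i = (SOME t. 0 \<le> t \<and> t \<le> int r - 2 \<and> nbr i (t + 2) = c (i + 1))"

lemma out_degree_nonneg: "0 \<le> out_degree i" and out_degree_le: "out_degree i \<le> int r - 2"
  and nbr_out_degree: "nbr i (out_degree i + 2) = c (i + 1)"
proof -
  obtain t where t: "1 \<le> t" "t \<le> int r" "c (i + 1) = nbr i t"
    using walk.link_walk_spoke c_adjacent by (rule surface.link_walk_positionE)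
  have "c (i + 1) \<noteq> c (i - 1)"
    unfolding c_eq_iff using zdvd_imp_le[of "int (length cs)" 2] length_cs by auto
  then have "t \<noteq> 1"
    using t(3) walk.spoke_pred by metis
  then have "\<exists>t. 0 \<le> t \<and> t \<le> int r - 2 \<and> nbr i (t + 2) = c (i + 1)"
    using t by (intro exI[of _ "t - 2"]) simp
  then show "0 \<le> out_degree i" "out_degree i \<le> int r - 2" "nbr i (out_degree i + 2) = c (i + 1)"
    unfolding out_degree_def by (metis (mono_tags, lifting) someI_ex)+
qed

lemma edge_nbr_in_X_iff:
  assumes "1 \<le> t" "t \<le> int r"
  shows "edge (c i) (nbr i t) \<in> X \<longleftrightarrow> t = 1 \<or> t = out_degree i + 2"
proof -
  have "nbr i t = c (i - 1) \<longleftrightarrow> t = 1"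
    using nbr_inj[of i t 1] walk.spoke_pred[of i] assms by auto
  moreover have "nbr i t = c (i + 1) \<longleftrightarrow> t = out_degree i + 2"
    using nbr_inj[of i t "out_degree i + 2"] nbr_out_degree[of i] out_degree_nonneg[of i]
      out_degree_le[of i] assms by auto
  ultimately show ?thesis
    using edge_in_X_iff[OF nbr_adjacent] by blast
qed

lemma nbr_triangle_inside_iff:
  assumes "1 \<le> t" "t \<le> int r"
  shows "triangle_interior (c i) (nbr i t) (nbr i (t + 1)) \<subseteq> inside (\<Union>X) \<longleftrightarrow> out_degree i + 2 \<le> t"
  using assms
proof (induction t rule: int_ge_induct)
  case base
  have "triangle_interior (c i) (nbr i 0) (nbr i 1) \<subseteq> inside (\<Union>X)"
    using inner_apex_inside[of "i - 1"] walk.spoke_0[of i] walk.spoke_pred[of i]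
      triangle_cong(2)[OF inner_apex[of "i - 1"], of "c i" "inner_apex (i - 1)" "c (i - 1)"]
    by (simp add: insert_commute)
  then show ?case
    using triangle_inside_flip[OF circuit walk.link_walk_spoke, of i 1] edge_nbr_in_X_iff[of 1 i] base
      out_degree_nonneg[of i] by simp
next
  case (step t)
  show ?case
  proof (cases "edge (c i) (nbr i (t + 1)) \<in> X")
    case True
    then have "\<not> out_degree i + 2 \<le> t" "out_degree i + 2 \<le> t + 1"
      using edge_nbr_in_X_iff[of "t + 1" i] step by auto
    then show ?thesis
      using triangle_inside_flip[OF circuit walk.link_walk_spoke True] step by simp
  next
    case False
    then have "out_degree i + 2 \<le> t \<longleftrightarrow> out_degree i + 2 \<le> t + 1"
      using edge_nbr_in_X_iff[of "t + 1" i] step by auto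
    then show ?thesis
      using triangle_inside_step[OF circuit walk.link_walk_spoke False] step by simp
  qed
qed

lemma nbr_inner_apex: "nbr i (out_degree i + 3) = inner_apex i"
proof -
  have "triangle (c i) (c (i + 1)) (nbr i (out_degree i + 3))"
    using surface.link_walk_succ[OF walk.link_walk_spoke, of i "out_degree i + 2"] nbr_out_degree[of i]
    by (simp add: add.assoc)
  moreover have "triangle_interior (c i) (c (i + 1)) (nbr i (out_degree i + 3)) \<subseteq> inside (\<Union>X)"
    using nbr_triangle_inside_iff[of "out_degree i + 2" i] out_degree_nonneg[of i] out_degree_le[of i]
      nbr_out_degree[of i] by (simp add: add.assoc)
  ultimately show ?thesis
    by (rule inner_apex_eq[symmetric])
qed

lemma disk_adjacent_nbr_iff:
  assumes t: "1 \<le> t" "t \<le> int r"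
  shows "disk_adjacent X (c i) (nbr i t) \<longleftrightarrow> t = 1 \<or> out_degree i + 2 \<le> t"
proof (cases "edge (c i) (nbr i t) \<in> X")
  case True
  then show ?thesis
    unfolding disk_adjacent_def disk_edges_iff[OF circuit edge_in_E[OF nbr_adjacent]]
    using nbr_adjacent edge_nbr_in_X_iff[OF t] by auto
next
  case False
  then show ?thesis
    unfolding disk_adjacent_def
    using disk_edges_iff_triangle_inside[OF circuit surface.link_walk_succ[OF walk.link_walk_spoke] False]
      nbr_triangle_inside_iff[OF t] edge_nbr_in_X_iff[OF t] nbr_adjacent by blast
qed

lemma disk_adjacent_c: "{w. disk_adjacent X (c i) w} = nbr i ` {out_degree i + 2..int r + 1}"
proof -
  have r_succ: "nbr i (int r + 1) = nbr i 1"
    by (simp add: walk.spoke_r_succ walk.spoke_pred)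
  show ?thesis
  proof
    show "{w. disk_adjacent X (c i) w} \<subseteq> nbr i ` {out_degree i + 2..int r + 1}"
    proof
      fix w assume "w \<in> {w. disk_adjacent X (c i) w}"
      then have w: "disk_adjacent X (c i) w" "adjacent (c i) w"
        unfolding disk_adjacent_def by auto
      obtain t where t: "1 \<le> t" "t \<le> int r" "w = nbr i t"
        using walk.link_walk_spoke w(2) by (rule surface.link_walk_positionE)
      then consider (first) "t = 1" | (later) "out_degree i + 2 \<le> t"
        using w(1) disk_adjacent_nbr_iff by blast
      then show "w \<in> nbr i ` {out_degree i + 2..int r + 1}"
      proof cases
        case first
        then show ?thesis
          using t(3) r_succ out_degree_le[of i] by (intro image_eqI[of _ _ "int r + 1"]) auto
      qed (use t in auto)
    qed
    show "nbr i ` {out_degree i + 2..int r + 1} \<subseteq> {w. disk_adjacent X (c i) w}"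
    proof clarify
      fix t assume t: "t \<in> {out_degree i + 2..int r + 1}"
      then show "disk_adjacent X (c i) (nbr i t)"
        using disk_adjacent_nbr_iff[of t i] disk_adjacent_nbr_iff[of 1 i] r_succ out_degree_nonneg[of i]
          degree_pos by (cases "t = int r + 1") auto
    qed
  qed
qed

lemma degree_c: "int (deg (disk_edges X) (c i)) = int r - out_degree i"
proof -
  have "deg (disk_edges X) (c i) = card {w. disk_adjacent X (c i) w}"
    unfolding disk_adjacent_def using card_adjacent_via[of "disk_edges X" "c i"] adjacent_in_V(1)[OF c_adjacent]
    by (simp add: disk_edges_def)
  moreover have "inj_on (nbr i) {out_degree i + 2..int r + 1}"
    using nbr_inj[of i] out_degree_nonneg[of i] by (auto simp: inj_on_def)
  ultimately show ?thesis
    unfolding disk_adjacent_c using out_degree_le[of i] by (simp add: card_image)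
qed

lemma edge_at_inner_vertex:
  assumes v: "v \<in> disk_vertices X" "v \<notin> range c" and w: "adjacent v w"
  shows "edge v w \<notin> X" "edge v w - V \<subseteq> inside (\<Union>X)"
proof -
  have inside: "v \<in> inside (\<Union>X)" and off: "v \<notin> \<Union>X"
    using v unfolding range_c disk_vertices_def by auto
  show notin: "edge v w \<notin> X"
    using off ends_in_edge(1)[OF w] by blast
  have "X \<subseteq> E" "jordan_curve (\<Union>X)"
    using circuit unfolding edge_circuit_def by auto
  moreover have "v \<in> closure (edge v w - V)"
    using edge_subset_closure[OF edge_in_E[OF w]] ends_in_edge(1)[OF w] by blast
  ultimately have "{v} \<subseteq> inside (\<Union>X) \<longleftrightarrow> edge v w - V \<subseteq> inside (\<Union>X)"
    using off edge_Int_Union[OF _ edge_in_E[OF w] notin] connected_edge_minus_V[OF edge_in_E[OF w]]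
    by (intro same_side_of_jordan_curve) auto
  then show "edge v w - V \<subseteq> inside (\<Union>X)"
    using inside by simp
qed

lemma inner_vertex_disk_adjacent:
  assumes "v \<in> disk_vertices X" "v \<notin> range c" "adjacent v w"
  shows "disk_adjacent X v w"
  unfolding disk_adjacent_def disk_edges_iff[OF circuit edge_in_E[OF assms(3)]]
  using edge_at_inner_vertex(2)[OF assms] assms(3) by blast

lemma triangle_inside_disk_adjacent:
  assumes tri: "triangle v x y" and "triangle_interior v x y \<subseteq> inside (\<Union>X)"
  shows "disk_adjacent X x y"
proof -
  have "triangle x y v" "triangle_interior x y v = triangle_interior v x y"
    using triangle_cong[OF tri, of x y v] by (auto simp: insert_commute)
  then show ?thesis
    unfolding disk_adjacent_def
    using triangle_inside_imp_disk_edge[OF circuit, of x y v] assms(2) triangle_adjacent(2)[OF tri] by simp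
qed

lemma inner_vertex_triangle:
  assumes v: "v \<in> disk_vertices X" "v \<notin> range c" and tri: "triangle v x y"
  shows "disk_adjacent X x y"
  using edge_at_inner_vertex[OF v triangle_adjacent(1)[OF tri]] edge_inside_iff_triangle_inside[OF circuit tri]
  by (intro triangle_inside_disk_adjacent[OF tri]) simp

lemma c_periodic: "c (i + int (length cs)) = c i"
  by (simp add: c_eq_iff)

lemma boundary_walk: "boundary_walk r adjacent triangle (int (length cs)) c inner_apex out_degree"
proof unfold_locales
  fix i
  have c_shift: "c (i + int (length cs) + 1) = c (i + 1)" "c (i + int (length cs) - 1) = c (i - 1)"
    by (simp_all add: c_eq_iff)
  have apex_periodic: "inner_apex (i + int (length cs)) = inner_apex i" for i
    unfolding inner_apex_def using c_periodic[of i] c_periodic[of "i + 1"] by (simp add: algebra_simps)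
  then show "inner_apex (i + int (length cs)) = inner_apex i" .
  have "nbr (i + int (length cs)) = nbr i"
    unfolding surface.spoke_def c_shift c_periodic using apex_periodic[of "i - 1"] by (simp add: algebra_simps)
  then show "out_degree (i + int (length cs)) = out_degree i"
    unfolding out_degree_def c_shift by simp
qed (fact length_cs c_periodic inner_apex out_degree_le nbr_out_degree nbr_inner_apex)+

end

section \<open>The expansions of a convex disk\<close>

lemma layer_count_cong_image:
  assumes inj: "inj_on f C" and sub: "\<And>n. sel (Gs n) \<subseteq> C" and image: "\<And>n. f ` sel (Gs n) = sel' (Hs n)"
  shows "layer_count sel Gs = layer_count sel' Hs"
proof
  fix n
  have "card (sel' (Hs n)) = card (sel (Gs n))"
    unfolding image[symmetric] by (rule card_image[OF inj_on_subset[OF inj sub]])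
  moreover have "card (sel' (Hs n) - sel' (Hs m)) = card (sel (Gs n) - sel (Gs m))" for m
  proof -
    have "sel (Gs n) - sel (Gs m) \<subseteq> C"
      using sub by blast
    then show ?thesis
      unfolding image[symmetric]
      using inj_on_image_set_diff[OF inj _ sub] card_image[OF inj_on_subset[OF inj]] by metis
  qed
  ultimately show "layer_count sel Gs n = layer_count sel' Hs n"
    unfolding layer_count_def by (cases n) simp_all
qed

context triangulated_mesh
begin

definition induced_subgraph :: "complex set \<Rightarrow> complex set \<times> complex set set" where
  "induced_subgraph W = (W, {e \<in> E. e \<inter> V \<subseteq> W})"

lemma expansion_induced_subgraph:
  "expansion V E (induced_subgraph W) = induced_subgraph (W \<union> {w. \<exists>v\<in>W. adjacent v w})"
proof -
  have "W \<union> {w \<in> V. \<exists>v\<in>W. adjacent v w} = W \<union> {w. \<exists>v\<in>W. adjacent v w}"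
    using adjacent_in_V(2) by blast
  then show ?thesis
    unfolding expansion_def induced_subgraph_def Let_def fst_conv by simp
qed

lemma ends_of_induced_edges:
  "(\<lambda>e. e \<inter> V) ` snd (induced_subgraph W) = surface.edges_within W"
proof
  show "(\<lambda>e. e \<inter> V) ` snd (induced_subgraph W) \<subseteq> surface.edges_within W"
  proof clarify
    fix e assume "e \<in> snd (induced_subgraph W)"
    then have e: "e \<in> E" "e \<inter> V \<subseteq> W"
      unfolding induced_subgraph_def by auto
    obtain v w where "adjacent v w" "e = edge v w"
      using e(1) by (rule edgeE)
    then show "e \<inter> V \<in> surface.edges_within W"
      using e(2) edge_Int_V unfolding surface.edges_within_def by auto
  qed
  show "surface.edges_within W \<subseteq> (\<lambda>e. e \<inter> V) ` snd (induced_subgraph W)"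
  proof
    fix s assume "s \<in> surface.edges_within W"
    then obtain v w where "s = {v, w}" "adjacent v w" "v \<in> W" "w \<in> W"
      unfolding surface.edges_within_def by auto
    then show "s \<in> (\<lambda>e. e \<inter> V) ` snd (induced_subgraph W)"
      unfolding induced_subgraph_def using edge_in_E[of v w] edge_Int_V[of v w]
      by (intro image_eqI[of _ _ "edge v w"]) auto
  qed
qed

lemma triangle_interior_in_faces_of_iff:
  assumes tri: "triangle x y z"
  shows "triangle_interior x y z \<in> faces_of V E (induced_subgraph W) \<longleftrightarrow> {x, y, z} \<subseteq> W"
proof
  assume "triangle_interior x y z \<in> faces_of V E (induced_subgraph W)"
  then have sub: "{e \<in> E. e \<subseteq> triangle_boundary x y z} \<subseteq> {e \<in> E. e \<inter> V \<subseteq> W}"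
    unfolding faces_of_def induced_subgraph_def by (simp add: frontier_triangle[OF tri])
  have "edge x y \<in> {e \<in> E. e \<subseteq> triangle_boundary x y z}" "edge y z \<in> {e \<in> E. e \<subseteq> triangle_boundary x y z}"
    using triangle_adjacent[OF tri] edge_in_E unfolding triangle_boundary_def by auto
  then have "edge x y \<inter> V \<subseteq> W" "edge y z \<inter> V \<subseteq> W"
    using sub by auto
  then show "{x, y, z} \<subseteq> W"
    by (simp add: edge_Int_V triangle_adjacent[OF tri])
next
  assume "{x, y, z} \<subseteq> W"
  then have "e \<inter> V \<subseteq> W" if "e \<subseteq> triangle_boundary x y z" for e
    using that triangle_boundary_Int_V[OF tri] by blast
  then show "triangle_interior x y z \<in> faces_of V E (induced_subgraph W)"
    unfolding faces_of_def induced_subgraph_def using triangle_face[OF tri]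
    by (auto simp: frontier_triangle[OF tri])
qed

lemma corners_of_induced_faces:
  "(\<lambda>F. frontier F \<inter> V) ` faces_of V E (induced_subgraph W) = surface.triangles_within W"
proof
  have corners: "frontier (triangle_interior x y z) \<inter> V = {x, y, z}" if "triangle x y z" for x y z
    by (simp add: that frontier_triangle triangle_boundary_Int_V)
  show "(\<lambda>F. frontier F \<inter> V) ` faces_of V E (induced_subgraph W) \<subseteq> surface.triangles_within W"
  proof clarify
    fix F assume F: "F \<in> faces_of V E (induced_subgraph W)"
    then have "F \<in> faces V E"
      unfolding faces_of_def by blast
    then obtain x y z where tri: "triangle x y z" "F = triangle_interior x y z"
      by (rule faceE)
    then have "{x, y, z} \<subseteq> W"
      using F triangle_interior_in_faces_of_iff by blast
    then show "frontier F \<inter> V \<in> surface.triangles_within W"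
      unfolding tri(2) corners[OF tri(1)] surface.triangles_within_def using tri(1) by auto
  qed
  show "surface.triangles_within W \<subseteq> (\<lambda>F. frontier F \<inter> V) ` faces_of V E (induced_subgraph W)"
  proof
    fix s assume "s \<in> surface.triangles_within W"
    then obtain x y z where s: "s = {x, y, z}" "triangle x y z" "{x, y, z} \<subseteq> W"
      unfolding surface.triangles_within_def by auto
    then show "s \<in> (\<lambda>F. frontier F \<inter> V) ` faces_of V E (induced_subgraph W)"
      using triangle_interior_in_faces_of_iff[OF s(2), of W] corners[OF s(2)]
      by (intro image_eqI[of _ _ "triangle_interior x y z"]) auto
  qed
qed

end

locale convex_mesh_disk = mesh_disk +
  assumes degree_ge_6: "r \<ge> 6" and convex: "convex_disk r V E cs"
begin

lemma out_degree_ge_2: "2 \<le> out_degree i"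
proof -
  have "c i \<in> set cs"
    using range_cyclic_nth[OF cs_neq_Nil] by blast
  then have "real (deg (disk_edges X) (c i)) \<le> 1 + real r / 2"
    using convex unfolding convex_disk_def comb_disk_eq[OF cycle] by simp
  then show ?thesis
    using degree_c[of i] degree_ge_6 by linarith
qed

sublocale disk: convex_patch r adjacent triangle "int (length cs)" c inner_apex out_degree
  "disk_vertices X" "disk_adjacent X"
proof (intro convex_patch.intro convex_boundary_walk.intro convex_patch_axioms.intro
    convex_boundary_walk_axioms.intro)
  show "disk_adjacent X (nbr i t) (nbr i (t + 1))" if "out_degree i + 2 \<le> t" "t \<le> int r" for i t
    using that nbr_triangle_inside_iff[of t i] out_degree_nonneg[of i]
    by (intro triangle_inside_disk_adjacent[OF surface.link_walk_succ[OF walk.link_walk_spoke]]) simp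
  show "disk_adjacent X (c i) w \<longleftrightarrow> w \<in> nbr i ` {out_degree i + 2..int r + 1}" for i w
    using disk_adjacent_c by blast
  show "v \<in> disk_vertices X" if "disk_adjacent X v w" for v w
    using that ends_in_edge(1) adjacent_in_V(1)
    unfolding disk_adjacent_def disk_edges_def disk_vertices_def by blast
  show "adjacent v w" if "disk_adjacent X v w" for v w
    using that unfolding disk_adjacent_def by simp
qed (fact surface.simply_connected_surface_axioms boundary_walk degree_ge_6 out_degree_ge_2 c_in_disk c_eq_iff
      finite_disk_vertices[OF circuit] disk_adjacent_sym disk_connected[OF cycle]
      inner_vertex_disk_adjacent inner_vertex_triangle)+

lemma comb_disk_eq_induced_subgraph: "comb_disk V E cs = induced_subgraph (disk.patch 0)"
proof -
  have "e \<in> disk_edges X \<longleftrightarrow> e \<inter> V \<subseteq> disk_vertices X" if "e \<in> E" for e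
  proof
    assume "e \<in> disk_edges X"
    then show "e \<inter> V \<subseteq> disk_vertices X"
      unfolding disk_edges_def disk_vertices_def by blast
  next
    assume e: "e \<inter> V \<subseteq> disk_vertices X"
    obtain v w where vw: "adjacent v w" "e = edge v w"
      using \<open>e \<in> E\<close> by (rule edgeE)
    then have "v \<in> disk_vertices X" "w \<in> disk_vertices X"
      using e edge_Int_V[OF vw(1)] by auto
    then have "disk_adjacent X v w"
      using disk.adjacent_D_iff vw(1) by simp
    then show "e \<in> disk_edges X"
      unfolding disk_adjacent_def vw(2) by simp
  qed
  then show ?thesis
    unfolding comb_disk_eq[OF cycle] induced_subgraph_def disk.patch_0 by (auto simp: disk_edges_def)
qed

abbreviation expansions :: "nat \<Rightarrow> complex set \<times> complex set set" where
  "expansions \<equiv> \<lambda>n. (expansion V E ^^ n) (comb_disk V E cs)"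

lemma expansions_eq_patches: "expansions n = induced_subgraph (disk.patch n)"
proof (induction n)
  case (Suc n)
  then show ?case
    by (simp add: expansion_induced_subgraph disk.patch_Suc_eq_neighbours)
qed (simp add: comb_disk_eq_induced_subgraph)

lemma faces_of_comb_disk: "faces_of V E (comb_disk V E cs) = disk_faces X"
  unfolding faces_of_def comb_disk_eq[OF cycle] using disk_faces_iff[OF circuit] by (auto simp: disk_faces_def)

lemma corners_of_expansions:
  "(\<lambda>e. e \<inter> V) ` snd (expansions n) = surface.edges_within (disk.patch n)"
  "(\<lambda>F. frontier F \<inter> V) ` faces_of V E (expansions n) = surface.triangles_within (disk.patch n)"
  unfolding expansions_eq_patches by (rule ends_of_induced_edges corners_of_induced_faces)+

definition layer_length :: "nat \<Rightarrow> real" where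
  "layer_length n = real_of_int (disk.len n)"

lemma layer_count_vertices: "layer_count fst expansions = layer_count disk.patch (\<lambda>n. n)"
  by (rule layer_count_cong_image[where f = "\<lambda>v. v" and C = UNIV])
    (simp_all add: expansions_eq_patches induced_subgraph_def)

lemma layer_count_edges:
  "layer_count snd expansions = layer_count surface.edges_within disk.patch"
proof (rule layer_count_cong_image)
  show "inj_on (\<lambda>e. e \<inter> V) E"
    by (rule inj_onI) (rule edge_eqI)
  show "snd (expansions n) \<subseteq> E" for n
    unfolding expansions_eq_patches induced_subgraph_def by auto
qed (rule corners_of_expansions)

lemma layer_count_faces:
  "layer_count (faces_of V E) expansions = layer_count surface.triangles_within disk.patch"
proof (rule layer_count_cong_image)
  show "faces_of V E (expansions n) \<subseteq> faces V E" for n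
    unfolding faces_of_def by blast
qed (rule inj_on_frontier_Int_V corners_of_expansions)+

lemma layer_length_recurrence:
  "layer_length (Suc (Suc n)) = (real r - 4) * layer_length (Suc n) - layer_length n"
  unfolding layer_length_def disk.len_recurrence by simp

lemma layer_count_Suc:
  "layer_count fst expansions (Suc n) = layer_length (Suc n)"
  "layer_count snd expansions (Suc n) = 2 * layer_length (Suc n) + layer_length n"
  "layer_count (faces_of V E) expansions (Suc n) = layer_length (Suc n) + layer_length n"
  unfolding layer_count_vertices layer_count_edges layer_count_faces layer_count_def layer_length_def
  using arg_cong[OF disk.card_patch_Suc_Diff[of n], of real_of_int]
    arg_cong[OF disk.card_edges_patch_Suc_Diff[of n], of real_of_int]
    arg_cong[OF disk.card_triangles_patch_Suc_Diff[of n], of real_of_int] by simp_all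

lemma euler_comb_disk:
  "layer_count fst expansions 0 + layer_count (faces_of V E) expansions 0 = layer_count snd expansions 0 + 1"
proof -
  have "layer_count fst expansions 0 = card (disk_vertices X)"
    "layer_count snd expansions 0 = card (disk_edges X)"
    "layer_count (faces_of V E) expansions 0 = card (disk_faces X)"
    by (simp_all add: layer_count_def faces_of_comb_disk) (simp_all add: comb_disk_eq[OF cycle])
  then show ?thesis
    using euler_disk[OF cycle] by simp
qed

lemma handshake_comb_disk:
  "2 * layer_count snd expansions 0 = real r * layer_count fst expansions 0 - layer_length 1 - layer_length 0"
  "3 * layer_count (faces_of V E) expansions 0 =
    real r * layer_count fst expansions 0 - layer_length 1 - 2 * layer_length 0"
  unfolding layer_count_vertices layer_count_edges layer_count_faces layer_count_def layer_length_def
  using arg_cong[OF disk.card_edges_patch[of 0], of real_of_int]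
    arg_cong[OF disk.card_triangles_patch[of 0], of real_of_int] disk.len_Suc_eq_sum[of 0] by simp_all

end

lemma lin_recI:
  assumes "\<And>n. x (Suc (Suc (Suc n))) = \<gamma> * x (Suc (Suc n)) - x (Suc n)"
  shows "lin_rec \<gamma> x"
  unfolding lin_rec_def
proof (intro allI impI)
  fix n :: nat assume "n \<ge> 1"
  then obtain m where "n = Suc m"
    by (cases n) auto
  then show "x (n + 2) = \<gamma> * x (n + 1) - x n"
    using assms[of m] by simp
qed

theorem euler_sums_of_layers:
  fixes \<rho> :: real and \<beta> vs es fs :: "nat \<Rightarrow> real"
  assumes "\<rho> \<noteq> 6"
    and rec: "\<And>n. \<beta> (Suc (Suc n)) = (\<rho> - 4) * \<beta> (Suc n) - \<beta> n"
    and layers: "\<And>n. vs (Suc n) = \<beta> (Suc n)" "\<And>n. es (Suc n) = 2 * \<beta> (Suc n) + \<beta> n"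
      "\<And>n. fs (Suc n) = \<beta> (Suc n) + \<beta> n"
    and euler: "vs 0 + fs 0 = es 0 + 1"
    and handshake: "2 * es 0 = \<rho> * vs 0 - \<beta> 1 - \<beta> 0" "3 * fs 0 = \<rho> * vs 0 - \<beta> 1 - 2 * \<beta> 0"
  shows "lin_rec (\<rho> - 4) vs" "lin_rec (\<rho> - 4) es" "lin_rec (\<rho> - 4) fs"
    and "vs 0 + euler_sum (\<rho> - 4) vs = - 6 / (\<rho> - 6)"
    and "es 0 + euler_sum (\<rho> - 4) es = - 3 * \<rho> / (\<rho> - 6)"
    and "fs 0 + euler_sum (\<rho> - 4) fs = - 2 * \<rho> / (\<rho> - 6)"
proof -
  show "lin_rec (\<rho> - 4) vs" "lin_rec (\<rho> - 4) es" "lin_rec (\<rho> - 4) fs"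
    by (rule lin_recI, simp add: layers rec algebra_simps)+
  have beta_2: "\<beta> 2 = (\<rho> - 4) * \<beta> 1 - \<beta> 0"
    using rec[of 0] by (simp add: numeral_2_eq_2)
  have beta_0: "\<beta> 0 = 3 * vs 0 - es 0 - 3" and beta_1: "\<beta> 1 = (\<rho> - 3) * vs 0 - es 0 + 3"
    and fs_0: "fs 0 = es 0 + 1 - vs 0"
    using euler handshake by (simp_all add: algebra_simps)
  have first: "vs 1 = \<beta> 1" "vs 2 = \<beta> 2" "es 1 = 2 * \<beta> 1 + \<beta> 0" "es 2 = 2 * \<beta> 2 + \<beta> 1"
    "fs 1 = \<beta> 1 + \<beta> 0" "fs 2 = \<beta> 2 + \<beta> 1"
    using layers[of 0] layers[of 1] by (simp_all add: numeral_2_eq_2)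
  have frac: "x + y / (2 - (\<rho> - 4)) = w / (\<rho> - 6)" if "x * (\<rho> - 6) - y = w" for x y w
    using \<open>\<rho> \<noteq> 6\<close> that by (simp add: divide_simps) (simp add: algebra_simps)
  show "vs 0 + euler_sum (\<rho> - 4) vs = - 6 / (\<rho> - 6)"
    unfolding euler_sum_def first beta_2 beta_0 beta_1 by (rule frac) (simp add: algebra_simps)
  show "es 0 + euler_sum (\<rho> - 4) es = - 3 * \<rho> / (\<rho> - 6)"
    unfolding euler_sum_def first beta_2 beta_0 beta_1 by (rule frac) (simp add: algebra_simps)
  show "fs 0 + euler_sum (\<rho> - 4) fs = - 2 * \<rho> / (\<rho> - 6)"
    unfolding euler_sum_def first beta_2 beta_0 beta_1 fs_0 by (rule frac) (simp add: algebra_simps)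
qed

theorem theorem1:
  fixes r :: nat and V :: "complex set" and E :: "complex set set" and cs :: "complex list"
  assumes "r > 6"
    and "mesh r V E"
    and "simple_cycle V E cs"
    and "convex_disk r V E cs"
  defines "Gs \<equiv> (\<lambda>n. (expansion V E ^^ n) (comb_disk V E cs))"
  defines "vs \<equiv> layer_count fst Gs"
    and "es \<equiv> layer_count snd Gs"
    and "fs \<equiv> layer_count (faces_of V E) Gs"
  shows "lin_rec (real r - 4) vs \<and> lin_rec (real r - 4) es \<and> lin_rec (real r - 4) fs \<and>
         vs 0 + euler_sum (real r - 4) vs = -6 / (real r - 6) \<and>
         es 0 + euler_sum (real r - 4) es = -3 * real r / (real r - 6) \<and>
         fs 0 + euler_sum (real r - 4) fs = -2 * real r / (real r - 6)"
proof -
  interpret triangulated_mesh r V E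
    using assms(1,2) by unfold_locales auto
  interpret convex_mesh_disk r V E cs
    using assms(1,3,4) by unfold_locales (auto simp: simple_cycle_iff_graph_cycle)
  have "real r \<noteq> 6"
    using assms(1) by simp
  from euler_sums_of_layers[OF this layer_length_recurrence layer_count_Suc euler_comb_disk handshake_comb_disk]
  show ?thesis
    unfolding vs_def es_def fs_def Gs_def by blast
qed

end
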